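(* With notation as in the context, for every $u\in\mathbb R^2_{<,+}$, $$d\big(e_1,\tfrac14(u,0)\big)^2=\phi\big((e_1,\tfrac14(u,0));(\Lambda^{-1}(u),0)\big).$$
   Context: $N_{3,2}$ is $\mathbb R^3\times\mathbb R^3$ with law $(x,t)\cdot(x',t')=(x+x',t+t'+\frac12\langle\mathbb Ux,x'\rangle)$, $\langle\mathbb Ux,x'\rangle=(\langle U^{(j)}x,x'\rangle)_{j=1}^3$, $\sum_j\tau_jU^{(j)}=\begin{pmatrix}0&\tau_3&-\tau_2\\-\tau_3&0&\tau_1\\\tau_2&-\tau_1&0\end{pmatrix}$, identity $o$; $d(g)$ is the Carnot–Carathéodory distance from $o$ (infimum of $\int_0^1|x'|$ over absolutely continuous curves from $o$ to $g$ with $t'=\frac12\langle\mathbb Ux,x'\rangle$); $e_1=(1,0,0)$. $\psi(s)=(1-s\cot s)/s^2$; $\phi((x,t);\tau)=|x|^2|\tau|\cot|\tau|+\psi(|\tau|)\langle\tau,x\rangle^2+4t\cdot\tau$ for $|\tau|\notin\pi\mathbb Z\setminus\{0\}$. $\vartheta_1$ is the unique solution of $\tan s=s$ in $(\pi,\frac32\pi)$. For $v=(v_1,v_2)$, $r=|v|$: $\Lambda(v)=v_2\big[\frac{\psi'(r)}{r}v_2v+2\psi(r)(0,1)\big]$, $\Omega_{-,4}=\{v:v_2<0,\ \pi<v_1<r<\vartheta_1,\ 2\psi(r)+\frac{\psi'(r)}{r}v_2^2<0\}$, $\mathbb R^2_{<,+}=\{(u_1,u_2):u_1>0,\ 0<u_2<\frac2{\sqrt\pi}\sqrt{u_1}\}$;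 $\Lambda$ is a diffeomorphism from $\Omega_{-,4}$ onto $\mathbb R^2_{<,+}$ and $\Lambda^{-1}$ denotes its inverse. *)

theory Defs
  imports "HOL-Analysis.Analysis"
begin

definition Umat :: "real^3 \<Rightarrow> real^3^3" where
  "Umat \<tau> = vector [vector [0, \<tau>$3, - \<tau>$2],
                     vector [- \<tau>$3, 0, \<tau>$1],
                     vector [\<tau>$2, - \<tau>$1, 0]]"

definition U :: "3 \<Rightarrow> real^3^3" where
  "U j = Umat (axis j 1)"

definition Uform :: "real^3 \<Rightarrow> real^3 \<Rightarrow> real^3" where
  "Uform x x' = (\<chi> j. (U j *v x) \<bullet> x')"

definition N32_mult :: "((real^3) \<times> (real^3)) \<Rightarrow> ((real^3) \<times> (real^3)) \<Rightarrow> ((real^3) \<times> (real^3))" where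
  "N32_mult g g' = (fst g + fst g', snd g + snd g' + (1/2) *\<^sub>R Uform (fst g) (fst g'))"

definition N32_id :: "(real^3) \<times> (real^3)" where
  "N32_id = (0, 0)"

definition abs_cont_on :: "real set \<Rightarrow> (real \<Rightarrow> 'a::real_normed_vector) \<Rightarrow> bool" where
  "abs_cont_on S f \<longleftrightarrow>
     (\<forall>\<epsilon>>0. \<exists>\<delta>>0. \<forall>(n::nat) (ab :: nat \<Rightarrow> real \<times> real).
        (\<forall>k<n. fst (ab k) \<in> S \<and> snd (ab k) \<in> S \<and> fst (ab k) \<le> snd (ab k)) \<and>
        (\<forall>i<n. \<forall>j<n. i \<noteq> j \<longrightarrow> snd (ab i) \<le> fst (ab j) \<or> snd (ab j) \<le> fst (ab i)) \<and>
        (\<Sum>k<n. snd (ab k) - fst (ab k)) < \<delta>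
        \<longrightarrow> (\<Sum>k<n. norm (f (snd (ab k)) - f (fst (ab k)))) < \<epsilon>)"

definition horizontal_curve :: "(real \<Rightarrow> (real^3) \<times> (real^3)) \<Rightarrow> ((real^3) \<times> (real^3)) \<Rightarrow> bool" where
  "horizontal_curve \<gamma> g \<longleftrightarrow>
     abs_cont_on {0..1} \<gamma> \<and> \<gamma> 0 = N32_id \<and> \<gamma> 1 = g \<and>
     (AE s in lborel. s \<in> {0..1} \<longrightarrow>
        \<gamma> differentiable (at s) \<and>
        snd (vector_derivative \<gamma> (at s)) =
          (1/2) *\<^sub>R Uform (fst (\<gamma> s)) (fst (vector_derivative \<gamma> (at s))))"

definition curve_length :: "(real \<Rightarrow> (real^3) \<times> (real^3)) \<Rightarrow> real" where
  "curve_length \<gamma> = integral {0..1} (\<lambda>s. norm (fst (vector_derivative \<gamma> (at s))))"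

definition cc_dist :: "(real^3) \<times> (real^3) \<Rightarrow> real" where
  "cc_dist g = Inf {curve_length \<gamma> | \<gamma>. horizontal_curve \<gamma> g}"

definition psi :: "real \<Rightarrow> real" where
  "psi s = (1 - s * cot s) / s^2"

definition phi :: "(real^3) \<times> (real^3) \<Rightarrow> real^3 \<Rightarrow> real" where
  "phi g \<tau> = (norm (fst g))^2 * norm \<tau> * cot (norm \<tau>)
             + psi (norm \<tau>) * (\<tau> \<bullet> fst g)^2 + 4 * (snd g \<bullet> \<tau>)"

definition theta1 :: real where
  "theta1 = (THE s. pi < s \<and> s < 3/2 * pi \<and> tan s = s)"

definition Lambda :: "real^2 \<Rightarrow> real^2" where
  "Lambda v = v$2 *\<^sub>R ((deriv psi (norm v) / norm v * v$2) *\<^sub>R v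
                         + (2 * psi (norm v)) *\<^sub>R vector [0, 1])"

definition Omega_m4 :: "(real^2) set" where
  "Omega_m4 = {v. v$2 < 0 \<and> pi < v$1 \<and> v$1 < norm v \<and> norm v < theta1 \<and>
                 2 * psi (norm v) + deriv psi (norm v) / norm v * (v$2)^2 < 0}"

definition R2_lt_plus :: "(real^2) set" where
  "R2_lt_plus = {u. u$1 > 0 \<and> 0 < u$2 \<and> u$2 < 2 / sqrt pi * sqrt (u$1)}"

text \<open>Inverse of the diffeomorphism Lambda : Omega_m4 \<rightarrow> R2_lt_plus.\<close>
definition Lambda_inv :: "real^2 \<Rightarrow> real^2" where
  "Lambda_inv = the_inv_into Omega_m4 Lambda"

definition e1 :: "real^3" where
  "e1 = vector [1, 0, 0]"

end

theory Submission
  imports Defs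
begin

text \<open>
  In terms of the cross product the horizontality condition reads \<open>t' = (x' \<times> x) / 2\<close>, so the task
  is to minimise the length of space curves from \<open>0\<close> to \<open>e1\<close> with prescribed area vector. Write
  such a curve as the segment plus a loop with mean \<open>m\<close>. For fixed \<open>m\<close> and a Lagrange multiplier
  \<open>\<tau>\<close> the problem is quadratic, and because the mean is fixed it stays positive for \<open>norm \<tau> <
  theta1\<close>, beyond the classical range \<open>norm \<tau> < pi\<close>. This yields a lower bound which is explicit
  in \<open>m\<close> and \<open>\<tau>\<close> and concave in \<open>\<tau>\<close>. The minimum over \<open>m\<close> of its maximum over \<open>\<tau>\<close> is attained; the
  critical point equations force \<open>\<tau>\<close> into the plane of \<open>(u, 0)\<close> and amount to \<open>Lambda \<tau> = u\<close> with
  \<open>\<tau>\<close> in \<open>Omega_m4\<close>, and the value is that of \<open>phi\<close>. A helix with constant speed attains it.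
  Injectivity of \<open>Lambda\<close> identifies \<open>\<tau>\<close> with the inverse image of \<open>u\<close>.
\<close>

unbundle cross3_syntax

subsection \<open>Trigonometric functions attached to \<open>psi\<close>\<close>

text \<open>Beyond \<open>pi\<close> no single multiplier certifies the helix: the loop functional
  itself becomes negative there, since its minimum for mean \<open>m\<close> orthogonal to
  \<open>\<tau>\<close> is \<open>- 4 * kap s\<close> times the squared norm of \<open>m\<close>,
  and \<open>kap s > 0\<close>. Fixing the mean leaves a finite bound, up to the first
  \<open>s\<close> at which loops of mean zero degenerate, namely \<open>theta1\<close>. The sharp
  bound is 12 times the part of \<open>m\<close> along \<open>\<tau>\<close>, squared, minus
  \<open>4 * kap s\<close> times the transverse part, squared. Writing
  \<open>3 + kap s = s^2 / cden s\<close> turns it into \<open>energy_lb\<close>: the squared norm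
  of \<open>m \<times> \<tau>\<close>, linear in \<open>\<tau>\<close>, divided by
  \<open>cden (norm \<tau>)\<close>. So concavity in \<open>\<tau>\<close> reduces to concavity of
  the one-variable function \<open>cden\<close>. In \<open>m\<close> the bound is not convex, so the
  minimiser is found by compactness and the unwanted critical points must be excluded by hand:
  \<open>s < pi\<close> and \<open>s = pi\<close> by the inequality between \<open>u $ 1\<close> and
  \<open>u $ 2\<close>, the boundary of the ball of multipliers by the pole of \<open>kap\<close> at
  \<open>theta1\<close>, the wrong sign of \<open>m\<close> by a reflection. What remains is also
  the preimage of \<open>u\<close> under \<open>Lambda\<close>.\<close>

definition tan_gap :: "real \<Rightarrow> real" where
  "tan_gap s = sin s - s * cos s"

text \<open>On the interval from \<open>pi\<close> to \<open>theta1\<close> the function \<open>kap\<close> equals \<open>- 1 / psi\<close>, but unlike \<open>psi\<close> it is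
  smooth at \<open>pi\<close>; there \<open>kap_slope s\<close> equals \<open>kap' s / s\<close>.\<close>

definition kap :: "real \<Rightarrow> real" where
  "kap s = - (s\<^sup>2 * sin s) / tan_gap s"

definition kap_slope :: "real \<Rightarrow> real" where
  "kap_slope s = 1 + (3 * kap s + (kap s)\<^sup>2) / s\<^sup>2"

lemma tan_gap_deriv: "(tan_gap has_real_derivative s * sin s) (at s)"
  unfolding tan_gap_def[abs_def] by (auto intro!: derivative_eq_intros)

lemma tan_gap_mono_0_pi:
  assumes "0 \<le> a" "a < b" "b \<le> pi" shows "tan_gap a < tan_gap b"
proof (rule DERIV_pos_imp_increasing_open[OF assms(2)])
  show "\<exists>y. (tan_gap has_real_derivative y) (at x) \<and> 0 < y" if "a < x" "x < b" for x
    using that assms by (intro exI[of _ "x * sin x"] conjI tan_gap_deriv mult_pos_pos sin_gt_zero) auto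
  show "continuous_on {a..b} tan_gap"
    by (rule DERIV_continuous_on[OF has_field_derivative_at_within[OF tan_gap_deriv]])
qed

lemma sin_neg_pi_2pi:
  assumes "pi < s" "s < 2 * pi" shows "sin s < 0"
proof -
  have "sin (s - pi) > 0" using assms by (intro sin_gt_zero) auto
  then show ?thesis by simp
qed

lemma cos_neg_pi_3pi2:
  assumes "pi \<le> s" "s < 3/2 * pi" shows "cos s < 0"
proof -
  have "cos (s - pi) > 0" using assms by (intro cos_gt_zero_pi) auto
  then show ?thesis by simp
qed

lemma tan_gap_anti_pi_2pi:
  assumes "pi \<le> a" "a < b" "b \<le> 2 * pi" shows "tan_gap b < tan_gap a"
proof (rule DERIV_neg_imp_decreasing_open[OF assms(2)])
  show "\<exists>y. (tan_gap has_real_derivative y) (at x) \<and> y < 0" if "a < x" "x < b" for x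
  proof (intro exI[of _ "x * sin x"] conjI tan_gap_deriv mult_pos_neg)
    have "x > pi" using that assms by linarith
    then show "0 < x" using pi_gt_zero by linarith
    show "sin x < 0" using that assms by (intro sin_neg_pi_2pi) auto
  qed
  show "continuous_on {a..b} tan_gap"
    by (rule DERIV_continuous_on[OF has_field_derivative_at_within[OF tan_gap_deriv]])
qed

lemma theta1_ex: "\<exists>s. pi < s \<and> s < 3/2 * pi \<and> tan_gap s = 0"
proof -
  have k1: "tan_gap pi > 0" by (simp add: tan_gap_def)
  have s3: "sin (3/2 * pi) = -1" "cos (3/2*pi) = 0"
  proof -
    have e: "3/2 * pi = pi / 2 + pi" by simp
    show "sin (3/2 * pi) = -1" "cos (3/2*pi) = 0"
      unfolding e by (simp_all only: sin_periodic_pi cos_periodic_pi sin_pi_half cos_pi_half minus_zero)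
  qed
  have k2: "tan_gap (3/2 * pi) < 0" unfolding tan_gap_def s3 by simp
  have "\<exists>x. pi \<le> x \<and> x \<le> 3/2 * pi \<and> tan_gap x = 0"
    using k1 k2 tan_gap_deriv by (intro IVT2) (auto intro: DERIV_isCont)
  then obtain x where x: "pi \<le> x" "x \<le> 3/2 * pi" "tan_gap x = 0" by blast
  have "x \<noteq> pi" "x \<noteq> 3/2 * pi" using x(3) k1 k2 by (metis less_irrefl)+
  with x show ?thesis by (intro exI[of _ x]) auto
qed

text \<open>On this interval the cosine does not vanish, so \<open>tan s = s\<close> says
  \<open>tan_gap s = 0\<close>; and \<open>tan_gap\<close>, smooth and strictly decreasing there,
  gives the uniqueness that the description operator in \<open>theta1\<close> requires.\<close>

lemma theta1_eq: "pi < theta1 \<and> theta1 < 3/2 * pi \<and> tan_gap theta1 = 0"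
proof -
  obtain s where s: "pi < s" "s < 3/2 * pi" "tan_gap s = 0" using theta1_ex by blast
  have iff: "tan x = x \<longleftrightarrow> tan_gap x = 0" if "pi < x" "x < 3/2 * pi" for x
    using cos_neg_pi_3pi2[of x] that by (auto simp: tan_def tan_gap_def field_simps)
  have "theta1 = s" unfolding theta1_def
  proof (rule the_equality)
    show "pi < s \<and> s < 3/2 * pi \<and> tan s = s" using s iff by auto
    fix x assume x: "pi < x \<and> x < 3/2 * pi \<and> tan x = x"
    then have "tan_gap x = 0" using iff by auto
    show "x = s"
    proof (rule ccontr)
      assume "x \<noteq> s"
      then consider "x < s" | "s < x" by linarith
      then show False
        using tan_gap_anti_pi_2pi[of x s] tan_gap_anti_pi_2pi[of s x] x s \<open>tan_gap x = 0\<close> by cases auto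
    qed
  qed
  with s show ?thesis by simp
qed

lemma theta1_bounds: "pi < theta1" "theta1 < 3/2 * pi" "tan_gap theta1 = 0"
  using theta1_eq by auto

lemma theta1_lt_2pi: "theta1 < 2 * pi"
  using theta1_bounds(2) pi_gt_zero by linarith

lemma tan_gap_pos:
  assumes "0 < s" "s < theta1" shows "tan_gap s > 0"
proof (cases "s \<le> pi")
  case True
  then show ?thesis using tan_gap_mono_0_pi[of 0 s] assms by (simp add: tan_gap_def)
next
  case False
  then have "tan_gap theta1 < tan_gap s"
    using assms theta1_lt_2pi by (intro tan_gap_anti_pi_2pi) auto
  then show ?thesis using theta1_bounds by simp
qed

lemma sc_range:
  assumes "pi \<le> s" "s < theta1"
  shows "sin s \<le> 0" "cos s < 0" "s > 3" "s < 5"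
proof -
  show "sin s \<le> 0"
    using sin_neg_pi_2pi[of s] assms theta1_lt_2pi by (cases "s = pi") auto
  show "cos s < 0" using cos_neg_pi_3pi2[of s] assms theta1_bounds by simp
  show "s > 3" using assms pi_gt3 by linarith
  show "s < 5" using assms theta1_bounds(2) pi_less_4 pi_approx by simp
qed

lemma kap_pi [simp]: "kap pi = 0" by (simp add: kap_def)

lemma kap_slope_alt:
  assumes "tan_gap s \<noteq> 0" "s \<noteq> 0"
  shows "kap_slope s = (s\<^sup>2 + s * sin s * cos s - 2 * (sin s)\<^sup>2) / (tan_gap s)\<^sup>2"
proof -
  have "kap_slope s * (tan_gap s)\<^sup>2 = (tan_gap s)\<^sup>2 - 3 * sin s * tan_gap s + s\<^sup>2 * (sin s)\<^sup>2"
    unfolding kap_slope_def kap_def using assms by (simp add: field_simps power2_eq_square)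
  also have "\<dots> = s\<^sup>2 + s * sin s * cos s - 2 * (sin s)\<^sup>2 + s\<^sup>2 * ((sin s)\<^sup>2 + (cos s)\<^sup>2 - 1)"
    unfolding tan_gap_def by algebra
  also have "\<dots> = s\<^sup>2 + s * sin s * cos s - 2 * (sin s)\<^sup>2" by simp
  finally show ?thesis using assms by (simp add: field_simps)
qed

text \<open>\<open>kap s\<close> is \<open>- s\<close> times the logarithmic derivative of
  \<open>tan_gap\<close>, and \<open>tan_gap'' = (2 / s) * tan_gap' - tan_gap\<close>. Hence the
  Riccati equation \<open>s * kap' = s^2 + 3 * kap + kap^2\<close>, whose right-hand side is
  \<open>s^2 * kap_slope s\<close>.\<close>

lemma kap_deriv:
  assumes "tan_gap s \<noteq> 0" "s \<noteq> 0"
  shows "(kap has_real_derivative s * kap_slope s) (at s)"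
proof -
  have "(kap has_real_derivative
     (- (2 * s * sin s + s\<^sup>2 * cos s) * tan_gap s - (- (s\<^sup>2 * sin s)) * (s * sin s)) / (tan_gap s *
         tan_gap s)) (at s)"
    unfolding kap_def[abs_def]
    by (rule derivative_eq_intros tan_gap_deriv refl assms | simp add: assms)+
  moreover have id: "(- (2 * s * sin s + s\<^sup>2 * cos s) * tan_gap s - (- (s\<^sup>2 * sin s)) * (s * sin s))
      = s * (s\<^sup>2 + s * sin s * cos s - 2 * (sin s)\<^sup>2) + s ^ 3 * ((sin s)\<^sup>2 + (cos s)\<^sup>2 - 1)"
    unfolding tan_gap_def by algebra
  ultimately have "(kap has_real_derivative
     s * (s\<^sup>2 + s * sin s * cos s - 2 * (sin s)\<^sup>2) / (tan_gap s * tan_gap s)) (at s)"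
    unfolding id by simp
  then show ?thesis
    by (simp add: kap_slope_alt[OF assms] power2_eq_square)
qed

lemma kap_slope_deriv:
  assumes "tan_gap s \<noteq> 0" "s \<noteq> 0"
  shows "(kap_slope has_real_derivative
     (6 * s * sin s - 3 * s\<^sup>2 * cos s - 3 * (sin s)\<^sup>2 * cos s - s * sin s ^ 3 - 2 * s ^ 3 * sin s)
       / tan_gap s ^ 3) (at s)" (is "(_ has_real_derivative ?N / _) _")
proof -
  define h where "h = (\<lambda>s. (s\<^sup>2 + s * sin s * cos s - 2 * (sin s)\<^sup>2) / (tan_gap s)\<^sup>2)"
  define M where "M = (2 * s + (sin s * cos s + s * (cos s * cos s - sin s * sin s)) - 4 * sin s * cos s)
      * (tan_gap s)\<^sup>2
       - (s\<^sup>2 + s * sin s * cos s - 2 * (sin s)\<^sup>2) * (2 * tan_gap s * (s * sin s))"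
  have d: "(h has_real_derivative M / ((tan_gap s)\<^sup>2 * (tan_gap s)\<^sup>2)) (at s)"
    unfolding h_def M_def
    by (rule derivative_eq_intros tan_gap_deriv refl assms | simp add: assms algebra_simps)+
  have "M = (?N + (4 * s * sin s - s\<^sup>2 * cos s) * ((sin s)\<^sup>2 + (cos s)\<^sup>2 - 1)) * tan_gap s"
    unfolding M_def tan_gap_def by algebra
  then have "M = ?N * tan_gap s" by simp
  then have "M / ((tan_gap s)\<^sup>2 * (tan_gap s)\<^sup>2) = ?N * tan_gap s / (tan_gap s ^ 3 * tan_gap s)"
    by (simp add: power2_eq_square power3_eq_cube)
  also have "\<dots> = ?N / tan_gap s ^ 3" using assms by simp
  finally have d': "(h has_real_derivative ?N / tan_gap s ^ 3) (at s)" using d by simp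
  have "open {x. tan_gap x * x \<noteq> 0}"
    using tan_gap_deriv
    by (intro open_Collect_neq continuous_intros continuous_at_imp_continuous_on ballI DERIV_isCont)
  then have "\<forall>\<^sub>F x in nhds s. x \<in> {x. tan_gap x * x \<noteq> 0}"
    using assms by (intro eventually_nhds_in_open) auto
  then have "\<forall>\<^sub>F x in nhds s. h x = kap_slope x"
    by eventually_elim (simp add: kap_slope_alt h_def)
  then show ?thesis using d' DERIV_cong_ev[of s s h kap_slope] by (simp add: assms)
qed

lemma tan_gap_nz: "\<lbrakk>pi \<le> s; s < theta1\<rbrakk> \<Longrightarrow> tan_gap s \<noteq> 0" "\<lbrakk>pi \<le> s; s < theta1\<rbrakk> \<Longrightarrow> s \<noteq> 0"
  using tan_gap_pos[of s] pi_gt_zero by linarith+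

text \<open>Beyond \<open>pi\<close> the sine is nonpositive and the cosine negative. In the
  numerator of the derivative only \<open>6 * s * sin s\<close> has the wrong sign, and
  \<open>- 2 * s^3 * sin s\<close> absorbs it because \<open>s^2\<close> exceeds 3.\<close>

lemma kap_slope_strict_mono:
  assumes "pi \<le> a" "a < b" "b < theta1" shows "kap_slope a < kap_slope b"
proof (rule DERIV_pos_imp_increasing[OF assms(2)])
  fix x assume x: "a \<le> x" "x \<le> b"
  have r: "pi \<le> x" "x < theta1" using x assms by auto
  note s = sc_range[OF r]
  have kp: "tan_gap x > 0" using tan_gap_pos r s by simp
  have sq: "3 \<le> x\<^sup>2" using mult_mono[of 3 x 3 x] s by (simp add: power2_eq_square)
  have "0 \<le> - sin x * (2 * x * (x\<^sup>2 - 3))" using s sq by (intro mult_nonneg_nonneg) auto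
  moreover have "0 < - (3 * x\<^sup>2 * cos x)" using s by (simp add: mult_pos_neg)
  moreover have "0 \<le> - (3 * (sin x)\<^sup>2 * cos x)" using s by (simp add: mult_nonneg_nonpos)
  moreover have "0 \<le> - (x * sin x ^ 3)"
  proof -
    have "sin x ^ 3 \<le> 0" using s by (simp add: power3_eq_cube mult_nonneg_nonpos mult_nonpos_nonpos)
    then show ?thesis using s by (simp add: mult_nonneg_nonpos)
  qed
  ultimately have "0 < 6 * x * sin x - 3 * x\<^sup>2 * cos x - 3 * (sin x)\<^sup>2 * cos x - x * sin x ^ 3 - 2 * x ^ 3
      * sin x"
    by (simp add: algebra_simps power2_eq_square power3_eq_cube)
  then show "\<exists>y. (kap_slope has_real_derivative y) (at x) \<and> 0 < y"
    using kp kap_slope_deriv[OF tan_gap_nz[OF r]] by (meson divide_pos_pos zero_less_power)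
qed

lemma kap_slope_pi [simp]: "kap_slope pi = 1" by (simp add: kap_slope_def)

lemma kap_slope_ge_1: "\<lbrakk>pi \<le> s; s < theta1\<rbrakk> \<Longrightarrow> 1 \<le> kap_slope s"
  using kap_slope_strict_mono[of pi s] by (cases "s = pi") auto

lemma kap_strict_mono:
  assumes "pi \<le> a" "a < b" "b < theta1" shows "kap a < kap b"
proof (rule DERIV_pos_imp_increasing[OF assms(2)])
  fix x assume x: "a \<le> x" "x \<le> b"
  have r: "pi \<le> x" "x < theta1" using x assms by auto
  show "\<exists>y. (kap has_real_derivative y) (at x) \<and> 0 < y"
    using kap_slope_ge_1[OF r] sc_range[OF r]
    by (intro exI[of _ "x * kap_slope x"] conjI kap_deriv[OF tan_gap_nz[OF r]] mult_pos_pos) auto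
qed

lemma kap_pos: "\<lbrakk>pi < s; s < theta1\<rbrakk> \<Longrightarrow> 0 < kap s"
  using kap_strict_mono[of pi s] by simp

lemma kap_nonneg: "\<lbrakk>pi \<le> s; s < theta1\<rbrakk> \<Longrightarrow> 0 \<le> kap s"
  using kap_pos[of s] by (cases "s = pi") auto

text \<open>At \<open>theta1\<close> the denominator \<open>tan_gap\<close> tends to 0 from above
  while the numerator keeps a positive limit. This pole later keeps maximisers off the boundary of
  the ball of multipliers.\<close>

lemma kap_unbounded: "\<exists>s. pi < s \<and> s < theta1 \<and> M \<le> kap s"
proof -
  define c where "c = - (theta1\<^sup>2 * sin theta1)"
  have "c > 0" using sin_neg_pi_2pi[of theta1] theta1_bounds theta1_lt_2pi pi_gt_zero
    by (auto simp: c_def mult_pos_neg)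
  have l1: "((\<lambda>s. - (s\<^sup>2 * sin s)) \<longlongrightarrow> c) (at_left theta1)"
    unfolding c_def by (auto intro!: tendsto_intros)
  have "(tan_gap \<longlongrightarrow> 0) (at_left theta1)"
    using DERIV_isCont[OF tan_gap_deriv, of theta1] theta1_bounds(3)
    by (metis isCont_def filterlim_at_split)
  moreover have "\<forall>\<^sub>F x in at_left theta1. 0 < tan_gap x"
    using theta1_bounds tan_gap_pos pi_gt_zero by (intro eventually_at_leftI[of pi]) auto
  ultimately have "filterlim kap at_top (at_left theta1)"
    unfolding kap_def[abs_def]
    by (intro LIM_at_top_divide[OF l1 \<open>c > 0\<close>]) auto
  then have "\<forall>\<^sub>F x in at_left theta1. M \<le> kap x" by (simp add: filterlim_at_top)
  moreover have "\<forall>\<^sub>F x in at_left theta1. pi < x \<and> x < theta1"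
    using theta1_bounds by (intro eventually_at_leftI[of pi]) auto
  ultimately have "\<forall>\<^sub>F x in at_left theta1. pi < x \<and> x < theta1 \<and> M \<le> kap x"
    by eventually_elim auto
  then show ?thesis using eventually_happens trivial_limit_at_left_real by blast
qed

text \<open>In terms of the variable \<open>s\<^sup>2\<close>, the function \<open>kap\<close> is convex and vanishes at \<open>pi\<^sup>2\<close>.\<close>

lemma kap_le_kap_slope:
  assumes "pi \<le> s" "s < theta1" shows "2 * kap s \<le> kap_slope s * (s\<^sup>2 - pi\<^sup>2)"
proof (cases "s = pi")
  case False
  define f where "f = (\<lambda>x. kap_slope s * (x\<^sup>2 - pi\<^sup>2) - 2 * kap x)"
  have "f pi \<le> f s"
  proof (rule DERIV_nonneg_imp_nondecreasing[OF assms(1)])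
    fix x assume x: "pi \<le> x" "x \<le> s"
    then have r: "pi \<le> x" "x < theta1" using assms by auto
    have "(f has_real_derivative 2 * x * (kap_slope s - kap_slope x)) (at x)"
      unfolding f_def using kap_deriv[OF tan_gap_nz[OF r]]
      by (auto intro!: derivative_eq_intros simp: algebra_simps)
    moreover have "kap_slope x \<le> kap_slope s" using kap_slope_strict_mono[of x s] x assms by (cases "x =
        s") auto
    ultimately show "\<exists>y. (f has_real_derivative y) (at x) \<and> 0 \<le> y"
      using sc_range[OF r] by auto
  qed
  then show ?thesis by (simp add: f_def)
qed simp

lemma psi_kap:
  assumes "pi < s" "s < theta1" shows "psi s = - 1 / kap s"
proof -
  have "sin s < 0" using sin_neg_pi_2pi assms theta1_lt_2pi by simp
  moreover have "tan_gap s \<noteq> 0" "s \<noteq> 0" using tan_gap_nz assms by auto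
  ultimately show ?thesis
    by (simp add: psi_def kap_def tan_gap_def cot_def field_simps power2_eq_square)
qed

lemma psi_deriv:
  assumes "pi < s" "s < theta1"
  shows "(psi has_real_derivative s * kap_slope s / (kap s)\<^sup>2) (at s)"
proof -
  have "((\<lambda>x. - 1 / kap x) has_real_derivative s * kap_slope s / (kap s)\<^sup>2) (at s)"
    using kap_deriv[of s] tan_gap_nz[of s] kap_pos[OF assms] assms
    by (auto intro!: derivative_eq_intros simp: power2_eq_square)
  moreover have "\<forall>\<^sub>F x in nhds s. - 1 / kap x = psi x"
    using assms psi_kap by (intro eventually_nhds_in_open[THEN eventually_mono, of "{pi<..<theta1}"]) auto
  ultimately show ?thesis using DERIV_cong_ev[of s s "\<lambda>x. - 1 / kap x" psi] by simp
qed

lemma deriv_psi: "\<lbrakk>pi < s; s < theta1\<rbrakk> \<Longrightarrow> deriv psi s = s * kap_slope s / (kap s)\<^sup>2"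
  using psi_deriv DERIV_imp_deriv by blast

section \<open>Strict concavity of the denominator \<open>cden\<close>\<close>

definition cden_tail :: "real \<Rightarrow> real" where
  "cden_tail s = s\<^sup>2 / (3 + kap s)"

text \<open>The derivative of \<open>e = cden_tail s\<close>, expressed through \<open>e\<close> by
  the Riccati equation for \<open>kap\<close>. Its sign and monotonicity then need only bounds on
  \<open>e\<close> and \<open>s\<close>, with no trigonometry.\<close>

definition cden_slope :: "real \<Rightarrow> real" where
  "cden_slope s = (5 * cden_tail s - (cden_tail s)\<^sup>2 - s\<^sup>2) / s"

text \<open>Beyond \<open>pi\<close> one has \<open>s\<^sup>2 / cden s = 3 + kap s\<close>, the sharp value. Below \<open>pi\<close> the sharp value of \<open>cden\<close> is
  replaced by a smaller quadratic, which makes \<open>cden\<close> visibly concave.\<close>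

definition cden :: "real \<Rightarrow> real" where
  "cden s = (if s \<le> pi then pi\<^sup>2 / 2 - s\<^sup>2 / 6 else cden_tail s)"

lemma cden_tail_pi: "cden_tail pi = pi\<^sup>2 / 3" by (simp add: cden_tail_def)

lemma pi_sq_bounds: "9 < pi\<^sup>2" "pi\<^sup>2 < 9.9"
proof -
  have "3 * 3 < pi * pi" using pi_gt3 by (intro mult_strict_mono) auto
  then show "9 < pi\<^sup>2" by (simp add: power2_eq_square)
  have "pi < 3.1416" using pi_approx by simp
  then have "pi * pi \<le> 3.1416 * 3.1416" by (intro mult_mono) auto
  then show "pi\<^sup>2 < 9.9" by (simp add: power2_eq_square)
qed

lemma cden_tail_pos: "\<lbrakk>pi \<le> s; s < theta1\<rbrakk> \<Longrightarrow> 0 < cden_tail s"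
  using kap_nonneg[of s] tan_gap_nz[of s] by (auto simp: cden_tail_def)

lemma cden_tail_deriv:
  assumes "pi \<le> s" "s < theta1"
  shows "(cden_tail has_real_derivative cden_slope s) (at s)"
proof -
  define z where "z = 3 + kap s"
  have z: "z > 0" using kap_nonneg[OF assms] by (simp add: z_def)
  have s: "s \<noteq> 0" using tan_gap_nz assms by auto
  have "(cden_tail has_real_derivative (2 * s * z - s\<^sup>2 * (s * kap_slope s)) / (z * z)) (at s)"
    unfolding cden_tail_def[abs_def] z_def using kap_deriv[OF tan_gap_nz[OF assms]] z
    by (auto intro!: derivative_eq_intros simp: z_def)
  moreover have "s\<^sup>2 * kap_slope s = s\<^sup>2 + z\<^sup>2 - 3 * z"
    using s by (simp add: kap_slope_def z_def field_simps power2_eq_square)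
  then have "2 * s * z - s\<^sup>2 * (s * kap_slope s) = s * (5 * z - z\<^sup>2 - s\<^sup>2)"
    by algebra
  moreover have "s * (5 * z - z\<^sup>2 - s\<^sup>2) / (z * z) = cden_slope s"
    unfolding cden_slope_def cden_tail_def z_def[symmetric] using s z
    by (simp add: field_simps power2_eq_square)
  ultimately show ?thesis by simp
qed

lemma cden_slope_neg:
  assumes "pi \<le> s" "s < theta1" shows "cden_slope s < 0"
proof -
  have "0 \<le> (cden_tail s - 5/2)\<^sup>2" by simp
  then have "5 * cden_tail s - (cden_tail s)\<^sup>2 \<le> 25/4" by (simp add: power2_eq_square field_simps)
  moreover have "9 < s\<^sup>2" using pi_sq_bounds assms by (smt (verit) pi_ge_zero power_mono)
  ultimately show ?thesis unfolding cden_slope_def using sc_range[OF assms] by (simp add: divide_neg_pos)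
qed

lemma cden_tail_le:
  assumes "pi \<le> s" "s < theta1" shows "cden_tail s \<le> pi\<^sup>2 / 3"
proof -
  have "cden_tail s \<le> cden_tail pi"
  proof (rule DERIV_nonpos_imp_nonincreasing[OF assms(1)])
    fix x assume "pi \<le> x" "x \<le> s"
    then have "pi \<le> x" "x < theta1" using assms by auto
    then show "\<exists>y. (cden_tail has_real_derivative y) (at x) \<and> y \<le> 0"
      using cden_tail_deriv cden_slope_neg less_imp_le by blast
  qed
  then show ?thesis by (simp add: cden_tail_pi)
qed

text \<open>Differentiating the Riccati equation once more leaves the sign of
  \<open>(2 * e - 4) * N - 2 * s^2\<close>, where \<open>N\<close> is positive; only
  \<open>e > 2\<close> needs an estimate.\<close>

lemma cden_slope_strict_anti:
  assumes "pi \<le> a" "a < b" "b < theta1" shows "cden_slope b < cden_slope a"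
proof (rule DERIV_neg_imp_decreasing[OF assms(2)])
  fix s assume "a \<le> s" "s \<le> b"
  then have r: "pi \<le> s" "s < theta1" using assms by auto
  have s0: "s \<noteq> 0" "0 < s" using sc_range[OF r] by auto
  define e where "e = cden_tail s"
  define N where "N = s\<^sup>2 + e\<^sup>2 - 5 * e"
  have dN: "cden_slope s = - N / s" by (simp add: cden_slope_def N_def e_def)
  have "(cden_slope has_real_derivative (((5 - 2 * e) * cden_slope s - 2 * s) * s - (5 * e - e\<^sup>2 - s\<^sup>2)) /
      (s * s)) (at s)"
  proof -
    define D where "D = cden_slope s"
    have "((\<lambda>s. (5 * cden_tail s - (cden_tail s)\<^sup>2 - s\<^sup>2) / s) has_real_derivative
        (((5 - 2 * e) * D - 2 * s) * s - (5 * e - e\<^sup>2 - s\<^sup>2)) / (s * s)) (at s)"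
      unfolding e_def using s0 cden_tail_deriv[OF r, folded D_def]
      by (auto intro!: derivative_eq_intros simp: algebra_simps)
    then show ?thesis unfolding D_def by (simp add: cden_slope_def[abs_def])
  qed
  moreover have "((5 - 2 * e) * cden_slope s - 2 * s) * s - (5 * e - e\<^sup>2 - s\<^sup>2) = (2 * e - 4) * N - 2 * s\<^sup>2"
    using s0 by (simp add: dN field_simps power2_eq_square) (simp add: N_def power2_eq_square algebra_simps)
  moreover have "(2 * e - 4) * N - 2 * s\<^sup>2 < 0"
  proof -
    have Np: "N > 0" using cden_slope_neg[OF r] s0 by (simp add: dN zero_less_divide_iff)
    have eb: "0 < e" "e \<le> 3.3" using cden_tail_pos[OF r] cden_tail_le[OF r] pi_sq_bounds by (auto simp: e_def)
    have s2: "s\<^sup>2 < 22.3"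
    proof -
      have "s < 4.7124" using r theta1_bounds(2) pi_approx by simp
      then have "s * s \<le> 4.7124 * 4.7124" using s0 by (intro mult_mono) auto
      then show ?thesis by (simp add: power2_eq_square)
    qed
    show ?thesis
    proof (cases "e \<le> 2")
      case True
      then have "(2 * e - 4) * N \<le> 0" using Np by (simp add: mult_nonpos_nonneg)
      moreover have "0 < s\<^sup>2" using s0 by simp
      ultimately show ?thesis by linarith
    next
      case False
      \<comment> \<open>On the interval from 2 to 3.3 the parabola \<open>e^2 - 5 * e\<close> lies
        below its chord. The bound 3.3 comes from \<open>pi^2 / 3\<close>, the factor 13/5 below is
        \<open>2 * 3.3 - 4\<close>, and 22.3 bounds the square of \<open>3/2 * pi\<close>.\<close>
      have "(e - 2) * (e - 3.3) \<le> 0" using False eb by (intro mult_nonneg_nonpos) auto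
      then have "e\<^sup>2 - 5 * e \<le> 0.3 * e - 6.6" by (simp add: power2_eq_square field_simps)
      also have "\<dots> \<le> -5.61" using eb by simp
      finally have "N \<le> s\<^sup>2 - 5.61" by (simp add: N_def)
      then have "(2 * e - 4) * N \<le> 13/5 * (s\<^sup>2 - 561/100)"
        using False eb Np by (intro mult_mono) (auto simp: power2_eq_square)
      moreover have "s\<^sup>2 < 223/10" using s2 by simp
      ultimately show ?thesis by (simp add: algebra_simps)
    qed
  qed
  ultimately show "\<exists>y. (cden_slope has_real_derivative y) (at s) \<and> y < 0"
    using s0 by (intro exI[of _ "((2 * e - 4) * N - 2 * s\<^sup>2) / (s * s)"] conjI)
      (auto intro!: divide_neg_pos)
qed

lemma cden_tail_support:
  assumes x: "pi \<le> x" "x < theta1" and s: "pi \<le> s" "s < theta1" and "s \<noteq> x"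
  shows "cden_tail s < cden_tail x + cden_slope x * (s - x)"
proof (cases "x < s")
  case True
  obtain z where z: "x < z" "z < s" "cden_tail s - cden_tail x = (s - x) * cden_slope z"
    using MVT2[OF True, of cden_tail cden_slope] cden_tail_deriv x s by force
  have "cden_slope z < cden_slope x" using cden_slope_strict_anti[of x z] z x s by auto
  then have "(s - x) * cden_slope z < (s - x) * cden_slope x" using True by simp
  then show ?thesis using z by (simp add: algebra_simps)
next
  case False
  then have lt: "s < x" using assms by auto
  obtain z where z: "s < z" "z < x" "cden_tail x - cden_tail s = (x - s) * cden_slope z"
    using MVT2[OF lt, of cden_tail cden_slope] cden_tail_deriv x s by force
  have "cden_slope x < cden_slope z" using cden_slope_strict_anti[of z x] z x s by auto
  then have "(x - s) * cden_slope x < (x - s) * cden_slope z" using lt by simp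
  then show ?thesis using z by (simp add: algebra_simps)
qed

text \<open>\<open>- pi / 3\<close> is the slope at \<open>pi\<close> of the quadratic used below
  \<open>pi\<close>. The two pieces of \<open>cden\<close> thus meet in a concave corner, thanks to
  \<open>9 < pi^2\<close>.\<close>

lemma cden_slope_pi: "cden_slope pi \<le> - pi / 3"
proof -
  have "0 \<le> pi\<^sup>2 * (pi\<^sup>2 - 9)" using pi_sq_bounds by (intro mult_nonneg_nonneg) auto
  then show ?thesis unfolding cden_slope_def cden_tail_pi by (simp add: field_simps power2_eq_square)
qed

text \<open>A strict supporting line at every point expresses strict concavity across the corner at
  \<open>pi\<close>, where second derivatives are of no use. Strict midpoint concavity and strict
  decrease are both read off from it.\<close>

lemma cden_support:
  assumes "0 \<le> x" "x < theta1" "0 \<le> s" "s < theta1" "s \<noteq> x"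
  shows "cden s < cden x + (if x \<le> pi then - x / 3 else cden_slope x) * (s - x)"
proof -
  let ?q = "\<lambda>s. pi\<^sup>2 / 2 - s\<^sup>2 / (6::real)"
  have q_pi: "?q pi = cden_tail pi" by (simp add: cden_tail_pi)
  have q_tan: "?q s' \<le> ?q x' + (- x' / 3) * (s' - x')" for s' x'
  proof -
    have "0 \<le> (s' - x')\<^sup>2 / 6" by simp
    then show ?thesis by (simp add: power2_eq_square field_simps)
  qed
  consider "x \<le> pi" "s \<le> pi" | "x \<le> pi" "pi < s" | "pi < x" "pi \<le> s" | "pi < x" "s < pi" by linarith
  then show ?thesis
  proof cases
    case 1
    have "0 < (s - x)\<^sup>2 / 6" using assms by simp
    then show ?thesis using 1 by (simp add: cden_def power2_eq_square field_simps)
  next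
    case 2
    have "cden_tail s < cden_tail pi + cden_slope pi * (s - pi)" using 2 assms theta1_bounds by (intro
        cden_tail_support) auto
    also have "cden_slope pi * (s - pi) \<le> (- pi / 3) * (s - pi)" using cden_slope_pi 2 by (intro
        mult_right_mono) auto
    also have "\<dots> \<le> (- x / 3) * (s - pi)" using 2 by (intro mult_right_mono) auto
    also have "cden_tail pi \<le> ?q x + (- x / 3) * (pi - x)" using q_tan[of pi x] q_pi by simp
    finally have "cden_tail s < ?q x + ((- x / 3) * (pi - x) + (- x / 3) * (s - pi))" by simp
    also have "(- x / 3) * (pi - x) + (- x / 3) * (s - pi) = (- x / 3) * (s - x)"
      by (simp add: field_simps)
    finally show ?thesis using 2 by (simp add: cden_def)
  next
    case 3
    then show ?thesis using cden_tail_support[of x s] assms q_pi by (auto simp: cden_def)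
  next
    case 4
    have "cden_tail pi < cden_tail x + cden_slope x * (pi - x)" using 4 assms theta1_bounds by (intro
        cden_tail_support) auto
    moreover have "?q s \<le> cden_tail pi + (- pi / 3) * (s - pi)" using q_tan[of s pi] q_pi by simp
    moreover have "(- pi / 3) * (s - pi) \<le> cden_slope x * (s - pi)"
      using cden_slope_pi cden_slope_strict_anti[of pi x] 4 assms by (intro mult_right_mono_neg) auto
    ultimately show ?thesis using 4 by (simp add: cden_def algebra_simps)
  qed
qed

lemma cden_midpoint:
  assumes "0 \<le> x" "x < theta1" "0 \<le> y" "y < theta1" "x \<noteq> y"
  shows "(cden x + cden y) / 2 < cden ((x + y) / 2)"
  using cden_support[of "(x + y) / 2" x] cden_support[of "(x + y) / 2" y] assms
  by (auto simp: field_simps split: if_splits)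

lemma cden_strict_anti:
  assumes "0 \<le> a" "a < b" "b < theta1" shows "cden b < cden a"
proof -
  have "cden b < cden a + (if a \<le> pi then - a / 3 else cden_slope a) * (b - a)"
    using assms by (intro cden_support) auto
  moreover have "(if a \<le> pi then - a / 3 else cden_slope a) * (b - a) \<le> 0"
    using assms cden_slope_neg[of a] by (intro mult_nonpos_nonneg) auto
  ultimately show ?thesis by linarith
qed

lemma cden_pos:
  assumes "0 \<le> s" "s < theta1" shows "0 < cden s"
proof (cases "s \<le> pi")
  case True
  then have "s\<^sup>2 \<le> pi\<^sup>2" using assms by (intro power_mono) auto
  then show ?thesis using True pi_sq_bounds by (simp add: cden_def)
qed (use cden_tail_pos[of s] assms in \<open>auto simp: cden_def\<close>)

lemma cden_ge_pi: "\<lbrakk>pi \<le> s; s < theta1\<rbrakk> \<Longrightarrow> cden s = cden_tail s"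
  using cden_tail_pi by (cases "s = pi") (auto simp: cden_def)

lemma sq_div_cden: "\<lbrakk>pi \<le> s; s < theta1\<rbrakk> \<Longrightarrow> s\<^sup>2 / cden s = 3 + kap s"
  using kap_nonneg[of s] tan_gap_nz[of s] by (simp add: cden_ge_pi cden_tail_def)

lemma cden_continuous_on: "continuous_on {0..<theta1} cden"
proof -
  have "continuous_on ({0..pi} \<union> {pi..<theta1}) (\<lambda>s. if s \<le> pi then pi\<^sup>2 / 2 - s\<^sup>2 / 6 else cden_tail s)"
  proof (rule continuous_on_cases_local)
    show "closedin (top_of_set ({0..pi} \<union> {pi..<theta1})) {0..pi}"
      by (rule closed_subset) auto
    have "{0..pi} \<union> {pi..<theta1} = {0..<theta1}" using theta1_bounds by auto
    then show "closedin (top_of_set ({0..pi} \<union> {pi..<theta1})) {pi..<theta1}"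
      by (auto simp: closedin_closed intro!: exI[of _ "{pi..}"])
    show "continuous_on {pi..<theta1} cden_tail"
      using cden_tail_deriv by (intro continuous_at_imp_continuous_on ballI DERIV_isCont) auto
    show "continuous_on {0..pi} (\<lambda>s. pi\<^sup>2 / 2 - s\<^sup>2 / (6::real))" by (intro continuous_intros) auto
    show "\<And>x. (x \<in> {0..pi} \<and> \<not> x \<le> pi) \<or> (x \<in> {pi..<theta1} \<and> x \<le> pi) \<Longrightarrow> pi\<^sup>2 / 2 - x\<^sup>2 / 6 = cden_tail x"
      by (auto simp: cden_tail_pi)
  qed
  moreover have "{0..pi} \<union> {pi..<theta1} = {0..<theta1}" using theta1_bounds by auto
  ultimately show ?thesis by (simp add: cden_def[abs_def])
qed

section \<open>Comparison of \<open>cden\<close> with the sharp constant\<close>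

text \<open>From \<open>f 0 = 0\<close> the function first rises and then falls, so its value at the
  right end decides between a single sign change and none.\<close>

lemma sign_pattern_integrate:
  fixes f h :: "real \<Rightarrow> real"
  assumes d: "\<And>x. (f has_real_derivative h x) (at x)"
    and a: "0 \<le> a" "a \<le> b"
    and pos: "\<And>x. \<lbrakk>0 \<le> x; x \<le> a\<rbrakk> \<Longrightarrow> 0 \<le> h x"
    and neg: "\<And>x. \<lbrakk>a \<le> x; x \<le> b\<rbrakk> \<Longrightarrow> h x \<le> 0"
    and f0: "f 0 = 0"
  shows "f b \<le> 0 \<Longrightarrow> \<exists>c. 0 \<le> c \<and> c \<le> b \<and> (\<forall>x. 0 \<le> x \<and> x \<le> c \<longrightarrow> 0 \<le> f x) \<and> (\<forall>x. c \<le> x \<and> x \<le> b \<longrightarrow> f x \<le> 0)"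
    and "\<lbrakk>0 \<le> f b; 0 \<le> x; x \<le> b\<rbrakk> \<Longrightarrow> 0 \<le> f x"
proof -
  have inc: "0 \<le> f x" if "0 \<le> x" "x \<le> a" for x
  proof -
    have "f 0 \<le> f x"
    proof (rule DERIV_nonneg_imp_nondecreasing[OF that(1)])
      fix z assume "0 \<le> z" "z \<le> x"
      then have "0 \<le> z" "z \<le> a" using that by auto
      then show "\<exists>y. (f has_real_derivative y) (at z) \<and> 0 \<le> y" using d pos by blast
    qed
    then show ?thesis by (simp add: f0)
  qed
  have dec: "f y \<le> f x" if "a \<le> x" "x \<le> y" "y \<le> b" for x y
  proof (rule DERIV_nonpos_imp_nonincreasing[OF that(2)])
    fix z assume "x \<le> z" "z \<le> y"
    then have "a \<le> z" "z \<le> b" using that by auto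
    then show "\<exists>y. (f has_real_derivative y) (at z) \<and> y \<le> 0" using d neg by blast
  qed
  show "0 \<le> f x" if "0 \<le> f b" "0 \<le> x" "x \<le> b"
    using inc[of x] dec[of x b] that a by (cases "x \<le> a") auto
  show "\<exists>c. 0 \<le> c \<and> c \<le> b \<and> (\<forall>x. 0 \<le> x \<and> x \<le> c \<longrightarrow> 0 \<le> f x) \<and> (\<forall>x. c \<le> x \<and> x \<le> b \<longrightarrow> f x \<le> 0)"
    if "f b \<le> 0"
  proof -
    have "\<exists>c. a \<le> c \<and> c \<le> b \<and> f c = 0"
      using that inc[of a] a d by (intro IVT2) (auto intro: DERIV_isCont)
    then obtain c where c: "a \<le> c" "c \<le> b" "f c = 0" by blast
    have "0 \<le> f x" if "0 \<le> x" "x \<le> c" for x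
      using inc[of x] dec[of x c] c that by (cases "x \<le> a") auto
    moreover have "f x \<le> 0" if "c \<le> x" "x \<le> b" for x
      using dec[of c x] c that by auto
    ultimately show ?thesis using a c by (intro exI[of _ c]) auto
  qed
qed

text \<open>Each of \<open>R2\<close>, \<open>R\<close>, \<open>G\<close> is an antiderivative of the previous one up to the factor \<open>x\<close>, so the single
  sign change of the cosine propagates to \<open>G\<close>.\<close>

lemma kap_bound_below_pi:
  assumes "0 < s" "s \<le> pi"
  shows "3 - s\<^sup>2 / cden s \<le> - kap s"
proof -
  define q where "q = (\<lambda>s::real. pi\<^sup>2 / 2 - s\<^sup>2 / 6)"
  define R2 where "R2 = (\<lambda>s. sin s * (5 - q s) - tan_gap s / 3)"
  define R where "R = (\<lambda>s. 2/3 * s\<^sup>2 * sin s - tan_gap s * (q s - 3))"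
  \<comment> \<open>\<open>0 \<le> G s\<close> is the claim cleared of the positive denominators
    \<open>q s\<close> and \<open>tan_gap s\<close>.\<close>
  define G where "G = (\<lambda>s. s\<^sup>2 * sin s * q s - 3/2 * (pi\<^sup>2 - s\<^sup>2) * tan_gap s)"
  have q': "(q has_real_derivative - x / 3) (at x)" for x
    unfolding q_def by (auto intro!: derivative_eq_intros)
  have dR2: "(R2 has_real_derivative cos x * (5 - q x)) (at x)" for x
    unfolding R2_def
    by (auto intro!: derivative_eq_intros q' tan_gap_deriv simp: algebra_simps)
  have dR: "(R has_real_derivative x * R2 x) (at x)" for x
    unfolding R_def R2_def
    by (auto intro!: derivative_eq_intros q' tan_gap_deriv simp: tan_gap_def field_simps power2_eq_square)
  have dG: "(G has_real_derivative x * R x) (at x)" for x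
    unfolding G_def R_def
    by (auto intro!: derivative_eq_intros q' tan_gap_deriv simp: tan_gap_def q_def field_simps
        power2_eq_square)
  have q5: "q x < 5" for x
  proof -
    have "0 \<le> x\<^sup>2 / 6" by simp
    then show ?thesis using pi_sq_bounds unfolding q_def by linarith
  qed
  have q_pi: "q pi = pi\<^sup>2 / 3" by (simp add: q_def)
  have kpi: "tan_gap pi = pi" by (simp add: tan_gap_def)
  have "\<exists>c. 0 \<le> c \<and> c \<le> pi \<and> (\<forall>x. 0 \<le> x \<and> x \<le> c \<longrightarrow> 0 \<le> R2 x) \<and> (\<forall>x. c \<le> x \<and> x \<le> pi \<longrightarrow> R2 x \<le> 0)"
  proof (rule sign_pattern_integrate(1)[OF dR2, of "pi/2"])
    show "0 \<le> cos x * (5 - q x)" if "0 \<le> x" "x \<le> pi/2" for x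
      using that q5[of x] by (intro mult_nonneg_nonneg cos_ge_zero) auto
    show "cos x * (5 - q x) \<le> 0" if "pi/2 \<le> x" "x \<le> pi" for x
    proof (rule mult_nonpos_nonneg)
      have "0 \<le> cos (pi - x)" using that by (intro cos_ge_zero) auto
      then show "cos x \<le> 0" by simp
    qed (use q5[of x] in auto)
  qed (auto simp: R2_def tan_gap_def)
  then obtain c where c: "0 \<le> c" "c \<le> pi" "\<And>x. 0 \<le> x \<Longrightarrow> x \<le> c \<Longrightarrow> 0 \<le> R2 x" "\<And>x. c \<le> x \<Longrightarrow> x \<le> pi \<Longrightarrow> R2 x \<le> 0"
    by blast
  have "\<exists>c. 0 \<le> c \<and> c \<le> pi \<and> (\<forall>x. 0 \<le> x \<and> x \<le> c \<longrightarrow> 0 \<le> R x) \<and> (\<forall>x. c \<le> x \<and> x \<le> pi \<longrightarrow> R x \<le> 0)"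
  proof (rule sign_pattern_integrate(1)[OF dR c(1,2)])
    show "0 \<le> x * R2 x" if "0 \<le> x" "x \<le> c" for x using c that by simp
    show "x * R2 x \<le> 0" if "c \<le> x" "x \<le> pi" for x using c that by (intro mult_nonneg_nonpos) auto
    \<comment> \<open>The value is \<open>- pi * (pi^2 / 3 - 3)\<close>, so this is again
      \<open>9 < pi^2\<close>.\<close>
    show "R pi \<le> 0" using pi_sq_bounds by (simp add: R_def kpi q_pi)
  qed (simp add: R_def tan_gap_def)
  then obtain c' where c': "0 \<le> c'" "c' \<le> pi" "\<And>x. 0 \<le> x \<Longrightarrow> x \<le> c' \<Longrightarrow> 0 \<le> R x" "\<And>x. c' \<le> x \<Longrightarrow> x \<le> pi \<Longrightarrow> R x \<le> 0"
    by blast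
  have "0 \<le> G s"
  proof (rule sign_pattern_integrate(2)[OF dG c'(1,2)])
    show "0 \<le> x * R x" if "0 \<le> x" "x \<le> c'" for x using c' that by simp
    show "x * R x \<le> 0" if "c' \<le> x" "x \<le> pi" for x using c' that by (intro mult_nonneg_nonpos) auto
    show "0 \<le> G pi" by (simp add: G_def)
  qed (use assms in \<open>auto simp: G_def tan_gap_def\<close>)
  moreover have kp: "0 < tan_gap s" using tan_gap_pos assms theta1_bounds by auto
  moreover have qp: "0 < q s" "cden s = q s" using cden_pos[of s] assms theta1_bounds by (auto simp:
      cden_def q_def)
  \<comment> \<open>The quadratic \<open>q\<close> has the value \<open>pi^2 / 3\<close> at
    \<open>pi\<close>, so that \<open>3 * q s - s^2\<close> vanishes there, in agreement with
    \<open>kap pi = 0\<close>.\<close>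
  moreover have id: "3/2 * (pi\<^sup>2 - s\<^sup>2) = 3 * q s - s\<^sup>2" by (simp add: q_def field_simps)
  ultimately have "(3 * q s - s\<^sup>2) * tan_gap s \<le> s\<^sup>2 * sin s * q s"
    unfolding G_def id by linarith
  then have "(3 * q s - s\<^sup>2) / q s \<le> s\<^sup>2 * sin s / tan_gap s"
    using kp qp by (simp add: divide_simps mult.commute)
  then show ?thesis using qp by (simp add: kap_def diff_divide_distrib)
qed

lemma kap_cden:
  assumes "0 < s" "s < theta1"
  shows "3 - s\<^sup>2 / cden s \<le> - kap s"
  using kap_bound_below_pi[of s] sq_div_cden[of s] assms by (cases "s \<le> pi") auto

subsection \<open>The energy of loops with prescribed mean\<close>

text \<open>\<open>tan_gap\<close> alone vanishes at 0, where the Riccati solution would blow up.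
  Adding \<open>e * cos x\<close> repairs this on the first quarter period; beyond it the cosine may
  be negative, but there \<open>tan_gap\<close> is at least the smaller of
  \<open>tan_gap (pi/2) = 1\<close> and \<open>tan_gap s\<close>, whence the choice of
  \<open>e\<close>.\<close>

lemma riccati_denominator:
  assumes "0 < s" "s < theta1"
  obtains e where "\<And>x. \<lbrakk>0 \<le> x; x \<le> s\<rbrakk> \<Longrightarrow> 0 < tan_gap x + e * cos x"
proof -
  define e where "e = min 1 (tan_gap s) / 2"
  have e: "0 < e" "e < 1" "e < tan_gap s" using tan_gap_pos[OF assms] by (auto simp: e_def min_def)
  have "0 < tan_gap x + e * cos x" if x: "0 \<le> x" "x \<le> s" for x
  proof (cases "x < pi / 2")
    case True
    have "tan_gap 0 \<le> tan_gap x" using tan_gap_mono_0_pi[of 0 x] x True pi_gt_zero by (cases "x = 0") auto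
    moreover have "0 < cos x" using x True by (intro cos_gt_zero_pi) auto
    ultimately show ?thesis using e by (simp add: tan_gap_def add_nonneg_pos)
  next
    case False
    have "e < tan_gap x"
    proof (cases "x \<le> pi")
      case True
      have "pi/2 \<le> x" using False by simp
      then have "tan_gap (pi/2) \<le> tan_gap x"
        using tan_gap_mono_0_pi[of "pi/2" x] True less_eq_real_def pi_half_ge_zero by metis
      then show ?thesis using e by (simp add: tan_gap_def)
    next
      case False
      then have "tan_gap s \<le> tan_gap x"
        using tan_gap_anti_pi_2pi[of x s] x assms theta1_lt_2pi by (cases "x = s") auto
      then show ?thesis using e by simp
    qed
    moreover have "- e \<le> e * cos x" using e mult_left_mono[of "-1" "cos x" e] by simp
    ultimately show ?thesis by linarith
  qed
  then show ?thesis using that by blast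
qed

text \<open>The functions \<open>a\<close>, \<open>b\<close>, \<open>c\<close> solve the matrix Riccati equation that completes the square in
  \<open>h'\<^sup>2 - (2 s)\<^sup>2 h\<^sup>2\<close> for functions \<open>h = H'\<close> of mean zero.\<close>

lemma riccati_solution:
  assumes "0 < s" "s < theta1"
  obtains a b c :: "real \<Rightarrow> real" where
    "\<And>x. x \<in> {0..1/2} \<Longrightarrow> (a has_real_derivative (2 * s)\<^sup>2 - 2 * b x + (a x)\<^sup>2) (at x)"
    "\<And>x. x \<in> {0..1/2} \<Longrightarrow> (b has_real_derivative a x * b x - c x) (at x)"
    "\<And>x. x \<in> {0..1/2} \<Longrightarrow> (c has_real_derivative (b x)\<^sup>2) (at x)"
    "a 0 = 0"
proof -
  obtain e where e: "\<And>x. \<lbrakk>0 \<le> x; x \<le> s\<rbrakk> \<Longrightarrow> 0 < tan_gap x + e * cos x"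
    using riccati_denominator[OF assms] by blast
  define l where "l = 2 * s"
  define D where "D = (\<lambda>x. tan_gap (l * x) + e * cos (l * x))"
  define a where "a = (\<lambda>x. - l * (l * x - e) * sin (l * x) / D x)"
  define b where "b = (\<lambda>x. l\<^sup>2 * sin (l * x) / D x)"
  define c where "c = (\<lambda>x. - (l ^ 3) * cos (l * x) / D x)"
  have Dpos: "D x \<noteq> 0" if "x \<in> {0..1/2}" for x
    using e[of "l * x"] that assms by (auto simp: D_def l_def)
  have Deq: "D x = sin (l * x) - (l * x - e) * cos (l * x)" for x
    by (simp add: D_def tan_gap_def algebra_simps)
  have D': "(D has_real_derivative l * (l * x - e) * sin (l * x)) (at x)" for x
    unfolding Deq[abs_def] by (auto intro!: derivative_eq_intros simp: algebra_simps)
  show ?thesis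
  proof
    fix x :: real assume x: "x \<in> {0..1/2}"
    note nz = Dpos[OF x]
    have "(a has_real_derivative
       ((- l * l * sin (l * x) - l * (l * x - e) * (cos (l * x) * l)) * D x
        - (- l * (l * x - e) * sin (l * x)) * (l * (l * x - e) * sin (l * x))) / (D x * D x)) (at x)"
      unfolding a_def using nz by (auto intro!: derivative_eq_intros D' simp: field_simps)
    moreover have "((- l * l * sin (l * x) - l * (l * x - e) * (cos (l * x) * l)) * D x
        - (- l * (l * x - e) * sin (l * x)) * (l * (l * x - e) * sin (l * x)))
      = l\<^sup>2 * (D x * D x) - 2 * l\<^sup>2 * sin (l * x) * D x + (l * (l * x - e) * sin (l * x))\<^sup>2"
      unfolding Deq by algebra
    moreover have "(l\<^sup>2 * (D x * D x) - 2 * l\<^sup>2 * sin (l * x) * D x + (l * (l * x - e) * sin (l * x))\<^sup>2) /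
        (D x * D x)
      = l\<^sup>2 - 2 * b x + (a x)\<^sup>2"
      unfolding a_def b_def using nz by (simp add: field_simps power2_eq_square)
    ultimately show "(a has_real_derivative (2 * s)\<^sup>2 - 2 * b x + (a x)\<^sup>2) (at x)"
      by (simp add: l_def)
    have "(b has_real_derivative
       (l\<^sup>2 * (cos (l * x) * l) * D x - l\<^sup>2 * sin (l * x) * (l * (l * x - e) * sin (l * x))) / (D x * D
           x)) (at x)"
      unfolding b_def using nz by (auto intro!: derivative_eq_intros D' simp: field_simps)
    moreover have "(l\<^sup>2 * (cos (l * x) * l) * D x - l\<^sup>2 * sin (l * x) * (l * (l * x - e) * sin (l * x))) /
        (D x * D x)
       = a x * b x - c x"
      unfolding a_def b_def c_def using nz by (simp add: field_simps power2_eq_square power3_eq_cube)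
    ultimately show "(b has_real_derivative a x * b x - c x) (at x)" by simp
    have "(c has_real_derivative
       (l ^ 3 * (sin (l * x) * l) * D x - (- (l ^ 3) * cos (l * x)) * (l * (l * x - e) * sin (l * x))) /
           (D x * D x)) (at x)"
      unfolding c_def using nz by (auto intro!: derivative_eq_intros D' simp: field_simps)
    moreover have "l ^ 3 * (sin (l * x) * l) * D x - (- (l ^ 3) * cos (l * x)) * (l * (l * x - e) * sin (l
        * x))
      = (l\<^sup>2 * sin (l * x))\<^sup>2"
      unfolding Deq by algebra
    moreover have "(l\<^sup>2 * sin (l * x))\<^sup>2 / (D x * D x) = (b x)\<^sup>2"
      unfolding b_def by (simp add: power2_eq_square)
    ultimately show "(c has_real_derivative (b x)\<^sup>2) (at x)" by simp
  next
    \<comment> \<open>At 0 only \<open>H\<close> vanishes while \<open>h\<close> is free, so the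
      quadratic form in \<open>(h, H)\<close> has no boundary term there just when
      \<open>a 0 = 0\<close>.\<close>
    show "a 0 = 0" by (simp add: a_def)
  qed
qed

text \<open>After subtracting the extremal \<open>X\<close> with the same integral, the integrand is a sum of two squares plus
  the derivative of \<open>Phi\<close>.\<close>

lemma half_loop_minorant:
  fixes P Q P' Q' :: "real \<Rightarrow> real"
  assumes s: "0 < s" "s < theta1"
    and cP: "continuous_on {0..1/2} P" and cQ: "continuous_on {0..1/2} Q"
    and fin: "finite F"
    and dP: "\<And>x. x \<in> {0<..<1/2} - F \<Longrightarrow> (P has_real_derivative P' x) (at x)"
    and dQ: "\<And>x. x \<in> {0<..<1/2} - F \<Longrightarrow> (Q has_real_derivative Q' x) (at x)"
    and bd: "P (1/2) = 0" "Q 0 = 0" "Q (1/2) = 0"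
    and mu: "(P has_integral mu) {0..1/2}"
  shows "\<exists>f. (f has_integral - 8 * kap s * mu\<^sup>2) {0..1/2} \<and>
     (\<forall>x. f x \<le> (P' x)\<^sup>2 + (Q' x)\<^sup>2 - 2 * s * (P x * Q' x - Q x * P' x))"
proof -
  obtain a b c where
    a': "\<And>x. x \<in> {0..1/2} \<Longrightarrow> (a has_real_derivative (2 * s)\<^sup>2 - 2 * b x + (a x)\<^sup>2) (at x)" and
    b': "\<And>x. x \<in> {0..1/2} \<Longrightarrow> (b has_real_derivative a x * b x - c x) (at x)" and
    c': "\<And>x. x \<in> {0..1/2} \<Longrightarrow> (c has_real_derivative (b x)\<^sup>2) (at x)" and
    a0: "a 0 = 0"
    using riccati_solution[OF s] by metis
  have kp: "tan_gap s > 0" using tan_gap_pos s by simp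
  \<comment> \<open>This amplitude gives the extremal \<open>X\<close> the integral
    \<open>mu\<close> over the half interval.\<close>
  define A where "A = 2 * mu * s / tan_gap s"
  \<comment> \<open>The mean of \<open>2 * s * P\<close> over the half interval: \<open>Q'\<close>
    has mean zero there, so only the fluctuation of \<open>2 * s * P\<close> can be matched by
    it.\<close>
  define g where "g = 4 * s * mu"
  define Z where "Z = (\<lambda>x. A * (sin (2 * s * x) / (2 * s) - x * cos s))"
  define X where "X = (\<lambda>x. A * (cos (2 * s * x) - cos s))"
  define X' where "X' = (\<lambda>x. - 2 * s * A * sin (2 * s * x))"
  define PP where "PP = (\<lambda>x. integral {0..x} P)"
  define h where "h = (\<lambda>x. P x - X x)"
  define h' where "h' = (\<lambda>x. P' x - X' x)"
  define H where "H = (\<lambda>x. PP x - Z x)"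
  define Phi where "Phi = (\<lambda>x. 2 * s * P x * Q x - g\<^sup>2 * x - 2 * g * Q x + 4 * s * g * PP x
      + 2 * h x * X' x + 8 * s\<^sup>2 * A * cos s * H x + X x * X' x + 4 * s\<^sup>2 * A * cos s * Z x
      - (a x * (h x)\<^sup>2 + 2 * b x * h x * H x + c x * (H x)\<^sup>2))"
  \<comment> \<open>An integrable minorant is produced instead of an inequality of integrals,
    because the squares of \<open>P'\<close> and \<open>Q'\<close> are not assumed integrable;
    \<open>f\<close> is integrable as the derivative of \<open>Phi\<close>.\<close>
  define f where "f = (\<lambda>x. (P' x)\<^sup>2 + (Q' x)\<^sup>2 - 2 * s * (P x * Q' x - Q x * P' x)
      - (Q' x - 2 * s * P x + g)\<^sup>2 - (h' x + a x * h x + b x * H x)\<^sup>2)"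
  have dZ: "(Z has_real_derivative X x) (at x)" for x
    unfolding Z_def X_def using s by (auto intro!: derivative_eq_intros simp: field_simps)
  have dX: "(X has_real_derivative X' x) (at x)" for x
    unfolding X_def X'_def by (auto intro!: derivative_eq_intros simp: field_simps)
  have dX': "(X' has_real_derivative - 4 * s\<^sup>2 * (X x + A * cos s)) (at x)" for x
    unfolding X_def X'_def by (auto intro!: derivative_eq_intros simp: power2_eq_square algebra_simps)
  have dPP: "(PP has_real_derivative P x) (at x)" if "x \<in> {0<..<1/2}" for x
  proof -
    have "(PP has_real_derivative P x) (at x within {0..1/2})"
      unfolding PP_def using cP that by (intro integral_has_real_derivative) auto
    then show ?thesis using that at_within_Icc_at[of 0 x "1/2"] by auto
  qed
  have cPP: "continuous_on {0..1/2} PP"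
    unfolding PP_def by (rule indefinite_integral_continuous_1[OF has_integral_integrable[OF mu]])
  have cc: "continuous_on {0..1/2} a" "continuous_on {0..1/2} b" "continuous_on {0..1/2} c"
    "continuous_on {0..1/2} X" "continuous_on {0..1/2} X'" "continuous_on {0..1/2} Z"
  proof -
    have con: "continuous_on {0..1/2} q" if "\<And>x. x \<in> {0..1/2} \<Longrightarrow> (q has_real_derivative r x) (at x)"
      for q r :: "real \<Rightarrow> real"
      using that by (meson DERIV_isCont continuous_at_imp_continuous_on)
    show "continuous_on {0..1/2} a" "continuous_on {0..1/2} b" "continuous_on {0..1/2} c"
      "continuous_on {0..1/2} X" "continuous_on {0..1/2} X'" "continuous_on {0..1/2} Z"
      by (rule con, erule a', rule con, erule b', rule con, erule c', rule con, rule dX,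
          rule con, rule dX', rule con, rule dZ)
  qed
  have "(f has_integral (Phi (1/2) - Phi 0)) {0..1/2}"
  proof (rule fundamental_theorem_of_calculus_interior_strong[OF fin])
    show "continuous_on {0..1/2} Phi"
      unfolding Phi_def h_def H_def by (intro continuous_intros cP cQ cPP cc)
    fix x assume x: "x \<in> {0<..<1/2} - F"
    then have xi: "x \<in> {0..1/2}" "x \<in> {0<..<1/2}" by auto
    have dh: "(h has_real_derivative h' x) (at x)"
      unfolding h_def h'_def by (intro derivative_intros dP[OF x] dX)
    have dH: "(H has_real_derivative h x) (at x)"
      unfolding h_def H_def by (intro derivative_intros dPP xi dZ)
    have "(Phi has_real_derivative
       2 * s * (P' x * Q x + P x * Q' x) - g\<^sup>2 - 2 * g * Q' x + 4 * s * g * P x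
      + 2 * (h' x * X' x + h x * (- 4 * s\<^sup>2 * (X x + A * cos s))) + 8 * s\<^sup>2 * A * cos s * h x
      + (X' x * X' x + X x * (- 4 * s\<^sup>2 * (X x + A * cos s))) + 4 * s\<^sup>2 * A * cos s * X x
      - (((2 * s)\<^sup>2 - 2 * b x + (a x)\<^sup>2) * (h x)\<^sup>2 + a x * (2 * h x * h' x)
        + 2 * ((a x * b x - c x) * h x * H x + b x * (h' x * H x + h x * h x))
        + ((b x)\<^sup>2 * (H x)\<^sup>2 + c x * (2 * H x * h x)))) (at x)" (is "(_ has_real_derivative ?D) _")
      unfolding Phi_def
      by (rule derivative_eq_intros dh dH dX dX' dZ dPP[OF xi(2)] dP[OF x] dQ[OF x] a'[OF xi(1)] b'[OF
          xi(1)] c'[OF xi(1)] refl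
          | simp)+ (simp add: algebra_simps)
    moreover have "?D = f x"
    proof -
      have e: "P x = h x + X x" "P' x = h' x + X' x" by (simp_all add: h_def h'_def)
      show ?thesis unfolding f_def e by (simp add: power2_eq_square algebra_simps)
    qed
    ultimately show "(Phi has_vector_derivative f x) (at x)"
      by (simp add: has_real_derivative_iff_has_vector_derivative)
  qed simp
  moreover have "Phi (1/2) - Phi 0 = - 8 * kap s * mu\<^sup>2"
  proof -
    have "PP (1/2) = mu" using mu by (simp add: PP_def integral_unique)
    have Z: "Z (1/2) = mu" using s kp by (simp add: Z_def A_def tan_gap_def field_simps)
    have "Phi 0 = 0" by (simp add: Phi_def bd a0 PP_def Z_def X'_def H_def)
    have "Phi (1/2) = - g\<^sup>2 / 2 + 4 * s * g * mu + 4 * s\<^sup>2 * A * cos s * mu"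
      using Z \<open>PP (1/2) = mu\<close> by (simp add: Phi_def bd h_def H_def X_def)
    also have "\<dots> = 8 * s\<^sup>2 * mu\<^sup>2 * (tan_gap s + s * cos s) / tan_gap s"
      unfolding g_def A_def using kp by (simp add: field_simps power2_eq_square)
    also have "\<dots> = - 8 * kap s * mu\<^sup>2"
      unfolding kap_def using kp by (simp add: tan_gap_def field_simps)
    finally show ?thesis using \<open>Phi 0 = 0\<close> by simp
  qed
  ultimately have "(f has_integral - 8 * kap s * mu\<^sup>2) {0..1/2}" by simp
  then show ?thesis by (intro exI[of _ f]) (auto simp: f_def)
qed

lemma has_integral_fold_half:
  fixes f :: "real \<Rightarrow> real"
  assumes "(f has_integral I) {0..1}"
  shows "((\<lambda>x. f (1/2 + x) + f (1/2 - x)) has_integral I) {0..1/2}"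
proof -
  have i: "f integrable_on {0..1}" using assms by blast
  have i1: "f integrable_on {0..1/2}" and i2: "f integrable_on {1/2..1}"
    by (rule integrable_subinterval_real[OF i]; auto)+
  have sum: "integral {0..1/2} f + integral {1/2..1} f = I"
    using Henstock_Kurzweil_Integration.integral_combine[OF _ _ i, of "1/2"] assms by (simp add:
        integral_unique)
  have "((\<lambda>x. f (1/2 + x)) has_integral integral {1/2..1} f) {0..1/2}"
  proof -
    have "(f has_integral integral {1/2..1} f) (cbox (1/2) 1)" using i2 by (simp add: integrable_integral)
    from has_integral_affinity'[OF this, of 1 "1/2"] show ?thesis by (simp add: add.commute)
  qed
  moreover have "((\<lambda>x. f (1/2 - x)) has_integral integral {0..1/2} f) {0..1/2}"
  proof -
    have "(f has_integral integral {0..1/2} f) (cbox 0 (1/2))" using i1 by (simp add: integrable_integral)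
    from has_integral_affinity[OF this, of "-1" "1/2"]
    have "((\<lambda>x. f (1/2 - x)) has_integral integral {0..1/2} f) ((\<lambda>x. - x + 1/2) ` {0..1/2})" by simp
    moreover have "(\<lambda>x. - x + 1/2) ` {0..1/2} = {0..1/2::real}"
      using image_affinity_atLeastAtMost[of "-1" "1/2" 0 "1/2::real"] by simp
    ultimately show ?thesis by simp
  qed
  ultimately show ?thesis
    using has_integral_add[of "\<lambda>x. f (1/2 + x)" "integral {1/2..1} f" "{0..1/2}" "\<lambda>x. f (1/2 - x)"
        "integral {0..1/2} f"] sum
    by (simp add: add.commute)
qed

text \<open>Reflection about the midpoint splits a planar loop into two symmetric loops that do not interact;
  only for symmetric loops does the range \<open>s < theta1\<close> suffice in \<open>half_loop_minorant\<close>.\<close>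

lemma planar_loop_inequality:
  fixes X Y X' Y' g :: "real \<Rightarrow> real"
  assumes s: "0 < s" "s < theta1"
    and cX: "continuous_on {0..1} X" and cY: "continuous_on {0..1} Y"
    and fin: "finite F"
    and dX: "\<And>x. x \<in> {0<..<1} - F \<Longrightarrow> (X has_real_derivative X' x) (at x)"
    and dY: "\<And>x. x \<in> {0<..<1} - F \<Longrightarrow> (Y has_real_derivative Y' x) (at x)"
    and bd: "X 0 = 0" "X 1 = 0" "Y 0 = 0" "Y 1 = 0"
    and m: "(X has_integral mX) {0..1}" "(Y has_integral mY) {0..1}"
    and J: "(g has_integral J) {0..1}"
    and g: "\<And>x. x \<in> {0..1} \<Longrightarrow> (X' x)\<^sup>2 + (Y' x)\<^sup>2 - 2 * s * (X x * Y' x - Y x * X' x) \<le> g x"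
  shows "- 4 * kap s * (mX\<^sup>2 + mY\<^sup>2) \<le> J"
proof -
  define F' where "F' = (\<lambda>x. x - 1/2) ` F \<union> (\<lambda>x. 1/2 - x) ` F"
  have F': "finite F'" using fin by (simp add: F'_def)
  have notF: "1/2 + x \<in> {0<..<1} - F" "1/2 - x \<in> {0<..<1} - F" if "x \<in> {0<..<1/2} - F'" for x
    using that by (force simp: F'_def image_iff)+
  have cp: "continuous_on {0..1/2} (\<lambda>x. f (1/2 + x))" and cm: "continuous_on {0..1/2} (\<lambda>x. f (1/2 - x))"
    if "continuous_on {0..1} f" for f :: "real \<Rightarrow> real"
    by (rule continuous_on_compose2[OF that], (intro continuous_intros)[1], force)+
  have dp: "((\<lambda>x. f (1/2 + x)) has_real_derivative f' (1/2 + x)) (at x)"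
    and dm: "((\<lambda>x. f (1/2 - x)) has_real_derivative - f' (1/2 - x)) (at x)"
    if "\<And>x. x \<in> {0<..<1} - F \<Longrightarrow> (f has_real_derivative f' x) (at x)" "x \<in> {0<..<1/2} - F'"
    for f f' :: "real \<Rightarrow> real" and x
  proof -
    have "((\<lambda>x. 1/2 + x) has_real_derivative 1) (at x)" "((\<lambda>x. 1/2 - x) has_real_derivative -1) (at x)"
      by (auto intro!: derivative_eq_intros)
    note DERIV_chain'[OF this(1), of f "f' (1/2 + x)"] DERIV_chain'[OF this(2), of f "f' (1/2 - x)"]
    then show "((\<lambda>x. f (1/2 + x)) has_real_derivative f' (1/2 + x)) (at x)"
      "((\<lambda>x. f (1/2 - x)) has_real_derivative - f' (1/2 - x)) (at x)"
      using that(1)[OF notF(1)[OF that(2)]] that(1)[OF notF(2)[OF that(2)]] by auto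
  qed
  define Xe Xo Ye Yo where
    "Xe = (\<lambda>x. (X (1/2 + x) + X (1/2 - x)) / 2)" and "Xo = (\<lambda>x. (X (1/2 + x) - X (1/2 - x)) / 2)" and
    "Ye = (\<lambda>x. (Y (1/2 + x) + Y (1/2 - x)) / 2)" and "Yo = (\<lambda>x. (Y (1/2 + x) - Y (1/2 - x)) / 2)"
  define Xe' Xo' Ye' Yo' where
    "Xe' = (\<lambda>x. (X' (1/2 + x) - X' (1/2 - x)) / 2)" and "Xo' = (\<lambda>x. (X' (1/2 + x) + X' (1/2 - x)) / 2)" and
    "Ye' = (\<lambda>x. (Y' (1/2 + x) - Y' (1/2 - x)) / 2)" and "Yo' = (\<lambda>x. (Y' (1/2 + x) + Y' (1/2 - x)) / 2)"
  note defs = Xe_def Xo_def Ye_def Yo_def Xe'_def Xo'_def Ye'_def Yo'_def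
  have c: "continuous_on {0..1/2} Xe" "continuous_on {0..1/2} Xo" "continuous_on {0..1/2} Ye"
      "continuous_on {0..1/2} Yo"
    unfolding defs by (intro continuous_intros cp cm cX cY; simp)+
  have d: "(Xe has_real_derivative Xe' x) (at x)" "(Xo has_real_derivative Xo' x) (at x)"
    "(Ye has_real_derivative Ye' x) (at x)" "(Yo has_real_derivative Yo' x) (at x)"
    if "x \<in> {0<..<1/2} - F'" for x
    unfolding defs by (auto intro!: derivative_eq_intros dp[OF dX that] dm[OF dX that] dp[OF dY that]
        dm[OF dY that])
  have mX': "(Xe has_integral mX / 2) {0..1/2}" and mY': "(Ye has_integral mY / 2) {0..1/2}"
    unfolding defs using m by (auto intro!: has_integral_divide has_integral_fold_half)
  obtain f1 where f1: "(f1 has_integral - 8 * kap s * (mX / 2)\<^sup>2) {0..1/2}"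
    "\<And>x. f1 x \<le> (Xe' x)\<^sup>2 + (Yo' x)\<^sup>2 - 2 * s * (Xe x * Yo' x - Yo x * Xe' x)"
    using half_loop_minorant[OF s c(1) c(4) F' d(1) d(4) _ _ _ mX'] bd by (auto simp: defs)
  \<comment> \<open>The second pair is a quarter turn of \<open>(Xo, Ye)\<close>. The turn preserves
    the signed area and puts the even function first, as \<open>half_loop_minorant\<close>
    requires.\<close>
  obtain f2 where f2: "(f2 has_integral - 8 * kap s * (mY / 2)\<^sup>2) {0..1/2}"
    "\<And>x. f2 x \<le> (Ye' x)\<^sup>2 + (- Xo' x)\<^sup>2 - 2 * s * (Ye x * (- Xo' x) - (- Xo x) * Ye' x)"
    using half_loop_minorant[OF s c(3) continuous_on_minus[OF c(2)] F' d(3) DERIV_minus[OF d(2)] _ _ _ mY'] bd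
    by (auto simp: defs)
  have "((\<lambda>x. 2 * (f1 x + f2 x)) has_integral
     2 * (- 8 * kap s * (mX / 2)\<^sup>2 + - 8 * kap s * (mY / 2)\<^sup>2)) {0..1/2}"
    by (intro has_integral_mult_right has_integral_add f1 f2)
  then have "2 * (- 8 * kap s * (mX / 2)\<^sup>2 + - 8 * kap s * (mY / 2)\<^sup>2) \<le> J"
  proof (rule has_integral_le[OF _ has_integral_fold_half[OF J]])
    fix x :: real assume x: "x \<in> {0..1/2}"
    have "2 * (f1 x + f2 x) \<le> 2 * ((Xe' x)\<^sup>2 + (Yo' x)\<^sup>2 - 2 * s * (Xe x * Yo' x - Yo x * Xe' x)
       + ((Ye' x)\<^sup>2 + (- Xo' x)\<^sup>2 - 2 * s * (Ye x * (- Xo' x) - (- Xo x) * Ye' x)))"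
      using f1(2)[of x] f2(2)[of x] by simp
    also have "\<dots> = ((X' (1/2+x))\<^sup>2 + (Y' (1/2+x))\<^sup>2 - 2 * s * (X (1/2+x) * Y' (1/2+x) - Y (1/2+x) * X'
        (1/2+x)))
       + ((X' (1/2-x))\<^sup>2 + (Y' (1/2-x))\<^sup>2 - 2 * s * (X (1/2-x) * Y' (1/2-x) - Y (1/2-x) * X' (1/2-x)))"
      unfolding defs by (simp add: field_simps power2_eq_square)
    also have "\<dots> \<le> g (1/2 + x) + g (1/2 - x)" using x by (intro add_mono g) auto
    finally show "2 * (f1 x + f2 x) \<le> g (1/2 + x) + g (1/2 - x)" .
  qed
  then show ?thesis by (simp add: power2_eq_square algebra_simps)
qed

text \<open>The extremal is the parabola \<open>6 * w * x * (1 - x)\<close> with derivative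
  \<open>12 * w * (1/2 - x)\<close>; \<open>f\<close> arises by dropping the square of
  \<open>W' x - 12 * w * (1/2 - x)\<close>.\<close>

lemma scalar_loop_minorant:
  fixes W W' :: "real \<Rightarrow> real"
  assumes cW: "continuous_on {0..1} W" and fin: "finite F"
    and dW: "\<And>x. x \<in> {0<..<1} - F \<Longrightarrow> (W has_real_derivative W' x) (at x)"
    and bd: "W 0 = 0" "W 1 = 0"
    and m: "(W has_integral w) {0..1}"
  shows "\<exists>f. (f has_integral 12 * w\<^sup>2) {0..1} \<and> (\<forall>x. f x \<le> (W' x)\<^sup>2)"
proof -
  define f where "f = (\<lambda>x. 24 * w * ((1/2 - x) * W' x - W x) + 24 * w * W x - 144 * w\<^sup>2 * (1/2 - x)\<^sup>2)"
  have "((\<lambda>x. (1/2 - x) * W' x - W x) has_integral ((1/2 - 1) * W 1 - (1/2 - 0) * W 0)) {0..1}"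
  proof (rule fundamental_theorem_of_calculus_interior_strong[OF fin])
    show "continuous_on {0..1} (\<lambda>x. (1/2 - x) * W x)" by (intro continuous_intros cW)
    show "((\<lambda>x. (1/2 - x) * W x) has_vector_derivative (1/2 - x) * W' x - W x) (at x)" if "x \<in> {0<..<1} -
        F" for x
      unfolding has_real_derivative_iff_has_vector_derivative[symmetric]
      by (auto intro!: derivative_eq_intros dW[OF that])
  qed simp
  then have i1: "((\<lambda>x. (1/2 - x) * W' x - W x) has_integral 0) {0..1}" by (simp add: bd)
  have "((\<lambda>x::real. (1/2 - x)\<^sup>2) has_integral ((- ((1/2 - 1) ^ 3) / 3) - (- ((1/2 - 0) ^ 3) / 3))) {0..1}"
    by (intro fundamental_theorem_of_calculus)
      (auto simp: has_real_derivative_iff_has_vector_derivative[symmetric] power2_eq_square intro!: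
          derivative_eq_intros)
  then have i2: "((\<lambda>x::real. (1/2 - x)\<^sup>2) has_integral 1/12) {0..1}"
    by (simp add: power3_eq_cube)
  have "(f has_integral (24 * w * 0 + 24 * w * w - 144 * w\<^sup>2 * (1/12))) {0..1}"
    unfolding f_def by (intro has_integral_add has_integral_diff has_integral_mult_right i1 i2 m)
  then have "(f has_integral 12 * w\<^sup>2) {0..1}" by (simp add: power2_eq_square)
  moreover have "f x \<le> (W' x)\<^sup>2" for x
  proof -
    have "0 \<le> (W' x - 12 * w * (1/2 - x))\<^sup>2" by simp
    then show ?thesis unfolding f_def by (simp add: power2_eq_square algebra_simps)
  qed
  ultimately show ?thesis by blast
qed

section \<open>From planar loops to loops in space\<close>

lemma frame_parseval:
  fixes y n a :: "real^3"
  assumes "norm n = 1" "norm a = 1" "n \<bullet> a = 0"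
  shows "(norm y)\<^sup>2 = (y \<bullet> n)\<^sup>2 + (y \<bullet> a)\<^sup>2 + (y \<bullet> (a \<times> n))\<^sup>2"
proof -
  have "(y \<times> n) \<times> a = (a \<bullet> y) *\<^sub>R n"
    using assms(3) Lagrange[of a y n] cross_skew[of "y \<times> n" a] by (simp add: inner_commute)
  then have "(norm ((y \<times> n) \<times> a))\<^sup>2 = (y \<bullet> a)\<^sup>2"
    using assms by (simp add: inner_commute)
  moreover have "(y \<times> n) \<bullet> a = - (y \<bullet> (a \<times> n))"
    by (simp add: cross3_simps)
  ultimately have "(norm (y \<times> n))\<^sup>2 = (y \<bullet> a)\<^sup>2 + (y \<bullet> (a \<times> n))\<^sup>2"
    using norm_cross_dot[of "y \<times> n" a] assms by simp
  then show ?thesis using norm_cross_dot[of y n] assms by simp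
qed

text \<open>The area term sees only the components transverse to \<open>\<tau>\<close>: these obey
  the planar inequality, the component along \<open>\<tau>\<close> the scalar one. For
  \<open>\<tau> = 0\<close> there is no axis, and the scalar bound in the direction of
  \<open>m\<close> suffices.\<close>

lemma loop_inequality:
  fixes y y' :: "real \<Rightarrow> real^3" and m \<tau> :: "real^3"
  assumes \<tau>: "norm \<tau> < theta1"
    and cy: "continuous_on {0..1} y" and fin: "finite F"
    and dy: "\<And>x. x \<in> {0<..<1} - F \<Longrightarrow> (y has_vector_derivative y' x) (at x)"
    and bd: "y 0 = 0" "y 1 = 0"
    and m: "(y has_integral m) {0..1}"
    and J: "((\<lambda>x. (norm (y' x))\<^sup>2 + 2 * (\<tau> \<bullet> (y x \<times> y' x))) has_integral J) {0..1}"
  shows "12 * (norm m)\<^sup>2 - 4 * (norm (m \<times> \<tau>))\<^sup>2 / cden (norm \<tau>) \<le> J"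
proof -
  have cW: "continuous_on {0..1} (\<lambda>x. y x \<bullet> n)" for n by (intro continuous_intros cy)
  have dW: "((\<lambda>x. y x \<bullet> n) has_real_derivative y' x \<bullet> n) (at x)" if "x \<in> {0<..<1} - F" for x n
    using bounded_linear.has_vector_derivative[OF bounded_linear_inner_left dy[OF that]]
    by (simp add: has_real_derivative_iff_has_vector_derivative)
  have mW: "((\<lambda>x. y x \<bullet> n) has_integral m \<bullet> n) {0..1}" for n
    using has_integral_linear[OF m bounded_linear_inner_left[of n]] by (simp add: o_def)
  have par: "\<exists>f. (f has_integral 12 * (m \<bullet> n)\<^sup>2) {0..1} \<and> (\<forall>x. f x \<le> (y' x \<bullet> n)\<^sup>2)" for n
    using scalar_loop_minorant[OF cW fin dW _ _ mW] bd by simp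
  show ?thesis
  proof (cases "\<tau> = 0")
    case True
    obtain f where f: "(f has_integral 12 * (m \<bullet> sgn m)\<^sup>2) {0..1}" "\<And>x. f x \<le> (y' x \<bullet> sgn m)\<^sup>2"
      using par by blast
    have "12 * (m \<bullet> sgn m)\<^sup>2 \<le> J"
    proof (rule has_integral_le[OF f(1) J])
      fix x
      have "\<bar>y' x \<bullet> sgn m\<bar> \<le> norm (y' x) * norm (sgn m)" by (rule Cauchy_Schwarz_ineq2)
      also have "\<dots> \<le> norm (y' x)" by (simp add: norm_sgn)
      finally have "(y' x \<bullet> sgn m)\<^sup>2 \<le> (norm (y' x))\<^sup>2" using abs_le_square_iff by fastforce
      then show "f x \<le> (norm (y' x))\<^sup>2 + 2 * (\<tau> \<bullet> (y x \<times> y' x))" using f(2)[of x] True by simp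
    qed
    moreover have "m \<bullet> sgn m = norm m"
      by (cases "m = 0") (auto simp: sgn_div_norm dot_square_norm power2_eq_square)
    ultimately show ?thesis using True by simp
  next
    case False
    define s where "s = norm \<tau>"
    define n where "n = (1 / s) *\<^sub>R \<tau>"
    have s: "0 < s" "s < theta1" using False \<tau> by (auto simp: s_def)
    have n: "norm n = 1" "\<tau> = s *\<^sub>R n" using s by (auto simp: n_def s_def)
    obtain a0 :: "real^3" where a0: "a0 \<noteq> 0" "orthogonal n a0"
      using orthogonal_to_vector_exists[of n] by auto
    define a where "a = sgn a0"
    have a: "norm a = 1" "n \<bullet> a = 0"
      using a0 by (auto simp: a_def norm_sgn sgn_div_norm orthogonal_def)
    \<comment> \<open>This orientation, \<open>a \<times> b = - n\<close>, gives the area term the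
      sign that it has in \<open>planar_loop_inequality\<close>.\<close>
    define b where "b = a \<times> n"
    have ab: "a \<times> b = - n"
      using a n Lagrange[of a a n] by (simp add: b_def inner_commute norm_eq_1)
    have pars: "(norm z)\<^sup>2 = (z \<bullet> n)\<^sup>2 + (z \<bullet> a)\<^sup>2 + (z \<bullet> b)\<^sup>2" for z
      unfolding b_def using frame_parseval[OF n(1) a] .
    have area: "\<tau> \<bullet> (z \<times> z') = - s * ((z \<bullet> a) * (z' \<bullet> b) - (z \<bullet> b) * (z' \<bullet> a))" for z z'
    proof -
      have "(z \<times> z') \<bullet> (a \<times> b) = (z \<bullet> a) * (z' \<bullet> b) - (z \<bullet> b) * (z' \<bullet> a)" by (rule dot_cross)
      then have h: "n \<bullet> (z \<times> z') = - ((z \<bullet> a) * (z' \<bullet> b) - (z \<bullet> b) * (z' \<bullet> a))"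
        unfolding ab by (simp add: inner_commute)
      show ?thesis unfolding n(2) inner_scaleR_left h by (simp add: algebra_simps)
    qed
    obtain f where f: "(f has_integral 12 * (m \<bullet> n)\<^sup>2) {0..1}" "\<And>x. f x \<le> (y' x \<bullet> n)\<^sup>2"
      using par by blast
    have "- 4 * kap s * ((m \<bullet> a)\<^sup>2 + (m \<bullet> b)\<^sup>2) \<le> J - 12 * (m \<bullet> n)\<^sup>2"
    proof (rule planar_loop_inequality[OF s cW cW fin dW dW _ _ _ _ mW mW has_integral_diff[OF J f(1)]])
      fix x
      show "(y' x \<bullet> a)\<^sup>2 + (y' x \<bullet> b)\<^sup>2 - 2 * s * ((y x \<bullet> a) * (y' x \<bullet> b) - (y x \<bullet> b) * (y' x \<bullet> a))
        \<le> (norm (y' x))\<^sup>2 + 2 * (\<tau> \<bullet> (y x \<times> y' x)) - f x"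
        using f(2)[of x] unfolding pars[of "y' x"] area by simp
    qed (auto simp: bd)
    moreover have "4 * (3 - s\<^sup>2 / cden s) * ((m \<bullet> a)\<^sup>2 + (m \<bullet> b)\<^sup>2) \<le> 4 * (- kap s) * ((m \<bullet> a)\<^sup>2 + (m \<bullet> b)\<^sup>2)"
      using kap_cden[OF s] by (intro mult_right_mono) auto
    moreover have "(norm (m \<times> \<tau>))\<^sup>2 = s\<^sup>2 * ((m \<bullet> a)\<^sup>2 + (m \<bullet> b)\<^sup>2)"
    proof -
      have "(norm (m \<times> n))\<^sup>2 = (m \<bullet> a)\<^sup>2 + (m \<bullet> b)\<^sup>2"
        using norm_cross_dot[of m n] pars[of m] n by simp
      then show ?thesis unfolding n(2) by (simp add: cross_mult_right power_mult_distrib)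
    qed
    ultimately show ?thesis unfolding pars[of m] s_def[symmetric]
      by (simp add: algebra_simps add_divide_distrib)
  qed
qed

text \<open>\<open>energy_lb t m \<tau>\<close> bounds from below the energy, minus 1, of a curve from the identity to \<open>(e1, t)\<close> whose
  horizontal part has mean \<open>m + e1 / 2\<close>: the loop inequality is applied to the deviation of the curve from the
  segment, and the term \<open>4 * (\<tau> \<bullet> (t - e1 \<times> m))\<close> accounts for its area vector.\<close>

definition energy_lb :: "real^3 \<Rightarrow> real^3 \<Rightarrow> real^3 \<Rightarrow> real" where
  "energy_lb t m \<tau> = 12 * (norm m)\<^sup>2 - 4 * (norm (m \<times> \<tau>))\<^sup>2 / cden (norm \<tau>) + 4 * (\<tau> \<bullet> (t - e1 \<times> m))"

section \<open>The lower bound for polygons\<close>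

lemma has_integral_cells:
  fixes f :: "real \<Rightarrow> 'a::banach"
  assumes "N > (0::nat)" "\<And>i. i < n \<Longrightarrow> (f has_integral I i) {real i / N .. real (Suc i) / N}"
  shows "(f has_integral (\<Sum>i<n. I i)) {0..real n / N}"
  using assms(2)
proof (induction n)
  case 0
  then show ?case by (simp add: has_integral_refl)
next
  case (Suc n)
  have "(f has_integral (\<Sum>i<n. I i) + I n) {0..real (Suc n) / N}"
    using Suc assms(1)
    by (intro has_integral_combine[of 0 "real n / N" "real (Suc n) / N"]) (auto simp: divide_right_mono)
  then show ?case by simp
qed

lemma norm_e1 [simp]: "norm e1 = 1"
  by (simp add: e1_def norm_vec_def L2_set_def sum_3)

lemma e1_inner_e1 [simp]: "e1 \<bullet> e1 = 1"
  by (metis norm_e1 norm_eq_1)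

text \<open>Half the sum of the \<open>d i \<times> p i\<close> is the vertical endpoint of the
  horizontal lift of the polygon, and \<open>real N\<close> times the sum of squares is its energy
  when every edge takes time \<open>1 / N\<close>. Polygons are differentiable off a finite set,
  which is what \<open>loop_inequality\<close> asks for.\<close>

lemma polygon_bound:
  fixes p :: "nat \<Rightarrow> real^3" and N :: nat
  assumes N: "0 < N" and p0: "p 0 = 0" and pN: "p N = e1"
  defines "d \<equiv> \<lambda>i. p (Suc i) - p i"
  shows "\<exists>m. norm m \<le> (\<Sum>i<N. norm (d i)) + 1 \<and>
     (\<forall>\<tau>. norm \<tau> < theta1 \<longrightarrow>
        energy_lb ((1/2) *\<^sub>R (\<Sum>i<N. d i \<times> p i)) m \<tau> \<le> real N * (\<Sum>i<N. (norm (d i))\<^sup>2) - 1)"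
proof -
  \<comment> \<open>\<open>cl i x\<close> is the fraction of edge \<open>i\<close> covered at time
    \<open>x\<close>.\<close>
  define cl where "cl = (\<lambda>i x. max 0 (min 1 (real N * x - real i)))"
  define P where "P = (\<lambda>x. \<Sum>i<N. cl i x *\<^sub>R d i)"
  define D where "D = (\<lambda>x. real N *\<^sub>R d (nat \<lfloor>real N * x\<rfloor>))"
  define F where "F = (\<lambda>i. real i / N) ` {..N}"
  have finF: "finite F" by (simp add: F_def)
  have cP: "continuous_on {0..1} P" unfolding P_def cl_def by (intro continuous_intros)
  have tele: "(\<Sum>i<j. d i) = p j" for j
    unfolding d_def using sum_lessThan_telescope[of p j] p0 by simp
  have Pcell: "P x = p j + (real N * x - real j) *\<^sub>R d j"
    if "j < N" "real j \<le> real N * x" "real N * x \<le> real (Suc j)" for x j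
  proof -
    have "P x = (\<Sum>i<N. if i < j then d i else if i = j then (real N * x - real j) *\<^sub>R d j else 0)"
      unfolding P_def
    proof (rule sum.cong)
      fix i assume "i \<in> {..<N}"
      consider "i < j" | "i = j" | "j < i" by linarith
      then show "cl i x *\<^sub>R d i = (if i < j then d i else if i = j then (real N * x - real j) *\<^sub>R d j else 0)"
      proof cases
        case 1
        then have "real (Suc i) \<le> real j" by (simp only: of_nat_le_iff Suc_le_eq)
        then have "cl i x = 1" using that by (simp add: cl_def)
        then show ?thesis using 1 by simp
      next
        case 2
        then show ?thesis using that by (simp add: cl_def)
      next
        case 3
        then have "real (Suc j) \<le> real i" by (simp only: of_nat_le_iff Suc_le_eq)
        then have "cl i x = 0" using that by (simp add: cl_def)
        then show ?thesis using 3 by simp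
      qed
    qed simp
    also have "\<dots> = (\<Sum>i\<in>{..<N}. if i < j then d i else 0) + (\<Sum>i\<in>{..<N}. if i = j then (real N * x - real j)
        *\<^sub>R d j else 0)"
      unfolding sum.distrib[symmetric] by (rule sum.cong) auto
    also have "(\<Sum>i\<in>{..<N}. if i < j then d i else 0) = (\<Sum>i<j. d i)"
      using that by (simp add: sum.If_cases Int_absorb1 lessThan_def[symmetric])
    finally show ?thesis using that tele by simp
  qed
  have Dcell: "D x = real N *\<^sub>R d j" if "real j \<le> real N * x" "real N * x < real (Suc j)" for x j
  proof -
    have "\<lfloor>real N * x\<rfloor> = int j" using that by (intro floor_unique) auto
    then show ?thesis by (simp add: D_def)
  qed
  have incell: "\<exists>j<N. real j < real N * x \<and> real N * x < real (Suc j)" if "x \<in> {0<..<1} - F" for x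
  proof (intro exI[of _ "nat \<lfloor>real N * x\<rfloor>"] conjI)
    let ?j = "nat \<lfloor>real N * x\<rfloor>"
    have x0: "0 \<le> real N * x" using that by auto
    then have j: "real ?j \<le> real N * x" "real N * x < real ?j + 1" by linarith+
    have "real N * x < real N * 1" using that N by (intro mult_strict_left_mono) auto
    then have "real ?j < real N" using j by linarith
    then show jN: "?j < N" by linarith
    have "real ?j \<noteq> real N * x"
    proof
      assume "real ?j = real N * x"
      then have "x = real ?j / N" using N by (simp add: field_simps)
      then have "x \<in> F" using jN unfolding F_def by (intro image_eqI[of _ _ ?j]) auto
      then show False using that by auto
    qed
    then show "real ?j < real N * x" using j by linarith
    show "real N * x < real (Suc ?j)" unfolding of_nat_Suc using j(2) by linarith
  qed
  have dP: "(P has_vector_derivative D x) (at x)" if x: "x \<in> {0<..<1} - F" for x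
  proof -
    obtain j where j: "j < N" "real j < real N * x" "real N * x < real (Suc j)" using incell[OF x] by blast
    have "((\<lambda>x. p j + (real N * x - real j) *\<^sub>R d j) has_vector_derivative real N *\<^sub>R d j) (at x)"
      by (auto intro!: derivative_eq_intros)
    then have "(P has_vector_derivative real N *\<^sub>R d j) (at x)"
    proof (rule has_vector_derivative_transform_within_open)
      show "open {z. real j < real N * z \<and> real N * z < real (Suc j)}"
        by (intro open_Collect_conj open_Collect_less continuous_intros)
    qed (use j Pcell in auto)
    then show ?thesis using Dcell[of j x] j by simp
  qed
  have P0: "P 0 = 0" using Pcell[of 0 0] N p0 by simp
  have P1: "P 1 = e1" using Pcell[of "N - 1" 1] N pN by (simp add: d_def of_nat_diff algebra_simps)
  have Pint: "P integrable_on {0..1}" by (rule integrable_continuous_real[OF cP])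
  define M where "M = integral {0..1} P"
  define m where "m = M - (1/2) *\<^sub>R e1"
  have Mi: "(P has_integral M) {0..1}" using Pint by (simp add: M_def integrable_integral)
  have Pn: "norm (P x) \<le> (\<Sum>i<N. norm (d i))" for x
    unfolding P_def by (rule sum_norm_le) (auto simp: cl_def mult_left_le_one_le)
  have "norm M \<le> (\<Sum>i<N. norm (d i))"
    using has_integral_bound_real[OF _ _ Mi, of "\<Sum>i<N. norm (d i)" "{}"] Pn by (simp add: sum_nonneg)
  then have nM: "norm m \<le> (\<Sum>i<N. norm (d i)) + 1"
    unfolding m_def using norm_triangle_ineq4[of M "(1/2) *\<^sub>R e1"] by simp
  define y where "y = (\<lambda>x. P x - x *\<^sub>R e1)"
  define y' where "y' = (\<lambda>x. D x - e1)"
  have cy: "continuous_on {0..1} y" unfolding y_def by (intro continuous_intros cP)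
  have dy: "(y has_vector_derivative y' x) (at x)" if "x \<in> {0<..<1} - F" for x
    unfolding y_def y'_def by (auto intro!: derivative_eq_intros dP[OF that])
  have my: "(y has_integral m) {0..1}"
  proof -
    have "((\<lambda>x::real. x) has_integral 1/2) {0..1}"
      using ident_has_integral[of 0 "1::real"] by simp
    then have "((\<lambda>x. x *\<^sub>R e1) has_integral (1/2) *\<^sub>R e1) {0..1}"
      by (rule has_integral_scaleR_left)
    then show ?thesis unfolding y_def m_def by (intro has_integral_diff Mi)
  qed
  define S where "S = (\<Sum>i<N. (norm (d i))\<^sup>2)"
  define A where "A = (\<Sum>i<N. p i \<times> d i)"
  have AT: "A = - 2 *\<^sub>R ((1/2) *\<^sub>R (\<Sum>i<N. d i \<times> p i))"
  proof -
    have "p i \<times> d i = - (d i \<times> p i)" for i by (rule cross_skew)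
    then show ?thesis unfolding A_def by (simp add: sum_negf)
  qed
  have main: "energy_lb ((1/2) *\<^sub>R (\<Sum>i<N. d i \<times> p i)) m \<tau> \<le> real N * S - 1" if \<tau>: "norm \<tau> < theta1" for \<tau>
  proof -
    have step: "((\<lambda>x. (norm (D x))\<^sup>2 + 2 * (\<tau> \<bullet> (P x \<times> D x))) has_integral
        (\<Sum>i<N. real N * (norm (d i))\<^sup>2 + 2 * (\<tau> \<bullet> (p i \<times> d i)))) {0..real N / N}"
    proof (rule has_integral_cells[OF N])
      fix i assume i: "i < N"
      let ?K = "(norm (real N *\<^sub>R d i))\<^sup>2 + 2 * (\<tau> \<bullet> (p i \<times> (real N *\<^sub>R d i)))"
      have len: "real (Suc i) / N - real i / N = 1 / N" by (simp add: diff_divide_distrib[symmetric])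
      have "((\<lambda>x. ?K) has_integral (real (Suc i) / N - real i / N) *\<^sub>R ?K) {real i / N..real (Suc i) / N}"
        using has_integral_const_real[of ?K "real i / N" "real (Suc i) / N"] N
        by (simp add: divide_right_mono)
      then have "((\<lambda>x. ?K) has_integral real N * (norm (d i))\<^sup>2 + 2 * (\<tau> \<bullet> (p i \<times> d i))) {real i / N..real
          (Suc i) / N}"
      proof -
        have "(1 / real N) *\<^sub>R ?K = real N * (norm (d i))\<^sup>2 + 2 * (\<tau> \<bullet> (p i \<times> d i))"
          using N by (simp add: cross_mult_right power_mult_distrib power2_eq_square field_simps)
        then show ?thesis using \<open>((\<lambda>x. ?K) has_integral _) _\<close> unfolding len by (simp only:)
      qed
      then show "((\<lambda>x. (norm (D x))\<^sup>2 + 2 * (\<tau> \<bullet> (P x \<times> D x))) has_integral real N * (norm (d i))\<^sup>2 + 2 *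
          (\<tau> \<bullet> (p i \<times> d i)))
          {real i / N..real (Suc i) / N}"
      proof (rule has_integral_spike_finite[rotated 2])
        \<comment> \<open>At the right end of a cell \<open>D\<close> already takes the value of the
          next edge.\<close>
        show "finite {real (Suc i) / N}" by simp
        fix x assume x: "x \<in> {real i / N..real (Suc i) / N} - {real (Suc i) / N}"
        then have "real i \<le> real N * x" "real N * x < real (Suc i)" using N by (auto simp: field_simps)
        then have "P x = p i + (real N * x - real i) *\<^sub>R d i" "D x = real N *\<^sub>R d i"
          using Pcell[of i x] Dcell[of i x] i by auto
        then show "(norm (D x))\<^sup>2 + 2 * (\<tau> \<bullet> (P x \<times> D x)) = ?K"
          by (simp add: cross_add_left cross_mult_left cross_mult_right)
      qed
    qed
    have dPe: "((\<lambda>x. D x \<bullet> e1) has_integral P 1 \<bullet> e1 - P 0 \<bullet> e1) {0..1}"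
      by (rule fundamental_theorem_of_calculus_interior_strong[OF finF])
        (auto intro!: continuous_intros cP bounded_linear.has_vector_derivative[OF
            bounded_linear_inner_left] dP)
    have dPx: "((\<lambda>x. \<tau> \<bullet> (x *\<^sub>R (e1 \<times> D x) + e1 \<times> P x)) has_integral
        \<tau> \<bullet> (1 *\<^sub>R (e1 \<times> P 1)) - \<tau> \<bullet> (0 *\<^sub>R (e1 \<times> P 0))) {0..1}"
    proof (rule fundamental_theorem_of_calculus_interior_strong[OF finF])
      have bl: "bounded_linear (\<lambda>v. e1 \<times> v)"
        using bilinear_cross bilinear_conv_bounded_bilinear bounded_bilinear.bounded_linear_right by blast
      show "continuous_on {0..1} (\<lambda>x. \<tau> \<bullet> (x *\<^sub>R (e1 \<times> P x)))"
        by (intro continuous_intros continuous_on_cross cP)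
      fix x assume x: "x \<in> {0<..<1} - F"
      have "((\<lambda>x. e1 \<times> P x) has_vector_derivative e1 \<times> D x) (at x)"
        by (rule bounded_linear.has_vector_derivative[OF bl dP[OF x]])
      then have "((\<lambda>x. x *\<^sub>R (e1 \<times> P x)) has_vector_derivative x *\<^sub>R (e1 \<times> D x) + e1 \<times> P x) (at x)"
        by (auto intro!: derivative_eq_intros)
      then show "((\<lambda>x. \<tau> \<bullet> (x *\<^sub>R (e1 \<times> P x))) has_vector_derivative \<tau> \<bullet> (x *\<^sub>R (e1 \<times> D x) + e1 \<times> P x))
          (at x)"
        by (rule bounded_linear.has_vector_derivative[OF bounded_linear_inner_right])
    qed simp
    have iP: "((\<lambda>x. \<tau> \<bullet> (e1 \<times> P x)) has_integral \<tau> \<bullet> (e1 \<times> M)) {0..1}"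
    proof -
      have "bounded_linear (\<lambda>v. \<tau> \<bullet> (e1 \<times> v))"
        using bounded_linear_compose[OF bounded_linear_inner_right, of "\<lambda>v. e1 \<times> v" \<tau>]
          bilinear_cross bilinear_conv_bounded_bilinear bounded_bilinear.bounded_linear_right by blast
      from has_integral_linear[OF Mi this] show ?thesis by (simp add: o_def)
    qed
    \<comment> \<open>The integrand of the deviation \<open>y\<close> from the segment, written
      through \<open>P\<close> and \<open>D\<close>. The mixed terms are an exact derivative plus a
      multiple of the mean, which is how \<open>e1 \<times> m\<close> enters
      \<open>energy_lb\<close>.\<close>
    have "((\<lambda>x. ((norm (D x))\<^sup>2 + 2 * (\<tau> \<bullet> (P x \<times> D x))) - 2 * (D x \<bullet> e1) + 1
          - 2 * (\<tau> \<bullet> (x *\<^sub>R (e1 \<times> D x) + e1 \<times> P x)) + 4 * (\<tau> \<bullet> (e1 \<times> P x)))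
        has_integral ((\<Sum>i<N. real N * (norm (d i))\<^sup>2 + 2 * (\<tau> \<bullet> (p i \<times> d i))) - 2 * (P 1 \<bullet> e1 - P 0 \<bullet> e1) + 1
          - 2 * (\<tau> \<bullet> (1 *\<^sub>R (e1 \<times> P 1)) - \<tau> \<bullet> (0 *\<^sub>R (e1 \<times> P 0))) + 4 * (\<tau> \<bullet> (e1 \<times> M)))) {0..1}"
    proof (intro has_integral_add has_integral_diff has_integral_mult_right dPe dPx iP)
      show "((\<lambda>x. (norm (D x))\<^sup>2 + 2 * (\<tau> \<bullet> (P x \<times> D x))) has_integral
        (\<Sum>i<N. real N * (norm (d i))\<^sup>2 + 2 * (\<tau> \<bullet> (p i \<times> d i)))) {0..1}" using step N by simp
      show "((\<lambda>x. 1) has_integral (1::real)) {0..1::real}" using has_integral_const_real[of "1::real" 0 1]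
          by simp
    qed
    moreover have "((norm (D x))\<^sup>2 + 2 * (\<tau> \<bullet> (P x \<times> D x))) - 2 * (D x \<bullet> e1) + 1
          - 2 * (\<tau> \<bullet> (x *\<^sub>R (e1 \<times> D x) + e1 \<times> P x)) + 4 * (\<tau> \<bullet> (e1 \<times> P x))
        = (norm (y' x))\<^sup>2 + 2 * (\<tau> \<bullet> (y x \<times> y' x))" for x
    proof -
      have n: "(norm (y' x))\<^sup>2 = (norm (D x))\<^sup>2 - 2 * (D x \<bullet> e1) + 1"
        unfolding y'_def by (simp add: power2_norm_eq_inner inner_diff_left inner_diff_right inner_commute)
      have c: "y x \<times> y' x = P x \<times> D x + e1 \<times> P x - x *\<^sub>R (e1 \<times> D x)"
        unfolding y_def y'_def
        by (simp add: Cross3.left_diff_distrib Cross3.right_diff_distrib cross_mult_left cross_skew[of "P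
            x" e1])
      show ?thesis unfolding n c by (simp add: inner_add_right inner_diff_right algebra_simps)
    qed
    moreover have "(\<Sum>i<N. real N * (norm (d i))\<^sup>2 + 2 * (\<tau> \<bullet> (p i \<times> d i))) = real N * S + 2 * (\<tau> \<bullet> A)"
      unfolding S_def A_def by (simp add: sum.distrib sum_distrib_left inner_sum_right)
    ultimately have J: "((\<lambda>x. (norm (y' x))\<^sup>2 + 2 * (\<tau> \<bullet> (y x \<times> y' x))) has_integral
       real N * S + 2 * (\<tau> \<bullet> A) - 1 + 4 * (\<tau> \<bullet> (e1 \<times> M))) {0..1}"
      using P0 P1 by simp
    have "12 * (norm m)\<^sup>2 - 4 * (norm (m \<times> \<tau>))\<^sup>2 / cden (norm \<tau>) \<le> real N * S + 2 * (\<tau> \<bullet> A) - 1 + 4 * (\<tau> \<bullet>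
        (e1 \<times> M))"
      by (rule loop_inequality[OF \<tau> cy finF dy _ _ my J]) (simp_all add: y_def P0 P1)
    moreover have "e1 \<times> m = e1 \<times> M" unfolding m_def by (simp add: Cross3.right_diff_distrib cross_mult_right)
    ultimately show ?thesis unfolding energy_lb_def AT by (simp add: inner_diff_right algebra_simps)
  qed
  show ?thesis using nM main unfolding S_def by blast
qed

subsection \<open>Absolutely continuous curves\<close>

text \<open>The definition speaks of families indexed by natural numbers below \<open>n\<close>,
  whereas gauge divisions are finite sets; a bijection transfers the condition.\<close>

lemma abs_cont_on_finite_families:
  assumes "abs_cont_on S f" "0 < \<epsilon>"
  shows "\<exists>\<delta>>0. \<forall>(I :: 'i set) u v. finite I \<longrightarrow> (\<forall>i\<in>I. u i \<in> S \<and> v i \<in> S \<and> u i \<le> v i) \<longrightarrow>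
     (\<forall>i\<in>I. \<forall>j\<in>I. i \<noteq> j \<longrightarrow> v i \<le> u j \<or> v j \<le> u i) \<longrightarrow> (\<Sum>i\<in>I. v i - u i) < \<delta> \<longrightarrow>
     (\<Sum>i\<in>I. norm (f (v i) - f (u i))) < \<epsilon>"
proof -
  obtain \<delta> where \<delta>: "0 < \<delta>" "\<And>(n::nat) (ab :: nat \<Rightarrow> real \<times> real).
        (\<forall>k<n. fst (ab k) \<in> S \<and> snd (ab k) \<in> S \<and> fst (ab k) \<le> snd (ab k)) \<and>
        (\<forall>i<n. \<forall>j<n. i \<noteq> j \<longrightarrow> snd (ab i) \<le> fst (ab j) \<or> snd (ab j) \<le> fst (ab i)) \<and>
        (\<Sum>k<n. snd (ab k) - fst (ab k)) < \<delta>
        \<Longrightarrow> (\<Sum>k<n. norm (f (snd (ab k)) - f (fst (ab k)))) < \<epsilon>"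
    using assms unfolding abs_cont_on_def by blast
  show ?thesis
  proof (intro exI[of _ \<delta>] conjI \<delta>(1) allI impI)
    fix I :: "'i set" and u v
    assume fin: "finite I" and uv: "\<forall>i\<in>I. u i \<in> S \<and> v i \<in> S \<and> u i \<le> v i"
      and dj: "\<forall>i\<in>I. \<forall>j\<in>I. i \<noteq> j \<longrightarrow> v i \<le> u j \<or> v j \<le> u i"
      and len: "(\<Sum>i\<in>I. v i - u i) < \<delta>"
    obtain h where h: "bij_betw h {0..<card I} I" using ex_bij_betw_nat_finite[OF fin] by blast
    then have h: "bij_betw h {..<card I} I" by (simp add: atLeast0LessThan)
    have hI: "h k \<in> I" if "k < card I" for k using h that by (auto simp: bij_betw_def)
    have inj: "h i \<noteq> h j" if "i < card I" "j < card I" "i \<noteq> j" for i j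
      using h that by (auto simp: bij_betw_def inj_on_def)
    have "(\<Sum>k<card I. norm (f (snd (u (h k), v (h k))) - f (fst (u (h k), v (h k))))) < \<epsilon>"
    proof (rule \<delta>(2), intro conjI)
      show "(\<Sum>k<card I. snd (u (h k), v (h k)) - fst (u (h k), v (h k))) < \<delta>"
        using len sum.reindex_bij_betw[OF h, of "\<lambda>i. v i - u i"] by simp
    qed (use uv hI dj inj in auto)
    then show "(\<Sum>i\<in>I. norm (f (v i) - f (u i))) < \<epsilon>"
      using sum.reindex_bij_betw[OF h, of "\<lambda>i. norm (f (v i) - f (u i))"] by simp
  qed
qed

lemma abs_cont_on_subset: "\<lbrakk>abs_cont_on S f; T \<subseteq> S\<rbrakk> \<Longrightarrow> abs_cont_on T f"
  unfolding abs_cont_on_def by (meson subsetD)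

lemma nonoverlapping_intervals:
  fixes u v u' v' :: real
  assumes "interior {u..v} \<inter> interior {u'..v'} = {}" "u < v" "u' < v'"
  shows "v \<le> u' \<or> v' \<le> u"
proof (rule ccontr)
  assume "\<not> ?thesis"
  then have "(max u u' + min v v') / 2 \<in> {u<..<v} \<inter> {u'<..<v'}" using assms(2,3) by (auto simp: max_def
      min_def)
  then have "(max u u' + min v v') / 2 \<in> interior {u..v} \<inter> interior {u'..v'}"
    unfolding interior_atLeastAtMost_real .
  then show False unfolding assms(1) by (rule emptyE)
qed

text \<open>The fundamental theorem for absolutely continuous functions, in gauge form. At tags
  outside \<open>N\<close> the gauge is dictated by differentiability; at tags in \<open>N\<close>
  it confines the intervals to an open set of measure below \<open>\<delta>\<close>, where absolute
  continuity bounds the sum of the increments.\<close>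

lemma abs_cont_has_integral_derivative:
  fixes f f' :: "real \<Rightarrow> 'a::euclidean_space"
  assumes ab: "a \<le> b" and ac: "abs_cont_on {a..b} f" and N: "negligible N"
    and der: "\<And>x. x \<in> {a..b} - N \<Longrightarrow> (f has_vector_derivative f' x) (at x within {a..b})"
  shows "(f' has_integral (f b - f a)) {a..b}"
proof -
  define g where "g = (\<lambda>x. if x \<in> N then 0 else f' x)"
  have "(g has_integral (f b - f a)) {a..b}"
    unfolding has_integral_real
  proof (intro allI impI)
    fix e :: real assume e: "0 < e"
    define \<eta> where "\<eta> = e / (4 * (b - a + 1))"
    have \<eta>: "0 < \<eta>" using e ab by (simp add: \<eta>_def)
    have "\<eta> * (b - a) \<le> \<eta> * (b - a + 1)" using \<eta> by (intro mult_left_mono) auto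
    also have "\<dots> = e / 4" using ab by (simp add: \<eta>_def field_simps)
    finally have \<eta>_le: "\<eta> * (b - a) < e / 2" using e by linarith
    have "\<forall>x\<in>{a..b} - N. \<exists>d. 0 < d \<and> (\<forall>y\<in>{a..b}. norm (y - x) < d \<longrightarrow>
        norm (f y - f x - (y - x) *\<^sub>R f' x) \<le> \<eta> * norm (y - x))"
      using der \<eta> unfolding has_vector_derivative_def has_derivative_within_alt by blast
    then obtain d where d0: "\<forall>x\<in>{a..b} - N. 0 < d x \<and> (\<forall>y\<in>{a..b}. norm (y - x) < d x \<longrightarrow>
        norm (f y - f x - (y - x) *\<^sub>R f' x) \<le> \<eta> * norm (y - x))"
      by (rule exE[OF bchoice])
    have d: "\<And>x. x \<in> {a..b} - N \<Longrightarrow> 0 < d x"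
      "\<And>x y. \<lbrakk>x \<in> {a..b} - N; y \<in> {a..b}; norm (y - x) < d x\<rbrakk> \<Longrightarrow> norm (f y - f x - (y - x) *\<^sub>R f' x) \<le> \<eta> *
          norm (y - x)"
      using d0 by auto
    obtain \<delta> where \<delta>0: "0 < \<delta>"
      "\<forall>(I :: (real \<times> real set) set) u v. finite I \<longrightarrow> (\<forall>i\<in>I. u i \<in> {a..b} \<and> v i \<in> {a..b} \<and> u i \<le> v i) \<longrightarrow>
       (\<forall>i\<in>I. \<forall>j\<in>I. i \<noteq> j \<longrightarrow> v i \<le> u j \<or> v j \<le> u i) \<longrightarrow> (\<Sum>i\<in>I. v i - u i) < \<delta> \<longrightarrow>
       (\<Sum>i\<in>I. norm (f (v i) - f (u i))) < e / 2"
      using abs_cont_on_finite_families[OF ac half_gt_zero[OF e]] by blast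
    note \<delta> = \<delta>0(1) \<delta>0(2)[rule_format]
    obtain U where U: "open U" "N \<subseteq> U" "U \<in> lmeasurable" "measure lebesgue U < \<delta>"
    proof -
      have Nm: "N \<in> sets lebesgue" "N \<in> null_sets lebesgue"
        using N negligible_imp_sets negligible_iff_null_sets by auto
      obtain T where T: "open T" "N \<subseteq> T" "T - N \<in> lmeasurable" "emeasure lebesgue (T - N) < ennreal \<delta>"
        using sets_lebesgue_outer_open[OF Nm(1) \<delta>(1)] by metis
      have TT: "T \<in> sets lebesgue" using T(1) by auto
      have "emeasure lebesgue T = emeasure lebesgue (T - N)"
        using emeasure_Diff_null_set[OF Nm(2) TT] by simp
      then have "emeasure lebesgue T < ennreal \<delta>" using T by simp
      then have "T \<in> lmeasurable" "measure lebesgue T < \<delta>"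
        using TT \<delta>(1) by (auto simp: fmeasurable_def measure_def enn2real_less_iff less_trans[OF _
            ennreal_less_top])
      then show ?thesis using that T by blast
    qed
    define \<gamma> where "\<gamma> = (\<lambda>x. if x \<in> N then U else if x \<in> {a..b} then ball x (d x) else ball x 1)"
    have ga: "gauge \<gamma>" unfolding gauge_def \<gamma>_def using U d(1) by auto
    have main: "norm ((\<Sum>(x,k)\<in>p. measure lborel k *\<^sub>R g x) - (f b - f a)) < e"
      if p: "p tagged_division_of {a..b}" "\<gamma> fine p" for p
    proof -
      note pD = tagged_division_ofD[OF p(1)]
      \<comment> \<open>Degenerate intervals are left out: their increments vanish, and
        \<open>nonoverlapping_intervals\<close> can order only intervals of positive length.\<close>
      define D2 where "D2 = {z \<in> p. fst z \<in> N \<and> Inf (snd z) < Sup (snd z)}"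
      have fin: "finite p" "finite D2" using pD(1) by (auto simp: D2_def)
      have form: "\<exists>u v. k = {u..v} \<and> u \<le> v \<and> a \<le> u \<and> v \<le> b \<and> Inf k = u \<and> Sup k = v \<and> measure lborel k = v
          - u \<and> x \<in> {u..v}"
        if xk: "(x, k) \<in> p" for x k
      proof -
        obtain u v where uv: "k = {u..v}" using pD(4)[OF xk] by (auto simp: cbox_interval)
        have "x \<in> k" "k \<subseteq> {a..b}" using pD(2,3)[OF xk] by auto
        then have "u \<le> v" "a \<le> u" "v \<le> b" using uv by auto
        then show ?thesis using uv \<open>x \<in> k\<close> by auto
      qed
      have tel: "(\<Sum>(x,k)\<in>p. f (Sup k) - f (Inf k)) = f b - f a"
        by (rule additive_tagged_division_1[OF ab p(1)])
      have "(\<Sum>(x,k)\<in>p. measure lborel k *\<^sub>R g x) - (f b - f a)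
         = (\<Sum>(x,k)\<in>p. measure lborel k *\<^sub>R g x - (f (Sup k) - f (Inf k)))"
        unfolding tel[symmetric] sum_subtractf[symmetric] by (rule sum.cong) auto
      also have "norm \<dots> \<le> (\<Sum>(x,k)\<in>p. \<eta> * measure lborel k
           + (if (x, k) \<in> D2 then norm (f (Sup k) - f (Inf k)) else 0))"
      proof (rule sum_norm_le, clarify)
        fix x k assume xk: "(x, k) \<in> p"
        obtain u v where uv: "k = {u..v}" "u \<le> v" "a \<le> u" "v \<le> b" "Inf k = u" "Sup k = v" "measure lborel
            k = v - u" "x \<in> {u..v}"
          using form[OF xk] by blast
        show "norm (measure lborel k *\<^sub>R g x - (f (Sup k) - f (Inf k)))
          \<le> \<eta> * measure lborel k + (if (x, k) \<in> D2 then norm (f (Sup k) - f (Inf k)) else 0)"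
        proof (cases "x \<in> N")
          case True
          have nn: "0 \<le> \<eta> * (v - u)" using \<eta> uv by simp
          show ?thesis
          proof (cases "u < v")
            case True
            then show ?thesis using \<open>x \<in> N\<close> xk uv nn by (simp add: g_def D2_def norm_minus_commute)
          next
            case False
            then have "u = v" using uv by simp
            then show ?thesis using \<open>x \<in> N\<close> uv nn by (simp add: g_def)
          qed
        next
          case False
          have x: "x \<in> {a..b} - N" using False uv by auto
          have "k \<subseteq> \<gamma> x" using p(2) xk unfolding fine_def by fast
          moreover have "\<gamma> x = ball x (d x)" using x by (simp add: \<gamma>_def)
          ultimately have "k \<subseteq> ball x (d x)" by simp
          moreover have "u \<in> k" "v \<in> k" using uv by auto
          ultimately have "u \<in> ball x (d x)" "v \<in> ball x (d x)" by blast+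
          then have du: "norm (u - x) < d x" "norm (v - x) < d x" by (auto simp: dist_norm norm_minus_commute)
          have nv: "norm (f v - f x - (v - x) *\<^sub>R f' x) \<le> \<eta> * norm (v - x)"
            using d(2)[OF x _ du(2)] uv by auto
          have nu: "norm (f u - f x - (u - x) *\<^sub>R f' x) \<le> \<eta> * norm (u - x)"
            using d(2)[OF x _ du(1)] uv by auto
          have eq: "(v - u) *\<^sub>R f' x - (f v - f u) = (f u - f x - (u - x) *\<^sub>R f' x) - (f v - f x - (v - x)
              *\<^sub>R f' x)"
            by (simp add: algebra_simps)
          have "norm ((v - u) *\<^sub>R f' x - (f v - f u)) \<le> \<eta> * norm (u - x) + \<eta> * norm (v - x)"
            unfolding eq by (rule order_trans[OF norm_triangle_ineq4 add_mono[OF nu nv]])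
          also have "\<dots> = \<eta> * (v - u)" using uv by (simp add: algebra_simps)
          finally show ?thesis using False uv by (simp add: g_def D2_def)
        qed
      qed
      also have "\<dots> = \<eta> * (\<Sum>(x,k)\<in>p. measure lborel k) + (\<Sum>z\<in>D2. norm (f (Sup (snd z)) - f (Inf (snd z))))"
      proof -
        have "(\<Sum>(x,k)\<in>p. if (x, k) \<in> D2 then norm (f (Sup k) - f (Inf k)) else 0)
            = (\<Sum>z\<in>p. if z \<in> D2 then norm (f (Sup (snd z)) - f (Inf (snd z))) else 0)"
          by (rule sum.cong) auto
        also have "\<dots> = (\<Sum>z\<in>p \<inter> D2. norm (f (Sup (snd z)) - f (Inf (snd z))))"
          using fin by (simp add: sum.inter_restrict)
        also have "p \<inter> D2 = D2" by (auto simp: D2_def)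
        finally show ?thesis by (simp add: sum.distrib split_def sum_distrib_left)
      qed
      also have "(\<Sum>(x,k)\<in>p. measure lborel k) = b - a"
        using additive_content_tagged_division[of p a b] p(1) ab by (simp add: cbox_interval)
      also have "(\<Sum>z\<in>D2. norm (f (Sup (snd z)) - f (Inf (snd z)))) < e / 2"
      proof (rule \<delta>(2)[OF fin(2)])
        fix z assume "z \<in> D2"
        then have "(fst z, snd z) \<in> p" by (simp add: D2_def)
        from form[OF this] show "Inf (snd z) \<in> {a..b} \<and> Sup (snd z) \<in> {a..b} \<and> Inf (snd z) \<le> Sup (snd z)"
            by auto
      next
        fix z z' assume z: "z \<in> D2" "z' \<in> D2" "z \<noteq> z'"
        obtain u v where uv: "snd z = {u..v}" "Inf (snd z) = u" "Sup (snd z) = v" "u < v"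
          using form[of "fst z" "snd z"] z by (auto simp: D2_def)
        obtain u' v' where uv': "snd z' = {u'..v'}" "Inf (snd z') = u'" "Sup (snd z') = v'" "u' < v'"
          using form[of "fst z'" "snd z'"] z by (auto simp: D2_def)
        have "interior (snd z) \<inter> interior (snd z') = {}"
          using pD(5)[of "fst z" "snd z" "fst z'" "snd z'"] z by (auto simp: D2_def prod_eq_iff)
        then have "interior {u..v} \<inter> interior {u'..v'} = {}" using uv(1) uv'(1) by simp
        from nonoverlapping_intervals[OF this uv(4) uv'(4)]
        show "Sup (snd z) \<le> Inf (snd z') \<or> Sup (snd z') \<le> Inf (snd z)"
          using uv(2,3) uv'(2,3) by simp
      next
        have td: "D2 tagged_partial_division_of {a..b}"
          using p(1) tagged_partial_division_subset[of p "{a..b}" D2]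
          unfolding tagged_division_of_def by (auto simp: D2_def)
        then have td': "D2 tagged_division_of \<Union> (snd ` D2)"
          by (rule tagged_partial_division_of_Union_self)
        have "(\<Sum>z\<in>D2. Sup (snd z) - Inf (snd z)) = (\<Sum>(x,k)\<in>D2. measure lborel k)"
          using form by (intro sum.cong refl) (force simp: D2_def)
        also have "\<dots> = (\<Sum>k\<in>snd ` D2. measure lborel k)"
          by (rule sum.over_tagged_division_lemma[OF td']) (simp add: content_eq_0_interior)
        also have "\<dots> = (\<Sum>k\<in>snd ` D2. measure lebesgue k)"
        proof (rule sum.cong[OF refl])
          fix k assume "k \<in> snd ` D2"
          then obtain x where "(x, k) \<in> p" by (auto simp: D2_def)
          then obtain u v where "k = {u..v}" "u \<le> v" using form by blast
          then show "measure lborel k = measure lebesgue k" by simp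
        qed
        also have "\<dots> = measure lebesgue (\<Union> (snd ` D2))"
          using content_division[OF division_of_tagged_division[OF td']] .
        also have "\<dots> \<le> measure lebesgue U"
        proof (rule measure_mono_fmeasurable)
          show "\<Union> (snd ` D2) \<subseteq> U"
          proof clarify
            fix y x k assume yk: "(x, k) \<in> D2" "y \<in> snd (x, k)"
            then have "(x, k) \<in> p" "x \<in> N" by (auto simp: D2_def)
            then have "k \<subseteq> \<gamma> x" using p(2) unfolding fine_def by fast
            then show "y \<in> U" using yk \<open>x \<in> N\<close> by (auto simp: \<gamma>_def)
          qed
          show "\<Union> (snd ` D2) \<in> sets lebesgue"
            using lmeasurable_division[OF division_of_tagged_division[OF td']] by (rule fmeasurableD)
        qed (rule U(3))
        also have "\<dots> < \<delta>" by (rule U(4))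
        finally show "(\<Sum>z\<in>D2. Sup (snd z) - Inf (snd z)) < \<delta>" .
      qed
      finally show ?thesis using \<eta>_le by linarith
    qed
    show "\<exists>\<gamma>. gauge \<gamma> \<and> (\<forall>\<D>. \<D> tagged_division_of {a..b} \<and> \<gamma> fine \<D> \<longrightarrow>
        norm ((\<Sum>(x, k)\<in>\<D>. measure lborel k *\<^sub>R g x) - (f b - f a)) < e)"
      by (intro exI[of _ \<gamma>] conjI ga allI impI; elim conjE; rule main)
  qed
  then show ?thesis
    by (rule has_integral_spike[OF N, rotated]) (auto simp: g_def)
qed

text \<open>On an interval shorter than the \<open>\<delta>\<close> belonging to 1, the integrals of
  \<open>f'\<close> over any division have norms summing to at most 1; finitely many such intervals
  are then joined. This makes the integral in \<open>curve_length\<close> a genuine one rather than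
  the default 0.\<close>

lemma abs_cont_absolutely_integrable_derivative:
  fixes f f' :: "real \<Rightarrow> 'a::euclidean_space"
  assumes ab: "a \<le> b" and ac: "abs_cont_on {a..b} f"
    and int: "\<And>u v. \<lbrakk>a \<le> u; u \<le> v; v \<le> b\<rbrakk> \<Longrightarrow> (f' has_integral (f v - f u)) {u..v}"
  shows "f' absolutely_integrable_on {a..b}"
proof -
  obtain \<delta> where \<delta>0: "0 < \<delta>"
    "\<forall>(I :: real set set) u v. finite I \<longrightarrow> (\<forall>i\<in>I. u i \<in> {a..b} \<and> v i \<in> {a..b} \<and> u i \<le> v i) \<longrightarrow>
     (\<forall>i\<in>I. \<forall>j\<in>I. i \<noteq> j \<longrightarrow> v i \<le> u j \<or> v j \<le> u i) \<longrightarrow> (\<Sum>i\<in>I. v i - u i) < \<delta> \<longrightarrow>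
     (\<Sum>i\<in>I. norm (f (v i) - f (u i))) < 1"
    using abs_cont_on_finite_families[OF ac zero_less_one] by blast
  note \<delta> = \<delta>0(1) \<delta>0(2)[rule_format]
  have local: "f' absolutely_integrable_on {u..v}" if uv: "a \<le> u" "u \<le> v" "v \<le> b" "v - u < \<delta>" for u v
  proof -
    have "f' absolutely_integrable_on cbox u v"
    proof (rule bounded_variation_absolutely_integrable_interval)
      show "f' integrable_on cbox u v" using int[OF uv(1-3)] by (auto simp: cbox_interval)
      fix D assume D: "D division_of cbox u v"
      note DD = division_ofD[OF D]
      define I where "I = {k \<in> D. Inf k < Sup k}"
      have finI: "finite I" using DD(1) by (simp add: I_def)
      have form: "\<exists>c d. k = {c..d} \<and> c \<le> d \<and> u \<le> c \<and> d \<le> v \<and> Inf k = c \<and> Sup k = d \<and> measure lborel k = d - c"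
        if k: "k \<in> D" for k
      proof -
        obtain c d where cd: "k = {c..d}" using DD(4)[OF k] by (auto simp: cbox_interval)
        have "k \<noteq> {}" "k \<subseteq> {u..v}" using DD(2,3)[OF k] by (auto simp: cbox_interval)
        then have "c \<le> d" "u \<le> c" "d \<le> v" using cd by auto
        then show ?thesis using cd by auto
      qed
      have val: "integral k f' = f (Sup k) - f (Inf k)" if "k \<in> D" for k
        using form[OF that] int uv by (force intro!: integral_unique)
      have "(\<Sum>k\<in>D. norm (integral k f')) = (\<Sum>k\<in>D. norm (f (Sup k) - f (Inf k)))"
        using val by (intro sum.cong) auto
      also have "\<dots> = (\<Sum>k\<in>I. norm (f (Sup k) - f (Inf k)))"
      proof (rule sum.mono_neutral_right)
        show "\<forall>k\<in>D - I. norm (f (Sup k) - f (Inf k)) = 0"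
        proof
          fix k assume k: "k \<in> D - I"
          then have "\<not> Inf k < Sup k" "Inf k \<le> Sup k" using form[of k] by (auto simp: I_def)
          then show "norm (f (Sup k) - f (Inf k)) = 0" by simp
        qed
      qed (auto simp: I_def DD(1))
      also have "\<dots> < 1"
      proof (rule \<delta>(2)[OF finI])
        fix k assume "k \<in> I"
        then show "Inf k \<in> {a..b} \<and> Sup k \<in> {a..b} \<and> Inf k \<le> Sup k"
          using form[of k] uv by (auto simp: I_def)
      next
        fix k k' assume k: "k \<in> I" "k' \<in> I" "k \<noteq> k'"
        then have "interior k \<inter> interior k' = {}" using DD(5)[of k k'] by (auto simp: I_def)
        moreover obtain c d where "k = {c..d}" "Inf k = c" "Sup k = d" "c < d"
          using form[of k] k by (auto simp: I_def)
        moreover obtain c' d' where "k' = {c'..d'}" "Inf k' = c'" "Sup k' = d'" "c' < d'"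
          using form[of k'] k by (auto simp: I_def)
        ultimately show "Sup k \<le> Inf k' \<or> Sup k' \<le> Inf k"
          using nonoverlapping_intervals by metis
      next
        have "(\<Sum>k\<in>I. Sup k - Inf k) \<le> (\<Sum>k\<in>D. measure lborel k)"
        proof -
          have "(\<Sum>k\<in>I. Sup k - Inf k) = (\<Sum>k\<in>I. measure lborel k)"
            using form by (intro sum.cong refl) (force simp: I_def)
          also have "\<dots> \<le> (\<Sum>k\<in>D. measure lborel k)"
            by (rule sum_mono2) (auto simp: DD(1) I_def)
          finally show ?thesis .
        qed
        also have "\<dots> = v - u" using additive_content_division[OF D] uv by simp
        finally show "(\<Sum>k\<in>I. Sup k - Inf k) < \<delta>" using uv by simp
      qed
      finally show "(\<Sum>k\<in>D. norm (integral k f')) \<le> 1" by simp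
    qed
    then show ?thesis by (simp add: cbox_interval)
  qed
  have step: "f' absolutely_integrable_on {a..min b (a + real n * (\<delta> / 2))}" for n
  proof (induction n)
    case 0
    then show ?case using local[of a a] ab \<delta>(1) by simp
  next
    case (Suc n)
    let ?c = "min b (a + real n * (\<delta> / 2))" and ?d = "min b (a + real (Suc n) * (\<delta> / 2))"
    have cd: "a \<le> ?c" "?c \<le> ?d" "?d \<le> b" "?d - ?c < \<delta>"
      using ab \<delta>(1) by (auto simp: min_def field_simps)
    show ?case by (rule absolutely_integrable_on_combine[OF Suc local[OF cd] cd(1,2)])
  qed
  obtain n where "(b - a) / (\<delta> / 2) < real n" using reals_Archimedean2 by blast
  then have "b \<le> a + real n * (\<delta> / 2)" using \<delta>(1) by (simp add: field_simps)
  then show ?thesis using step[of n] by (simp add: min_def)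
qed

section \<open>The lower bound for horizontal curves\<close>

lemma Uform_cross: "Uform x y = y \<times> x"
proof -
  have "(U j *v x) \<bullet> y = (y \<times> x) $ j" for j
    using exhaust_3[of j]
    by (auto simp: U_def Umat_def matrix_vector_mult_def inner_vec_def sum_3 axis_def cross3_simps)
  then show ?thesis by (simp add: Uform_def vec_eq_iff)
qed

lemma bounded_bilinear_cross3: "bounded_bilinear (\<times>)"
  using bilinear_cross bilinear_conv_bounded_bilinear by blast

lemma norm_cross_le: "norm (x \<times> y) \<le> norm x * norm y"
proof -
  have "(norm (x \<times> y))\<^sup>2 \<le> (norm x * norm y)\<^sup>2"
    using norm_cross_dot[of x y] by (metis le_add_same_cancel1 zero_le_power2)
  then show ?thesis by (meson mult_nonneg_nonneg norm_ge_zero power2_le_imp_le)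
qed

lemma energy_lb_tendsto:
  assumes "T \<longlonglongrightarrow> t" "M \<longlonglongrightarrow> m"
  shows "(\<lambda>n. energy_lb (T n) (M n) \<tau>) \<longlonglongrightarrow> energy_lb t m \<tau>"
  unfolding energy_lb_def divide_inverse
  by (intro tendsto_intros assms bounded_bilinear.tendsto[OF bounded_bilinear_cross3])

text \<open>Inscribed polygons with vertices at equal arc length have energy at most the squared length of the
  curve, and their area vectors converge.\<close>

lemma curve_bound:
  assumes hor: "horizontal_curve \<gamma> (e1, t)"
  shows "\<exists>m. \<forall>\<tau>. norm \<tau> < theta1 \<longrightarrow> energy_lb t m \<tau> \<le> (curve_length \<gamma>)\<^sup>2 - 1"
proof -
  define V where "V = (\<lambda>s. vector_derivative \<gamma> (at s))"
  define X where "X = (\<lambda>s. fst (\<gamma> s))"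
  define T where "T = (\<lambda>s. snd (\<gamma> s))"
  define X' where "X' = (\<lambda>s. fst (V s))"
  define l where "l = curve_length \<gamma>"
  have ac: "abs_cont_on {0..1} \<gamma>" and g0: "\<gamma> 0 = (0, 0)" and g1: "\<gamma> 1 = (e1, t)"
    and ae: "AE s in lborel. s \<in> {0..1} \<longrightarrow> \<gamma> differentiable (at s) \<and>
        snd (V s) = (1/2) *\<^sub>R (X' s \<times> X s)"
    using hor by (auto simp: horizontal_curve_def N32_id_def V_def X_def X'_def Uform_cross)
  obtain Z where Z: "{s \<in> space lborel. \<not> (s \<in> {0..1} \<longrightarrow> \<gamma> differentiable (at s) \<and>
        snd (V s) = (1/2) *\<^sub>R (X' s \<times> X s))} \<subseteq> Z" "emeasure lborel Z = 0" "Z \<in> sets lborel"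
    using AE_E[OF ae] by blast
  have neg: "negligible Z"
    using Z unfolding negligible_iff_null_sets by (intro null_sets_completionI) auto
  have good: "(\<gamma> has_vector_derivative V s) (at s)" "snd (V s) = (1/2) *\<^sub>R (X' s \<times> X s)"
    if "s \<in> {0..1} - Z" for s
    using that Z(1) by (auto simp: V_def vector_derivative_works)
  have Vint: "(V has_integral \<gamma> v - \<gamma> u) {u..v}" if "0 \<le> u" "u \<le> v" "v \<le> 1" for u v
  proof (rule abs_cont_has_integral_derivative[OF that(2) abs_cont_on_subset[OF ac] neg])
    show "{u..v} \<subseteq> {0..1}" using that by auto
    fix x assume "x \<in> {u..v} - Z"
    then have "x \<in> {0..1} - Z" using that by auto
    then show "(\<gamma> has_vector_derivative V x) (at x within {u..v})"
      by (rule has_vector_derivative_at_within[OF good(1)])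
  qed
  have "V absolutely_integrable_on {0..1}"
    by (rule abs_cont_absolutely_integrable_derivative[OF _ ac Vint]) auto
  then have "(fst \<circ> V) absolutely_integrable_on {0..1}"
    by (rule absolutely_integrable_linear[OF _ bounded_linear_fst])
  then have nint1: "(\<lambda>s. norm (X' s)) integrable_on {0..1}"
    by (simp add: absolutely_integrable_on_def X'_def o_def)
  have nint: "(\<lambda>s. norm (X' s)) integrable_on {u..v}" if "0 \<le> u" "u \<le> v" "v \<le> 1" for u v
    using that by (intro integrable_subinterval_real[OF nint1]) auto
  have Xint: "(X' has_integral X v - X u) {u..v}" if "0 \<le> u" "u \<le> v" "v \<le> 1" for u v
    using has_integral_linear[OF Vint[OF that] bounded_linear_fst] by (simp add: o_def X'_def X_def)
  have Tint: "((\<lambda>s. (1/2) *\<^sub>R (X' s \<times> X s)) has_integral T v - T u) {u..v}" if "0 \<le> u" "u \<le> v" "v \<le> 1" for u v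
  proof -
    have "((\<lambda>s. snd (V s)) has_integral T v - T u) {u..v}"
      using has_integral_linear[OF Vint[OF that] bounded_linear_snd] by (simp add: o_def T_def)
    then show ?thesis
      by (rule has_integral_spike[OF neg, rotated]) (use good(2) that in auto)
  qed
  define L where "L = (\<lambda>s. integral {0..s} (\<lambda>s. norm (X' s)))"
  have Ldiff: "integral {u..v} (\<lambda>s. norm (X' s)) = L v - L u" if "0 \<le> u" "u \<le> v" "v \<le> 1" for u v
    using Henstock_Kurzweil_Integration.integral_combine[OF that(1,2) nint[of 0 v]] that by (simp add: L_def)
  have Lmono: "L u \<le> L v" if "0 \<le> u" "u \<le> v" "v \<le> 1" for u v
    using Ldiff[OF that] Henstock_Kurzweil_Integration.integral_nonneg[OF nint[OF that]] by simp
  have Xdiff: "norm (X v - X u) \<le> L v - L u" if "0 \<le> u" "u \<le> v" "v \<le> 1" for u v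
    using integral_norm_bound_integral[OF has_integral_integrable[OF Xint[OF that]] nint[OF that]]
      Ldiff[OF that] integral_unique[OF Xint[OF that]] by simp
  \<comment> \<open>Replacing an arc by its chord costs an error quadratic in the length of the arc,
    so \<open>N\<close> arcs of length \<open>l / N\<close> cost at most
    \<open>l^2 / (2 * N)\<close> together.\<close>
  have Tdiff: "norm (T v - T u - (1/2) *\<^sub>R ((X v - X u) \<times> X u)) \<le> (L v - L u)\<^sup>2 / 2"
    if uv: "0 \<le> u" "u \<le> v" "v \<le> 1" for u v
  proof -
    define e where "e = L v - L u"
    have "((\<lambda>s. (1/2) *\<^sub>R (X' s \<times> X u)) has_integral (1/2) *\<^sub>R ((X v - X u) \<times> X u)) {u..v}"
      using has_integral_linear[OF Xint[OF uv] bounded_bilinear.bounded_linear_left[OF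
          bounded_bilinear_cross3, of "X u"]]
      by (intro has_integral_cmul) (simp add: o_def)
    from has_integral_diff[OF Tint[OF uv] this]
    have i: "((\<lambda>s. (1/2) *\<^sub>R (X' s \<times> (X s - X u))) has_integral T v - T u - (1/2) *\<^sub>R ((X v - X u) \<times> X u))
        {u..v}"
      by (simp add: Cross3.right_diff_distrib scaleR_diff_right)
    have "norm (integral {u..v} (\<lambda>s. (1/2) *\<^sub>R (X' s \<times> (X s - X u)))) \<le> integral {u..v} (\<lambda>s. (e / 2) *
        norm (X' s))"
    proof (rule integral_norm_bound_integral)
      show "(\<lambda>s. (1/2) *\<^sub>R (X' s \<times> (X s - X u))) integrable_on {u..v}" using i by blast
      show "(\<lambda>s. (e / 2) * norm (X' s)) integrable_on {u..v}"
        using integrable_cmul[OF nint[OF uv], of "e / 2"] by simp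
      fix s assume s: "s \<in> {u..v}"
      have "norm (X s - X u) \<le> e"
        using Xdiff[of u s] Lmono[of s v] s uv by (auto simp: e_def)
      then have "norm (X' s \<times> (X s - X u)) \<le> norm (X' s) * e"
        using norm_cross_le[of "X' s" "X s - X u"] mult_left_mono[of "norm (X s - X u)" e "norm (X' s)"]
            by simp
      then show "norm ((1/2) *\<^sub>R (X' s \<times> (X s - X u))) \<le> (e / 2) * norm (X' s)" by (simp add: mult.commute)
    qed
    also have "integral {u..v} (\<lambda>s. (e / 2) * norm (X' s)) = e / 2 * e"
      using Ldiff[OF uv] by (simp add: e_def)
    finally have "norm (T v - T u - (1/2) *\<^sub>R ((X v - X u) \<times> X u)) \<le> e / 2 * e"
      unfolding integral_unique[OF i] .
    then show ?thesis by (simp add: e_def power2_eq_square)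
  qed
  have L0: "L 0 = 0" by (simp add: L_def)
  have L1: "L 1 = l" by (simp add: L_def l_def curve_length_def X'_def V_def)
  have X01: "X 0 = 0" "X 1 = e1" "T 0 = 0" "T 1 = t" using g0 g1 by (auto simp: X_def T_def)
  have l1: "1 \<le> l" using Xdiff[of 0 1] X01 L0 L1 by simp
  have Lcont: "continuous_on {0..1} L" unfolding L_def by (rule indefinite_integral_continuous_1[OF nint1])
  have approx: "\<exists>Tn m. norm (t - Tn) \<le> l\<^sup>2 / 2 * inverse (real (Suc n)) \<and> norm m \<le> l + 1 \<and>
      (\<forall>\<tau>. norm \<tau> < theta1 \<longrightarrow> energy_lb Tn m \<tau> \<le> l\<^sup>2 - 1)" for n
  proof -
    define N where "N = Suc n"
    have N: "0 < N" by (simp add: N_def)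
    \<comment> \<open>The end times are prescribed separately, since \<open>L\<close> may be
      constant near 0 or 1 and then does not determine them.\<close>
    have "\<exists>r. i \<le> N \<longrightarrow> (r \<in> {0..1} \<and> L r = real i * l / N \<and> (i = 0 \<longrightarrow> r = 0) \<and> (i = N \<longrightarrow> r = 1))" for i
    proof (cases "i = 0 \<or> i = N")
      case True
      then show ?thesis using L0 L1 N by (intro exI[of _ "if i = 0 then 0 else 1"]) auto
    next
      case False
      show ?thesis
      proof (cases "i \<le> N")
        case True
        have "real i * l / N \<le> l" using True N l1 by (simp add: field_simps)
        then have "\<exists>r. 0 \<le> r \<and> r \<le> 1 \<and> L r = real i * l / N"
          using IVT'[of L 0 "real i * l / N" 1] L0 L1 l1 Lcont by auto
        then show ?thesis using False by auto
      qed auto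
    qed
    then have "\<forall>i. \<exists>r. i \<le> N \<longrightarrow> (r \<in> {0..1} \<and> L r = real i * l / N \<and> (i = 0 \<longrightarrow> r = 0) \<and> (i = N \<longrightarrow> r = 1))"
      by (rule allI)
    then obtain \<sigma> where \<sigma>0: "\<forall>i. i \<le> N \<longrightarrow> (\<sigma> i \<in> {0..1} \<and> L (\<sigma> i) = real i * l / N \<and> (i = 0 \<longrightarrow> \<sigma> i = 0) \<and> (i
        = N \<longrightarrow> \<sigma> i = 1))"
      by (rule exE[OF choice])
    note \<sigma> = \<sigma>0[THEN spec, THEN mp]
    define p where "p = (\<lambda>i. X (\<sigma> i))"
    define d where "d = (\<lambda>i. p (Suc i) - p i)"
    have p0: "p 0 = 0" and pN: "p N = e1" using \<sigma>[of 0] \<sigma>[of N] X01 by (auto simp: p_def)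
    have cell: "0 \<le> \<sigma> i" "\<sigma> i \<le> \<sigma> (Suc i)" "\<sigma> (Suc i) \<le> 1" "L (\<sigma> (Suc i)) - L (\<sigma> i) = l / N" if "i < N" for i
    proof -
      show *: "0 \<le> \<sigma> i" "\<sigma> (Suc i) \<le> 1" using \<sigma>[of i] \<sigma>[of "Suc i"] that by auto
      have "L (\<sigma> (Suc i)) - L (\<sigma> i) = real (Suc i) * l / N - real i * l / N"
        using \<sigma>[of i] \<sigma>[of "Suc i"] that by auto
      also have "\<dots> = l / N" by (simp add: diff_divide_distrib[symmetric] algebra_simps)
      finally show L: "L (\<sigma> (Suc i)) - L (\<sigma> i) = l / N" .
      show "\<sigma> i \<le> \<sigma> (Suc i)"
      proof (rule ccontr)
        assume "\<not> ?thesis"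
        then have "L (\<sigma> (Suc i)) \<le> L (\<sigma> i)"
          using \<sigma>[of i] \<sigma>[of "Suc i"] that by (intro Lmono) auto
        moreover have "0 < l / N" using l1 N by simp
        ultimately show False using L by linarith
      qed
    qed
    have dn: "norm (d i) \<le> l / N" if "i < N" for i
      using Xdiff[OF cell(1-3)[OF that]] cell(4)[OF that] by (simp add: d_def p_def)
    obtain m where m: "norm m \<le> (\<Sum>i<N. norm (d i)) + 1"
      "\<And>\<tau>. norm \<tau> < theta1 \<Longrightarrow> energy_lb ((1/2) *\<^sub>R (\<Sum>i<N. d i \<times> p i)) m \<tau> \<le> real N * (\<Sum>i<N. (norm (d i))\<^sup>2)
          - 1"
      using polygon_bound[OF N p0 pN] unfolding d_def by blast
    have "(\<Sum>i<N. norm (d i)) \<le> (\<Sum>i<N. l / N)" using dn by (intro sum_mono) auto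
    then have m1: "norm m \<le> l + 1" using m(1) N by simp
    have "(\<Sum>i<N. (norm (d i))\<^sup>2) \<le> (\<Sum>i<N. (l / N)\<^sup>2)" using dn by (intro sum_mono power_mono) auto
    then have "real N * (\<Sum>i<N. (norm (d i))\<^sup>2) \<le> real N * (\<Sum>i<N. (l / N)\<^sup>2)" using N by simp
    also have "\<dots> = l\<^sup>2" using N by (simp add: power2_eq_square)
    finally have E: "real N * (\<Sum>i<N. (norm (d i))\<^sup>2) \<le> l\<^sup>2" .
    have "t = (\<Sum>i<N. T (\<sigma> (Suc i)) - T (\<sigma> i))"
      using sum_lessThan_telescope[of "\<lambda>i. T (\<sigma> i)" N] \<sigma>[of 0] \<sigma>[of N] X01 by simp
    then have "t - (1/2) *\<^sub>R (\<Sum>i<N. d i \<times> p i) = (\<Sum>i<N. T (\<sigma> (Suc i)) - T (\<sigma> i) - (1/2) *\<^sub>R (d i \<times> p i))"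
      by (simp add: sum_subtractf scaleR_sum_right)
    also have "norm \<dots> \<le> (\<Sum>i<N. (l / N)\<^sup>2 / 2)"
    proof (rule sum_norm_le)
      fix i assume "i \<in> {..<N}"
      then have i: "i < N" by simp
      show "norm (T (\<sigma> (Suc i)) - T (\<sigma> i) - (1/2) *\<^sub>R (d i \<times> p i)) \<le> (l / N)\<^sup>2 / 2"
        using Tdiff[OF cell(1-3)[OF i]] unfolding cell(4)[OF i] d_def p_def .
    qed
    also have "\<dots> = l\<^sup>2 / 2 * inverse (real (Suc n))"
      using N by (simp add: N_def[symmetric] power2_eq_square field_simps)
    finally have Tn: "norm (t - (1/2) *\<^sub>R (\<Sum>i<N. d i \<times> p i)) \<le> l\<^sup>2 / 2 * inverse (real (Suc n))" .
    show ?thesis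
    proof (intro exI conjI allI impI, rule Tn, rule m1)
      fix \<tau> :: "real^3" assume "norm \<tau> < theta1"
      from m(2)[OF this] E show "energy_lb ((1/2) *\<^sub>R (\<Sum>i<N. d i \<times> p i)) m \<tau> \<le> l\<^sup>2 - 1" by linarith
    qed
  qed
  then have "\<forall>n. \<exists>Tn m. norm (t - Tn) \<le> l\<^sup>2 / 2 * inverse (real (Suc n)) \<and> norm m \<le> l + 1 \<and>
      (\<forall>\<tau>. norm \<tau> < theta1 \<longrightarrow> energy_lb Tn m \<tau> \<le> l\<^sup>2 - 1)" by (rule allI)
  then obtain Tn where "\<forall>n. \<exists>m. norm (t - Tn n) \<le> l\<^sup>2 / 2 * inverse (real (Suc n)) \<and> norm m \<le> l + 1 \<and>
      (\<forall>\<tau>. norm \<tau> < theta1 \<longrightarrow> energy_lb (Tn n) m \<tau> \<le> l\<^sup>2 - 1)"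
    by (rule exE[OF choice])
  then obtain M where "\<forall>n. norm (t - Tn n) \<le> l\<^sup>2 / 2 * inverse (real (Suc n)) \<and> norm (M n) \<le> l + 1 \<and>
      (\<forall>\<tau>. norm \<tau> < theta1 \<longrightarrow> energy_lb (Tn n) (M n) \<tau> \<le> l\<^sup>2 - 1)"
    by (rule exE[OF choice])
  then have TM: "\<And>n. norm (t - Tn n) \<le> l\<^sup>2 / 2 * inverse (real (Suc n))" "\<And>n. norm (M n) \<le> l + 1"
    "\<And>n \<tau>. norm \<tau> < theta1 \<Longrightarrow> energy_lb (Tn n) (M n) \<tau> \<le> l\<^sup>2 - 1"
    by blast+
  have "Tn \<longlonglongrightarrow> t"
  proof -
    have "(\<lambda>n. l\<^sup>2 / 2 * inverse (real (Suc n))) \<longlonglongrightarrow> l\<^sup>2 / 2 * 0"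
      by (intro tendsto_intros LIMSEQ_inverse_real_of_nat)
    then have "(\<lambda>n. l\<^sup>2 / 2 * inverse (real (Suc n))) \<longlonglongrightarrow> 0" by (simp only: mult_zero_right)
    then have "(\<lambda>n. t - Tn n) \<longlonglongrightarrow> 0"
      by (rule Lim_null_comparison[rotated]) (rule always_eventually, rule allI, rule TM(1))
    from tendsto_diff[OF tendsto_const[of t] this] show ?thesis by simp
  qed
  \<comment> \<open>The means of the polygons stay bounded, and one limit point serves all
    \<open>\<tau>\<close> at once.\<close>
  have "\<forall>n. M n \<in> cball 0 (l + 1)" using TM(2) by simp
  then obtain m r where r: "strict_mono r" "(M \<circ> r) \<longlonglongrightarrow> m"
    using compact_cball[of "0::real^3" "l + 1"] unfolding compact_def by blast
  have "energy_lb t m \<tau> \<le> l\<^sup>2 - 1" if "norm \<tau> < theta1" for \<tau>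
  proof (rule LIMSEQ_le_const2)
    show "(\<lambda>n. energy_lb ((Tn \<circ> r) n) ((M \<circ> r) n) \<tau>) \<longlonglongrightarrow> energy_lb t m \<tau>"
      by (rule energy_lb_tendsto[OF LIMSEQ_subseq_LIMSEQ[OF \<open>Tn \<longlonglongrightarrow> t\<close> r(1)] r(2)])
    show "\<exists>N. \<forall>n\<ge>N. energy_lb ((Tn \<circ> r) n) ((M \<circ> r) n) \<tau> \<le> l\<^sup>2 - 1" using TM(3)[OF that] by simp
  qed
  then show ?thesis unfolding l_def by blast
qed

subsection \<open>Minimisation over the mean\<close>

text \<open>Multipliers range over a closed ball of radius \<open>S\<close> below
  \<open>theta1\<close>: it is compact, and \<open>cden (norm \<tau>)\<close> stays away from 0 on
  it.\<close>

definition is_max :: "real^3 \<Rightarrow> real \<Rightarrow> real^3 \<Rightarrow> real^3 \<Rightarrow> bool" where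
  "is_max t S m \<tau> \<longleftrightarrow> norm \<tau> \<le> S \<and> (\<forall>\<tau>'. norm \<tau>' \<le> S \<longrightarrow> energy_lb t m \<tau>' \<le> energy_lb t m \<tau>)"

lemma energy_lb_tendsto2:
  assumes S: "S < theta1" and M: "M \<longlonglongrightarrow> m" and T: "T \<longlonglongrightarrow> \<tau>" and b: "\<And>n. norm (T n) \<le> S"
  shows "(\<lambda>n. energy_lb t (M n) (T n)) \<longlonglongrightarrow> energy_lb t m \<tau>"
proof -
  have nT: "(\<lambda>n. norm (T n)) \<longlonglongrightarrow> norm \<tau>" by (intro tendsto_intros T)
  have n\<tau>: "norm \<tau> \<le> S" by (rule LIMSEQ_le_const2[OF nT]) (use b in auto)
  have "(\<lambda>n. cden (norm (T n))) \<longlonglongrightarrow> cden (norm \<tau>)"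
    using cden_continuous_on continuous_on_tendsto_compose[OF cden_continuous_on nT] n\<tau> b S
    by (auto intro!: always_eventually le_less_trans[OF _ S])
  moreover have "cden (norm \<tau>) \<noteq> 0" using cden_pos[of "norm \<tau>"] n\<tau> S by auto
  ultimately show ?thesis unfolding energy_lb_def
    by (intro tendsto_intros M T bounded_bilinear.tendsto[OF bounded_bilinear_cross3])
qed

lemma is_max_exists:
  assumes S: "0 \<le> S" "S < theta1"
  shows "\<exists>\<tau>. is_max t S m \<tau>"
proof -
  have "continuous_on (cball 0 S) (energy_lb t m)"
    unfolding continuous_on_sequentially
  proof (intro allI impI ballI, elim conjE)
    fix x :: "nat \<Rightarrow> real^3" and a assume x: "\<forall>n. x n \<in> cball 0 S" "x \<longlonglongrightarrow> a"
    then show "(energy_lb t m \<circ> x) \<longlonglongrightarrow> energy_lb t m a"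
      using energy_lb_tendsto2[OF S(2) tendsto_const[of m] x(2)] by (simp add: o_def)
  qed
  then obtain \<tau> where "\<tau> \<in> cball 0 S" "\<And>y. y \<in> cball 0 S \<Longrightarrow> energy_lb t m y \<le> energy_lb t m \<tau>"
    using continuous_attains_sup[OF compact_cball, of 0 S "energy_lb t m"] S by auto
  then show ?thesis unfolding is_max_def by auto
qed

lemma norm_midpoint_sq:
  fixes x y :: "'a::real_inner"
  shows "(norm ((1/2) *\<^sub>R (x + y)))\<^sup>2 = ((norm x)\<^sup>2 + (norm y)\<^sup>2) / 2 - (norm (x - y))\<^sup>2 / 4"
  unfolding power2_norm_eq_inner
  by (simp add: inner_add_left inner_add_right inner_diff_left inner_diff_right inner_commute field_simps)

text \<open>For different norms this is strict concavity of \<open>cden\<close> together with its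
  decrease. For equal norms the midpoint is strictly shorter, and the strict decrease of
  \<open>cden\<close> does the work.\<close>

lemma cden_norm_midpoint:
  fixes x y :: "real^3"
  assumes S: "norm x \<le> S" "norm y \<le> S" "S < theta1" and ne: "x \<noteq> y"
  shows "(cden (norm x) + cden (norm y)) / 2 < cden (norm ((1/2) *\<^sub>R (x + y)))" "norm ((1/2) *\<^sub>R (x + y)) < S"
proof -
  define z where "z = norm ((1/2) *\<^sub>R (x + y))"
  have z0: "0 \<le> z" by (simp add: z_def)
  have tri: "z \<le> (norm x + norm y) / 2" using norm_triangle_ineq[of x y] by (simp add: z_def)
  have eq: "z < norm x" if "norm x = norm y"
  proof (rule power2_less_imp_less)
    have "0 < (norm (x - y))\<^sup>2" using ne by simp
    then show "z\<^sup>2 < (norm x)\<^sup>2" using norm_midpoint_sq[of x y] that unfolding z_def by simp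
  qed simp
  have "(cden (norm x) + cden (norm y)) / 2 < cden z"
  proof (cases "norm x = norm y")
    case True
    then show ?thesis using cden_strict_anti[of z "norm x"] eq z0 S by simp
  next
    case False
    define a where "a = (norm x + norm y) / 2"
    have "a < theta1" "z \<le> a" using tri S by (auto simp: a_def)
    then have "cden a \<le> cden z"
      using cden_strict_anti[of z a] z0 by (cases "z = a") auto
    then have "cden ((norm x + norm y) / 2) \<le> cden z" by (simp only: a_def)
    then show ?thesis using cden_midpoint[of "norm x" "norm y"] False S by simp
  qed
  then show "(cden (norm x) + cden (norm y)) / 2 < cden (norm ((1/2) *\<^sub>R (x + y)))" by (simp only: z_def)
  have "z < S" using eq tri S(1,2) by (cases "norm x = norm y") auto
  then show "norm ((1/2) *\<^sub>R (x + y)) < S" by (simp only: z_def)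
qed

text \<open>Joint convexity of the squared norm divided by a positive scalar, in the form
  homogeneous of degree one.\<close>

lemma sq_norm_sum_le:
  fixes a b :: "'a::real_normed_vector"
  assumes "0 < E" "0 < E'"
  shows "(norm (a + b))\<^sup>2 / (E + E') \<le> (norm a)\<^sup>2 / E + (norm b)\<^sup>2 / E'"
proof -
  have "(norm (a + b))\<^sup>2 \<le> (norm a + norm b)\<^sup>2" by (intro power_mono norm_triangle_ineq) auto
  then have "(norm (a + b))\<^sup>2 / (E + E') \<le> (norm a + norm b)\<^sup>2 / (E + E')"
    using assms by (intro divide_right_mono) auto
  also have "\<dots> \<le> (norm a)\<^sup>2 / E + (norm b)\<^sup>2 / E'"
  proof -
    have "0 \<le> (norm a * E' - norm b * E)\<^sup>2" by simp
    then have "(norm a + norm b)\<^sup>2 * (E * E') \<le> ((norm a)\<^sup>2 * E' + (norm b)\<^sup>2 * E) * (E + E')"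
      by (simp add: power2_eq_square algebra_simps)
    moreover have "(norm a)\<^sup>2 / E + (norm b)\<^sup>2 / E' = ((norm a)\<^sup>2 * E' + (norm b)\<^sup>2 * E) / (E * E')"
      using assms by (simp add: field_simps)
    ultimately show ?thesis using assms by (simp add: pos_divide_le_eq pos_le_divide_eq)
  qed
  finally show ?thesis .
qed

text \<open>If \<open>m \<times> z = 0\<close>, a step \<open>\<delta>\<close> along
  \<open>c = t - e1 \<times> m\<close> gains to first order in the linear term and loses only to
  second order in the quotient. The first bound on \<open>\<delta>\<close> keeps the step in the
  ball, the second makes the gain prevail.\<close>

lemma is_max_cross_nonzero:
  assumes S: "S < theta1" and t: "e1 \<times> m \<noteq> t"
    and mx: "is_max t S m z" and zS: "norm z < S"
  shows "m \<times> z \<noteq> 0"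
proof
  assume mz0: "m \<times> z = 0"
  define c where "c = t - e1 \<times> m"
  have c0: "c \<noteq> 0" using t by (simp add: c_def)
  have fx: "energy_lb t m w = 12 * (norm m)\<^sup>2 - 4 * (norm (m \<times> w))\<^sup>2 / cden (norm w) + 4 * (w \<bullet> c)" for w
    by (simp add: energy_lb_def c_def)
  define \<delta> where "\<delta> = min ((S - norm z) / norm c) ((norm c)\<^sup>2 * cden S / (2 * ((norm (m \<times> c))\<^sup>2 + 1)))"
  have "0 < S" using zS norm_ge_zero[of z] by linarith
  then have eS: "0 < cden S" using S by (intro cden_pos) auto
  have \<delta>0: "0 < \<delta>" unfolding \<delta>_def using zS c0 eS by (auto intro!: divide_pos_pos mult_pos_pos add_nonneg_pos)
  define w where "w = z + \<delta> *\<^sub>R c"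
  have "\<delta> * norm c \<le> S - norm z" using c0 by (simp add: \<delta>_def field_simps min_def)
  then have wS: "norm w \<le> S"
    unfolding w_def using norm_triangle_ineq[of z "\<delta> *\<^sub>R c"] \<delta>0 by simp
  have ew: "cden S \<le> cden (norm w)" using cden_strict_anti[of "norm w" S] wS S by (cases "norm w = S") auto
  have mw: "m \<times> w = \<delta> *\<^sub>R (m \<times> c)" by (simp add: w_def cross_add_right cross_mult_right mz0)
  have "\<delta> * (norm (m \<times> c))\<^sup>2 < (norm c)\<^sup>2 * cden S"
  proof -
    have pp: "0 < 2 * ((norm (m \<times> c))\<^sup>2 + 1)" by (simp add: add_nonneg_pos)
    have "\<delta> \<le> (norm c)\<^sup>2 * cden S / (2 * ((norm (m \<times> c))\<^sup>2 + 1))" by (simp add: \<delta>_def)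
    then have "\<delta> * (2 * ((norm (m \<times> c))\<^sup>2 + 1)) \<le> (norm c)\<^sup>2 * cden S" using pp by (simp add:
        pos_le_divide_eq)
    moreover have "0 \<le> \<delta> * (norm (m \<times> c))\<^sup>2" using \<delta>0 by simp
    moreover have "\<delta> * (2 * ((norm (m \<times> c))\<^sup>2 + 1)) = 2 * (\<delta> * (norm (m \<times> c))\<^sup>2) + 2 * \<delta>"
      by (simp add: algebra_simps)
    ultimately show ?thesis using \<delta>0 by linarith
  qed
  then have "\<delta> * (\<delta> * (norm (m \<times> c))\<^sup>2) < \<delta> * ((norm c)\<^sup>2 * cden S)" using \<delta>0 by simp
  then have "(norm (m \<times> w))\<^sup>2 < \<delta> * (norm c)\<^sup>2 * cden S"
    unfolding mw by (simp add: power_mult_distrib power2_eq_square algebra_simps)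
  also have "\<dots> \<le> \<delta> * (norm c)\<^sup>2 * cden (norm w)" using ew \<delta>0 by (intro mult_left_mono) auto
  finally have "(norm (m \<times> w))\<^sup>2 / cden (norm w) < \<delta> * (norm c)\<^sup>2"
    using ew eS by (simp add: pos_divide_less_eq)
  moreover have "w \<bullet> c = z \<bullet> c + \<delta> * (norm c)\<^sup>2" by (simp add: w_def inner_add_left dot_square_norm)
  ultimately have "energy_lb t m z < energy_lb t m w" unfolding fx mz0 by simp
  then show False using mx wS unfolding is_max_def by (meson not_le)
qed

text \<open>The squared norm of a linear function divided by a positive concave function is convex; the strict
  concavity of \<open>cden\<close> excludes two maximisers.\<close>

lemma is_max_unique:
  assumes S: "0 \<le> S" "S < theta1" and t: "e1 \<times> m \<noteq> t"
    and mx: "is_max t S m x" "is_max t S m y"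
  shows "x = y"
proof (rule ccontr)
  assume ne: "x \<noteq> y"
  define z where "z = (1/2) *\<^sub>R (x + y)"
  define c where "c = t - e1 \<times> m"
  have nx: "norm x \<le> S" "norm y \<le> S" using mx by (auto simp: is_max_def)
  have Em: "(cden (norm x) + cden (norm y)) / 2 < cden (norm z)" and zS: "norm z < S"
    using cden_norm_midpoint[OF nx S(2) ne] by (auto simp: z_def)
  define E E' where "E = cden (norm x)" and "E' = cden (norm y)"
  have Ep: "0 < E" "0 < E'" "0 < cden (norm z)" using nx zS S by (auto simp: E_def E'_def intro!: cden_pos)
  have eq: "energy_lb t m x = energy_lb t m y" using mx nx by (auto simp: is_max_def intro: order.antisym)
  have zle: "energy_lb t m z \<le> energy_lb t m x" using mx(1) zS by (auto simp: is_max_def)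
  have mz: "m \<times> z = (1/2) *\<^sub>R (m \<times> x + m \<times> y)" by (simp add: z_def cross_mult_right cross_add_right)
  have zc: "z \<bullet> c = (x \<bullet> c + y \<bullet> c) / 2" by (simp add: z_def inner_add_left)
  have fx: "energy_lb t m w = 12 * (norm m)\<^sup>2 - 4 * (norm (m \<times> w))\<^sup>2 / cden (norm w) + 4 * (w \<bullet> c)" for w
    by (simp add: energy_lb_def c_def)
  have nz: "(norm (m \<times> z))\<^sup>2 = (norm (m \<times> x + m \<times> y))\<^sup>2 / 4"
    unfolding mz by (simp add: power_divide)
  have key: "2 * ((norm (m \<times> x))\<^sup>2 / E + (norm (m \<times> y))\<^sup>2 / E') \<le> (norm (m \<times> x + m \<times> y))\<^sup>2 / cden (norm z)"
  proof -
    have "energy_lb t m z \<le> (energy_lb t m x + energy_lb t m y) / 2" using zle eq by simp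
    then show ?thesis unfolding fx zc nz E_def E'_def by (simp add: field_simps)
  qed
  have a0: "m \<times> x + m \<times> y = 0"
  proof (rule ccontr)
    assume "m \<times> x + m \<times> y \<noteq> 0"
    then have p: "0 < (norm (m \<times> x + m \<times> y))\<^sup>2" by simp
    have "(norm (m \<times> x + m \<times> y))\<^sup>2 / cden (norm z) < (norm (m \<times> x + m \<times> y))\<^sup>2 / ((E + E') / 2)"
      using Em Ep p by (intro divide_strict_left_mono) (auto simp: E_def E'_def)
    also have "\<dots> = 2 * ((norm (m \<times> x + m \<times> y))\<^sup>2 / (E + E'))" by simp
    also have "\<dots> \<le> 2 * ((norm (m \<times> x))\<^sup>2 / E + (norm (m \<times> y))\<^sup>2 / E')"
      by (intro mult_left_mono sq_norm_sum_le Ep) simp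
    finally show False using key by simp
  qed
  then have "(norm (m \<times> x))\<^sup>2 / E + (norm (m \<times> y))\<^sup>2 / E' \<le> 0" using key by simp
  moreover have "0 \<le> (norm (m \<times> x))\<^sup>2 / E" "0 \<le> (norm (m \<times> y))\<^sup>2 / E'" using Ep by auto
  ultimately have "(norm (m \<times> x))\<^sup>2 / E = 0" "(norm (m \<times> y))\<^sup>2 / E' = 0" by linarith+
  then have mx0: "m \<times> x = 0" "m \<times> y = 0" using Ep by auto
  then have mz0: "m \<times> z = 0" unfolding mz by simp
  \<comment> \<open>With both cross products zero strict concavity says nothing, but the midpoint is
    then a maximiser inside the ball with \<open>m \<times> z = 0\<close>, which is
    impossible.\<close>
  have Fz: "energy_lb t m z = energy_lb t m x" using eq unfolding fx zc mz0 mx0 by simp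
  then have "is_max t S m z" using mx(1) zS by (simp add: is_max_def)
  then show False using is_max_cross_nonzero[OF S(2) t _ zS] mz0 by blast
qed

text \<open>At norm \<open>pi\<close> one has \<open>cden pi = pi^2 / 3\<close>, so the terms in the
  squared norm of \<open>m\<close> cancel. What is left is nonnegative and controls both
  \<open>B\<close> and \<open>m \<bullet> t\<close>.\<close>

lemma energy_lb_lower_pi:
  assumes c: "t - e1 \<times> m \<noteq> 0"
  defines "B \<equiv> t - e1 \<times> m"
  shows "norm ((pi / norm B) *\<^sub>R B) = pi" "energy_lb t m ((pi / norm B) *\<^sub>R B) = 12 * (m \<bullet> t)\<^sup>2 / (norm
      B)\<^sup>2 + 4 * pi * norm B"
proof -
  have b: "0 < norm B" using c by (simp add: B_def)
  let ?\<tau> = "(pi / norm B) *\<^sub>R B"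
  show n: "norm ?\<tau> = pi" using b by simp
  have mB: "m \<bullet> B = m \<bullet> t" by (simp add: B_def inner_diff_right dot_cross_self)
  have n2: "(norm (m \<times> ?\<tau>))\<^sup>2 = (norm m)\<^sup>2 * pi\<^sup>2 - (pi / norm B * (m \<bullet> t))\<^sup>2"
    using norm_cross_dot[of m ?\<tau>] n mB by (simp add: power_mult_distrib)
  have e: "cden pi = pi\<^sup>2 / 3" by (simp add: cden_def)
  have tb: "?\<tau> \<bullet> B = pi * norm B" using b by (simp add: dot_square_norm power2_eq_square)
  show "energy_lb t m ?\<tau> = 12 * (m \<bullet> t)\<^sup>2 / (norm B)\<^sup>2 + 4 * pi * norm B"
    unfolding energy_lb_def n B_def[symmetric] n2 e tb using b by (simp add: field_simps power2_eq_square)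
qed

lemma e1_cross: "(e1 \<times> m) $ 1 = 0" "(e1 \<times> m) $ 2 = - m $ 3" "(e1 \<times> m) $ 3 = m $ 2"
  "(m \<times> e1) $ 1 = 0" "(m \<times> e1) $ 2 = m $ 3" "(m \<times> e1) $ 3 = - m $ 2"
  by (simp_all add: cross_components e1_def)

text \<open>Coercivity comes from \<open>energy_lb_lower_pi\<close>: a bound on
  \<open>B = t - e1 \<times> m\<close> bounds the last two coordinates of \<open>m\<close>, and a
  bound on \<open>m \<bullet> t\<close> then bounds the first because
  \<open>t $ 1 > 0\<close>.\<close>

lemma minimizer_exists:
  assumes S: "pi \<le> S" "S < theta1" and t1: "0 < t $ 1"
  shows "\<exists>m0 \<tau>0. is_max t S m0 \<tau>0 \<and> (\<forall>m \<tau>. is_max t S m \<tau> \<longrightarrow> energy_lb t m0 \<tau>0 \<le> energy_lb t m \<tau>)"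
proof -
  have S0: "0 \<le> S" using S pi_gt_zero by linarith
  obtain tm where tm: "\<And>m. is_max t S m (tm m)" using is_max_exists[OF S0 S(2)] by metis
  define K where "K = (\<lambda>m. energy_lb t m (tm m))"
  have Kge: "energy_lb t m \<tau> \<le> K m" if "norm \<tau> \<le> S" for m \<tau> using tm[of m] that by (auto simp: K_def
      is_max_def)
  define B where "B = (\<lambda>m. t - e1 \<times> m)"
  have B1: "B m $ 1 = t $ 1" for m by (simp add: B_def e1_cross)
  have Bne: "B m \<noteq> 0" for m using B1[of m] t1 by auto
  have Klow: "12 * (m \<bullet> t)\<^sup>2 / (norm (B m))\<^sup>2 + 4 * pi * norm (B m) \<le> K m" for m
    using Kge[of "(pi / norm (B m)) *\<^sub>R B m" m] energy_lb_lower_pi[of t m] Bne[of m] S by (auto simp: B_def)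
  have nn: "0 \<le> 12 * (m \<bullet> t)\<^sup>2 / (norm (B m))\<^sup>2" "0 \<le> 4 * pi * norm (B m)" for m by auto
  have Kpos: "0 \<le> K m" for m using Klow[of m] nn[of m] by linarith
  define k0 where "k0 = K 0"
  have k0: "0 \<le> k0" using Kpos by (simp add: k0_def)
  define R0 where "R0 = (k0 * k0 + k0 + 2 * (k0 + norm t) * norm t) / t $ 1"
  define R where "R = R0 + 2 * (k0 + norm t)"
  have sub: "norm m \<le> R" if Km: "K m \<le> k0" for m
  proof -
    have bK: "4 * pi * norm (B m) \<le> k0"
      using Klow[of m] Km nn[of m] by linarith
    have "norm (B m) \<le> 4 * pi * norm (B m)"
      using pi_gt3 by (intro mult_right_mono[of 1 "4 * pi" "norm (B m)", simplified]) auto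
    then have b: "norm (B m) \<le> k0" using bK by linarith
    have "e1 \<times> m = t - B m" by (simp add: B_def)
    then have em: "norm (e1 \<times> m) \<le> k0 + norm t" using norm_triangle_ineq4[of t "B m"] b by simp
    have m23: "\<bar>m $ 2\<bar> \<le> k0 + norm t" "\<bar>m $ 3\<bar> \<le> k0 + norm t"
      using component_le_norm_cart[of "e1 \<times> m" 3] component_le_norm_cart[of "e1 \<times> m" 2] em by (auto simp:
          e1_cross)
    have "12 * (m \<bullet> t)\<^sup>2 / (norm (B m))\<^sup>2 \<le> k0" using Klow[of m] Km nn[of m] by linarith
    then have "12 * (m \<bullet> t)\<^sup>2 \<le> k0 * (norm (B m))\<^sup>2" using Bne[of m] by (simp add: field_simps)
    also have "\<dots> \<le> k0 * k0\<^sup>2" using b k0 by (intro mult_left_mono power_mono) auto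
    finally have "(m \<bullet> t)\<^sup>2 \<le> k0 * k0\<^sup>2" using zero_le_power2[of "m \<bullet> t"] by linarith
    also have "\<dots> \<le> (k0 * k0 + k0)\<^sup>2" using k0 by (simp add: power2_eq_square algebra_simps)
    finally have mt: "\<bar>m \<bullet> t\<bar> \<le> k0 * k0 + k0"
      using k0 by (intro power2_le_imp_le[of "\<bar>m \<bullet> t\<bar>"]) auto
    have "m \<bullet> t = m $ 1 * t $ 1 + m $ 2 * t $ 2 + m $ 3 * t $ 3" by (simp add: inner_vec_def sum_3)
    then have "m $ 1 * t $ 1 = m \<bullet> t - m $ 2 * t $ 2 - m $ 3 * t $ 3" by simp
    then have "\<bar>m $ 1\<bar> * t $ 1 \<le> \<bar>m \<bullet> t\<bar> + \<bar>m $ 2 * t $ 2\<bar> + \<bar>m $ 3 * t $ 3\<bar>"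
      using t1 abs_mult[of "m $ 1" "t $ 1"] by linarith
    moreover have "\<bar>m $ 2 * t $ 2\<bar> \<le> (k0 + norm t) * norm t" "\<bar>m $ 3 * t $ 3\<bar> \<le> (k0 + norm t) * norm t"
      unfolding abs_mult using m23 component_le_norm_cart by (auto intro!: mult_mono)
    ultimately have "\<bar>m $ 1\<bar> * t $ 1 \<le> k0 * k0 + k0 + 2 * (k0 + norm t) * norm t" using mt by linarith
    then have m1: "\<bar>m $ 1\<bar> \<le> R0" using t1 unfolding R0_def by (simp only: pos_le_divide_eq)
    have "norm m \<le> \<bar>m $ 1\<bar> + \<bar>m $ 2\<bar> + \<bar>m $ 3\<bar>" using norm_le_l1_cart[of m] by (simp add: sum_3)
    also have "\<dots> \<le> R0 + (k0 + norm t) + (k0 + norm t)" by (intro add_mono m1 m23)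
    finally show ?thesis unfolding R_def by simp
  qed
  define I where "I = Inf (range K)"
  have bdd: "bdd_below (range K)" using Kpos by (intro bdd_belowI[of _ 0]) auto
  have Ile: "I \<le> K m" for m unfolding I_def using bdd by (intro cInf_lower) auto
  have "\<forall>n. \<exists>m. norm m \<le> R \<and> K m \<le> I + inverse (real (Suc n))"
  proof
    fix n
    have "I < I + inverse (real (Suc n))" by simp
    then obtain m where m: "K m < I + inverse (real (Suc n))"
      using cInf_lessD[of "range K"] unfolding I_def by blast
    show "\<exists>m. norm m \<le> R \<and> K m \<le> I + inverse (real (Suc n))"
    proof (cases "K m \<le> k0")
      case True
      then show ?thesis using sub m less_imp_le by blast
    next
      case False
      then have "K 0 \<le> I + inverse (real (Suc n))" using m by (simp add: k0_def)
      then show ?thesis using sub[of 0] by (intro exI[of _ 0]) (auto simp: k0_def)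
    qed
  qed
  then obtain M where M0: "\<forall>n. norm (M n) \<le> R \<and> K (M n) \<le> I + inverse (real (Suc n))"
    by (rule exE[OF choice])
  then have "\<forall>n. M n \<in> cball 0 R" by simp
  then obtain m0 r where r: "strict_mono r" "(M \<circ> r) \<longlonglongrightarrow> m0"
    using compact_cball[of "0::real^3" R] unfolding compact_def by blast
  \<comment> \<open>Lower semicontinuity of a maximum of continuous functions: along the sequence it
    is enough to test with the multiplier that is optimal at \<open>m0\<close>.\<close>
  have "energy_lb t m0 (tm m0) \<le> I"
  proof (rule LIMSEQ_le)
    show "(\<lambda>n. energy_lb t ((M \<circ> r) n) (tm m0)) \<longlonglongrightarrow> energy_lb t m0 (tm m0)"
      by (rule energy_lb_tendsto[OF tendsto_const r(2)])
    have "(\<lambda>n. I + inverse (real (Suc n))) \<longlonglongrightarrow> I + 0"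
      by (intro tendsto_intros LIMSEQ_inverse_real_of_nat)
    then show "(\<lambda>n. I + inverse (real (Suc (r n)))) \<longlonglongrightarrow> I"
      using LIMSEQ_subseq_LIMSEQ[OF _ r(1), of "\<lambda>n. I + inverse (real (Suc n))"] by (simp add: o_def)
    show "\<exists>N. \<forall>n\<ge>N. energy_lb t ((M \<circ> r) n) (tm m0) \<le> I + inverse (real (Suc (r n)))"
    proof (intro exI allI impI)
      fix n
      have "energy_lb t (M (r n)) (tm m0) \<le> K (M (r n))" using tm[of m0] by (intro Kge) (simp add: is_max_def)
      also have "\<dots> \<le> I + inverse (real (Suc (r n)))" using M0 by blast
      finally show "energy_lb t ((M \<circ> r) n) (tm m0) \<le> I + inverse (real (Suc (r n)))" by simp
    qed
  qed
  moreover have "K m \<le> energy_lb t m \<tau>" if "is_max t S m \<tau>" for m \<tau>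
    using that tm[of m] by (auto simp: is_max_def K_def)
  ultimately have "energy_lb t m0 (tm m0) \<le> energy_lb t m \<tau>" if "is_max t S m \<tau>" for m \<tau>
    using Ile[of m] that by fastforce
  then show ?thesis using tm[of m0] by blast
qed

section \<open>Critical point equations\<close>

lemma energy_lb_expand:
  "energy_lb t (m + \<epsilon> *\<^sub>R h) \<tau> = energy_lb t m \<tau>
     + \<epsilon> * (24 * (m \<bullet> h) - 8 * ((m \<times> \<tau>) \<bullet> (h \<times> \<tau>)) / cden (norm \<tau>) - 4 * (\<tau> \<bullet> (e1 \<times> h)))
     + \<epsilon>\<^sup>2 * (12 * (norm h)\<^sup>2 - 4 * (norm (h \<times> \<tau>))\<^sup>2 / cden (norm \<tau>))"
proof -
  have sq: "(norm (a + \<epsilon> *\<^sub>R b))\<^sup>2 = (norm a)\<^sup>2 + 2 * \<epsilon> * (a \<bullet> b) + \<epsilon>\<^sup>2 * (norm b)\<^sup>2" for a b :: "real^3"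
    unfolding power2_norm_eq_inner
    by (simp add: inner_add_left inner_add_right inner_commute power2_eq_square algebra_simps)
  have c: "(m + \<epsilon> *\<^sub>R h) \<times> \<tau> = m \<times> \<tau> + \<epsilon> *\<^sub>R (h \<times> \<tau>)" "e1 \<times> (m + \<epsilon> *\<^sub>R h) = e1 \<times> m + \<epsilon> *\<^sub>R (e1 \<times> h)"
    by (simp_all add: cross_add_left cross_add_right cross_mult_left cross_mult_right)
  show ?thesis unfolding energy_lb_def c sq
    by (simp add: inner_diff_right inner_add_right divide_inverse algebra_simps)
qed

text \<open>Danskin's argument: as the maximiser is unique, nearby maximisers converge to it, and
  \<open>energy_lb\<close> is quadratic in \<open>m\<close>.\<close>

lemma minimizer_gradient:
  assumes S: "pi \<le> S" "S < theta1" and t1: "0 < t $ 1"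
    and mx: "is_max t S m \<tau>" and mn: "\<And>m' \<tau>'. is_max t S m' \<tau>' \<Longrightarrow> energy_lb t m \<tau> \<le> energy_lb t m' \<tau>'"
  shows "m \<bullet> \<tau> = 0" "(24 - 8 * (norm \<tau>)\<^sup>2 / cden (norm \<tau>)) *\<^sub>R m = 4 *\<^sub>R (\<tau> \<times> e1)"
proof -
  have S0: "0 \<le> S" using S pi_gt_zero by linarith
  define L where "L = (\<lambda>h \<tau>. 24 * (m \<bullet> h) - 8 * ((m \<times> \<tau>) \<bullet> (h \<times> \<tau>)) / cden (norm \<tau>) - 4 * (\<tau> \<bullet> (e1 \<times> h)))"
  have nS: "norm \<tau> \<le> S" using mx by (simp add: is_max_def)
  have Bne: "e1 \<times> m \<noteq> t" using t1 e1_cross(1)[of m] by auto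
  have Lpos: "0 \<le> L h \<tau>" for h
  proof -
    define M where "M = (\<lambda>n. m + inverse (real (Suc n)) *\<^sub>R h)"
    have Mlim: "M \<longlonglongrightarrow> m"
    proof -
      have "M \<longlonglongrightarrow> m + 0 *\<^sub>R h" unfolding M_def by (intro tendsto_intros LIMSEQ_inverse_real_of_nat)
      then show ?thesis by simp
    qed
    have "\<forall>n. \<exists>\<tau>'. is_max t S (M n) \<tau>'" using is_max_exists[OF S0 S(2)] by blast
    then obtain T where T: "\<forall>n. is_max t S (M n) (T n)" by (rule exE[OF choice])
    then have "\<forall>n. T n \<in> cball 0 S" by (simp add: is_max_def)
    then obtain \<tau>' r where \<tau>': "\<tau>' \<in> cball 0 S" and r: "strict_mono r" "(T \<circ> r) \<longlonglongrightarrow> \<tau>'"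
      using compact_cball[of "0::real^3" S] unfolding compact_def by blast
    have nT: "norm (T n) \<le> S" for n using T by (simp add: is_max_def)
    have MT: "(\<lambda>n. energy_lb t ((M \<circ> r) n) ((T \<circ> r) n)) \<longlonglongrightarrow> energy_lb t m \<tau>'"
      using nT by (intro energy_lb_tendsto2[OF S(2)] LIMSEQ_subseq_LIMSEQ[OF Mlim r(1)] r(2)) simp
    have "is_max t S m \<tau>'"
      unfolding is_max_def
    proof (intro conjI allI impI)
      show "norm \<tau>' \<le> S" using \<tau>' by simp
      fix z :: "real^3" assume z: "norm z \<le> S"
      show "energy_lb t m z \<le> energy_lb t m \<tau>'"
      proof (rule LIMSEQ_le[OF _ MT])
        show "(\<lambda>n. energy_lb t ((M \<circ> r) n) z) \<longlonglongrightarrow> energy_lb t m z"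
          by (rule energy_lb_tendsto[OF tendsto_const LIMSEQ_subseq_LIMSEQ[OF Mlim r(1)]])
        show "\<exists>N. \<forall>n\<ge>N. energy_lb t ((M \<circ> r) n) z \<le> energy_lb t ((M \<circ> r) n) ((T \<circ> r) n)"
          using T z by (auto simp: is_max_def)
      qed
    qed
    then have \<tau>eq: "\<tau>' = \<tau>" using is_max_unique[OF S0 S(2) Bne _ mx] by simp
    have ge: "0 \<le> L h (T n) + inverse (real (Suc n)) * (12 * (norm h)\<^sup>2)" for n
    proof -
      define \<epsilon> where "\<epsilon> = inverse (real (Suc n))"
      have \<epsilon>: "0 < \<epsilon>" by (simp add: \<epsilon>_def)
      \<comment> \<open>Maximality of \<open>\<tau>\<close> at \<open>m\<close>, followed by
        minimality of \<open>m\<close> against \<open>M n\<close>, compares two means at the same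
        multiplier \<open>T n\<close>.\<close>
      have "energy_lb t m (T n) \<le> energy_lb t m \<tau>" using mx nT by (simp add: is_max_def)
      also have "\<dots> \<le> energy_lb t (M n) (T n)" using mn T by blast
      finally have "0 \<le> \<epsilon> * L h (T n) + \<epsilon>\<^sup>2 * (12 * (norm h)\<^sup>2 - 4 * (norm (h \<times> T n))\<^sup>2 / cden (norm (T n)))"
        unfolding M_def energy_lb_expand L_def \<epsilon>_def by simp
      also have "\<dots> \<le> \<epsilon> * L h (T n) + \<epsilon>\<^sup>2 * (12 * (norm h)\<^sup>2)"
      proof -
        have "0 < cden (norm (T n))" using nT[of n] S by (intro cden_pos) auto
        then show ?thesis by (intro add_left_mono mult_left_mono) auto
      qed
      also have "\<dots> = \<epsilon> * (L h (T n) + \<epsilon> * (12 * (norm h)\<^sup>2))" by (simp add: power2_eq_square algebra_simps)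
      finally show ?thesis using \<epsilon> unfolding \<epsilon>_def[symmetric] by (simp add: zero_le_mult_iff)
    qed
    have "(\<lambda>n. L h ((T \<circ> r) n) + inverse (real (Suc (r n))) * (12 * (norm h)\<^sup>2)) \<longlonglongrightarrow> L h \<tau>' + 0 * (12 *
        (norm h)\<^sup>2)"
    proof (intro tendsto_intros)
      have lim: "(\<lambda>n. norm ((T \<circ> r) n)) \<longlonglongrightarrow> norm \<tau>'" by (intro tendsto_intros r(2))
      have "(\<lambda>n. cden (norm ((T \<circ> r) n))) \<longlonglongrightarrow> cden (norm \<tau>')"
        by (rule continuous_on_tendsto_compose[OF cden_continuous_on lim])
          (use \<tau>' nT S in \<open>auto intro!: always_eventually le_less_trans[OF _ S(2)]\<close>)
      moreover have "cden (norm \<tau>') \<noteq> 0" using cden_pos[of "norm \<tau>'"] \<tau>' S by auto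
      ultimately show "(\<lambda>n. L h ((T \<circ> r) n)) \<longlonglongrightarrow> L h \<tau>'"
        unfolding L_def by (intro tendsto_intros r(2) bounded_bilinear.tendsto[OF bounded_bilinear_cross3])
      show "(\<lambda>n. inverse (real (Suc (r n)))) \<longlonglongrightarrow> 0"
        using LIMSEQ_subseq_LIMSEQ[OF LIMSEQ_inverse_real_of_nat r(1)] by (simp add: o_def)
    qed
    then have "0 \<le> L h \<tau>' + 0 * (12 * (norm h)\<^sup>2)"
      by (rule LIMSEQ_le_const) (use ge in auto)
    then show ?thesis using \<tau>eq by simp
  qed
  define e where "e = cden (norm \<tau>)"
  define W where "W = 24 *\<^sub>R m - (8 / e) *\<^sub>R (\<tau> \<times> (m \<times> \<tau>)) - 4 *\<^sub>R (\<tau> \<times> e1)"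
  have LW: "L h \<tau> = h \<bullet> W" for h
  proof -
    have "(m \<times> \<tau>) \<bullet> (h \<times> \<tau>) = h \<bullet> (\<tau> \<times> (m \<times> \<tau>))" using cross_triple[of h \<tau> "m \<times> \<tau>"] by (simp add:
        inner_commute)
    moreover have "\<tau> \<bullet> (e1 \<times> h) = h \<bullet> (\<tau> \<times> e1)" using cross_triple[of \<tau> e1 h] cross_triple[of e1 h \<tau>] by
        (simp add: inner_commute)
    ultimately show ?thesis unfolding L_def W_def e_def by (simp add: inner_diff_right inner_commute)
  qed
  have "0 \<le> W \<bullet> W" "0 \<le> (- W) \<bullet> W" using Lpos[of W] Lpos[of "- W"] LW by auto
  then have W0: "W = 0" by (metis inner_eq_zero_iff inner_minus_left neg_0_le_iff_le order.antisym)
  have lag: "\<tau> \<times> (m \<times> \<tau>) = (norm \<tau>)\<^sup>2 *\<^sub>R m - (\<tau> \<bullet> m) *\<^sub>R \<tau>"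
    using Lagrange[of \<tau> m \<tau>] by (simp add: power2_norm_eq_inner)
  have "W \<bullet> \<tau> = 24 * (m \<bullet> \<tau>)"
    unfolding W_def lag by (simp add: inner_diff_left dot_cross_self power2_norm_eq_inner) (simp add:
        inner_commute)
  then show m0: "m \<bullet> \<tau> = 0" using W0 by simp
  have "W = (24 - 8 * (norm \<tau>)\<^sup>2 / e) *\<^sub>R m - 4 *\<^sub>R (\<tau> \<times> e1)"
    unfolding W_def lag using m0 by (simp add: inner_commute scaleR_diff_left)
  then show "(24 - 8 * (norm \<tau>)\<^sup>2 / cden (norm \<tau>)) *\<^sub>R m = 4 *\<^sub>R (\<tau> \<times> e1)" using W0 by (simp add: e_def)
qed

text \<open>Because \<open>m \<bullet> \<tau> = 0\<close>, the quotient at \<open>\<tau>\<close> is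
  as large as it can be for that norm. Turning \<open>\<tau>\<close> towards \<open>B\<close> would
  not increase it and would improve the linear term unless \<open>\<tau>\<close> already points
  along \<open>B\<close>; a problem in the norm alone remains.\<close>

lemma minimizer_direction:
  assumes S: "pi \<le> S" "S < theta1" and t1: "0 < t $ 1"
    and mx: "is_max t S m \<tau>" and m\<tau>: "m \<bullet> \<tau> = 0"
  defines "B \<equiv> t - e1 \<times> m"
  shows "0 < norm \<tau>" "B = (norm B / norm \<tau>) *\<^sub>R \<tau>" "0 < norm B"
    "\<And>s. \<lbrakk>0 \<le> s; s \<le> S\<rbrakk> \<Longrightarrow>
       s * norm B - (norm m)\<^sup>2 * (s\<^sup>2 / cden s) \<le> norm \<tau> * norm B - (norm m)\<^sup>2 * ((norm \<tau>)\<^sup>2 / cden (norm \<tau>))"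
    "energy_lb t m \<tau> = 12 * (norm m)\<^sup>2 - 4 * ((norm m)\<^sup>2 * ((norm \<tau>)\<^sup>2 / cden (norm \<tau>))) + 4 * (norm \<tau> *
        norm B)"
proof -
  define s where "s = norm \<tau>"
  have nS: "s \<le> S" using mx by (simp add: is_max_def s_def)
  have B1: "B $ 1 = t $ 1" by (simp add: B_def e1_cross)
  then have Bne: "B \<noteq> 0" using t1 by auto
  then show b: "0 < norm B" by simp
  have fF: "energy_lb t m z = 12 * (norm m)\<^sup>2 - 4 * (norm (m \<times> z))\<^sup>2 / cden (norm z) + 4 * (z \<bullet> B)" for z
    by (simp add: energy_lb_def B_def)
  have cr: "(norm (m \<times> z))\<^sup>2 = (norm m)\<^sup>2 * (norm z)\<^sup>2 - (m \<bullet> z)\<^sup>2" for z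
    by (rule norm_cross)
  have F\<tau>: "energy_lb t m \<tau> = 12 * (norm m)\<^sup>2 - 4 * ((norm m)\<^sup>2 * s\<^sup>2) / cden s + 4 * (\<tau> \<bullet> B)"
    unfolding fF cr m\<tau> s_def by simp
  have s0: "0 < s"
  proof (rule ccontr)
    assume "\<not> 0 < s"
    then have "\<tau> = 0" by (simp add: s_def)
    moreover have "e1 \<times> m \<noteq> t" using Bne by (auto simp: B_def)
    ultimately show False using is_max_cross_nonzero[OF S(2) _ mx] S(1) pi_gt_zero by auto
  qed
  then show "0 < norm \<tau>" by (simp add: s_def)
  have es: "0 < cden s" using s0 nS S by (intro cden_pos) auto
  have dir: "s * norm B \<le> \<tau> \<bullet> B"
  proof -
    let ?z = "(s / norm B) *\<^sub>R B"
    have nz: "norm ?z = s" using b s0 by simp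
    have zB: "?z \<bullet> B = s * norm B" using b by (simp add: dot_square_norm power2_eq_square)
    have "energy_lb t m ?z \<le> energy_lb t m \<tau>" using mx nz nS by (simp add: is_max_def)
    then have "- (4 * ((norm m)\<^sup>2 * s\<^sup>2 - (m \<bullet> ?z)\<^sup>2) / cden s) + 4 * (s * norm B) \<le> - (4 * ((norm m)\<^sup>2 *
        s\<^sup>2) / cden s) + 4 * (\<tau> \<bullet> B)"
      unfolding F\<tau> unfolding fF cr nz zB by simp
    moreover have "4 * ((norm m)\<^sup>2 * s\<^sup>2 - (m \<bullet> ?z)\<^sup>2) / cden s \<le> 4 * ((norm m)\<^sup>2 * s\<^sup>2) / cden s"
      using es by (intro divide_right_mono) auto
    ultimately show ?thesis by linarith
  qed
  have "norm \<tau> * norm B = \<tau> \<bullet> B"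
    using dir norm_cauchy_schwarz[of \<tau> B] by (simp add: s_def)
  then have "norm \<tau> *\<^sub>R B = norm B *\<^sub>R \<tau>" using norm_cauchy_schwarz_eq[of \<tau> B] by simp
  then have "(1 / norm \<tau>) *\<^sub>R (norm \<tau> *\<^sub>R B) = (1 / norm \<tau>) *\<^sub>R (norm B *\<^sub>R \<tau>)" by simp
  then show Beq: "B = (norm B / norm \<tau>) *\<^sub>R \<tau>" using s0 by (simp add: s_def)
  have \<tau>B: "\<tau> \<bullet> B = s * norm B" using \<open>norm \<tau> * norm B = \<tau> \<bullet> B\<close> by (simp add: s_def)
  show FF1: "energy_lb t m \<tau> = 12 * (norm m)\<^sup>2 - 4 * ((norm m)\<^sup>2 * ((norm \<tau>)\<^sup>2 / cden (norm \<tau>))) + 4 *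
      (norm \<tau> * norm B)"
    unfolding F\<tau> \<tau>B s_def by simp
  fix z :: real assume z: "0 \<le> z" "z \<le> S"
  let ?z = "(z / s) *\<^sub>R \<tau>"
  have nz: "norm ?z = z" using s0 z by (simp add: s_def)
  have "energy_lb t m ?z \<le> energy_lb t m \<tau>" using mx nz z by (simp add: is_max_def)
  moreover have "energy_lb t m ?z = 12 * (norm m)\<^sup>2 - 4 * ((norm m)\<^sup>2 * (z\<^sup>2 / cden z)) + 4 * (z * norm B)"
    unfolding fF cr nz using m\<tau> \<tau>B s0 by simp
  ultimately show "z * norm B - (norm m)\<^sup>2 * (z\<^sup>2 / cden z) \<le> norm \<tau> * norm B - (norm m)\<^sup>2 * ((norm \<tau>)\<^sup>2 /
      cden (norm \<tau>))"
    unfolding FF1 by simp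
qed

lemma norm_sq_3: "(norm (x::real^3))\<^sup>2 = (x $ 1)\<^sup>2 + (x $ 2)\<^sup>2 + (x $ 3)\<^sup>2"
  unfolding power2_norm_eq_inner by (simp add: inner_vec_def sum_3 power2_eq_square)

lemma minimizer_classify:
  assumes S: "pi < S" "S < theta1"
    and t: "t $ 1 = t1" "t $ 2 = t2" "t $ 3 = 0" "0 < t1" "0 < t2" "pi * t2\<^sup>2 < t1"
    and mx: "is_max t S m \<tau>" and mn: "\<And>m' \<tau>'. is_max t S m' \<tau>' \<Longrightarrow> energy_lb t m \<tau> \<le> energy_lb t m' \<tau>'"
  defines "s \<equiv> norm \<tau>"
  shows "\<exists>\<beta>>0. pi < s \<and> s \<le> S \<and> \<tau> $ 3 = 0 \<and> m $ 1 = 0 \<and> m $ 2 = 0 \<and> m $ 3 = \<tau> $ 2 / (2 * kap s) \<and>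
     t1 = \<beta> * \<tau> $ 1 \<and> t2 = \<tau> $ 2 * (\<beta> - 1 / (2 * kap s)) \<and>
     energy_lb t m \<tau> = 4 * s\<^sup>2 * \<beta> - 4 * kap s * (m $ 3)\<^sup>2 \<and> (s < S \<longrightarrow> \<beta> = kap_slope s * (m $ 3)\<^sup>2)"
proof -
  have S': "pi \<le> S" using S by simp
  have t1': "0 < t $ 1" using t by simp
  define B where "B = t - e1 \<times> m"
  define b where "b = norm B"
  define \<beta> where "\<beta> = b / s"
  define f where "f = (\<lambda>s. s\<^sup>2 / cden s)"
  define G where "G = 24 - 8 * f s"
  have grad: "m \<bullet> \<tau> = 0" "(24 - 8 * (norm \<tau>)\<^sup>2 / cden (norm \<tau>)) *\<^sub>R m = 4 *\<^sub>R (\<tau> \<times> e1)"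
    by (rule minimizer_gradient[OF S' S(2) t1' mx], erule mn)+
  note dir = minimizer_direction[OF S' S(2) t1' mx grad(1), folded B_def]
  have s0: "0 < s" and sS: "s \<le> S" using dir(1) mx by (auto simp: s_def is_max_def)
  have b0: "0 < b" using dir(3) by (simp add: b_def)
  have \<beta>0: "0 < \<beta>" using s0 b0 by (simp add: \<beta>_def)
  have bs: "b = \<beta> * s" using s0 by (simp add: \<beta>_def)
  have Beq: "B = \<beta> *\<^sub>R \<tau>" using dir(2) by (simp add: \<beta>_def b_def s_def)
  have rad: "x * b - (norm m)\<^sup>2 * f x \<le> s * b - (norm m)\<^sup>2 * f s" if "0 \<le> x" "x \<le> S" for x
    using dir(4)[OF that] by (simp add: f_def s_def b_def)
  have FFv: "energy_lb t m \<tau> = 12 * (norm m)\<^sup>2 - 4 * ((norm m)\<^sup>2 * f s) + 4 * (s * b)"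
    using dir(5) by (simp add: f_def s_def b_def)
  have g: "G *\<^sub>R m = 4 *\<^sub>R (\<tau> \<times> e1)" using grad(2) by (simp add: G_def f_def s_def)
  have "(G *\<^sub>R m) $ i = (4 *\<^sub>R (\<tau> \<times> e1)) $ i" for i using g by simp
  from this[of 1] this[of 2] this[of 3]
  have gm: "G * m $ 1 = 0" "G * m $ 2 = 4 * \<tau> $ 3" "G * m $ 3 = - 4 * \<tau> $ 2" by (simp_all add: e1_cross)
  have "B $ i = (\<beta> *\<^sub>R \<tau>) $ i" for i using Beq by simp
  from this[of 1] this[of 2] this[of 3]
  have bc: "t1 = \<beta> * \<tau> $ 1" "t2 + m $ 3 = \<beta> * \<tau> $ 2" "- m $ 2 = \<beta> * \<tau> $ 3"
    using t by (simp_all add: B_def e1_cross)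
  have \<tau>1: "0 < \<tau> $ 1" using bc(1) \<beta>0 t(4) by (simp add: zero_less_mult_iff)
  have t1b: "t1 \<le> b"
    unfolding bc(1) bs using \<beta>0 component_le_norm_cart[of \<tau> 1] \<tau>1 by (intro mult_left_mono) (auto simp: s_def)
  have f_pi: "f pi = 3" by (simp add: f_def cden_def)
  have f_ge: "f x = 3 + kap x" if "pi \<le> x" "x \<le> S" for x
    unfolding f_def using that S by (intro sq_div_cden) auto
  have s_pi: "pi < s"
  proof (rule ccontr)
    assume "\<not> pi < s"
    then consider "s < pi" | "s = pi" by linarith
    then show False
    proof cases
      case 1
      \<comment> \<open>Comparison with norm \<open>pi\<close> gives
        \<open>t1 \<le> b \<le> (9 / pi) * (norm m)^2\<close>, where 9 stems from the explicit
        quadratic in \<open>cden\<close>. The stationarity equations give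
        \<open>norm m \<le> t2\<close>, so \<open>9 < pi^2\<close> contradicts
        \<open>pi * t2^2 < t1\<close>.\<close>
      have s2: "s\<^sup>2 < pi\<^sup>2" using 1 s0 by (intro power_strict_mono) auto
      have fs: "f s = 6 * s\<^sup>2 / (3 * pi\<^sup>2 - s\<^sup>2)" using 1 by (simp add: f_def cden_def field_simps)
      have den: "2 * pi\<^sup>2 \<le> 3 * pi\<^sup>2 - s\<^sup>2" "0 < 3 * pi\<^sup>2 - s\<^sup>2" using s2 zero_le_power2[of s] by linarith+
      have fd: "3 - f s = 9 * (pi\<^sup>2 - s\<^sup>2) / (3 * pi\<^sup>2 - s\<^sup>2)" using den(2) unfolding fs by (simp add:
          field_simps)
      have f3: "0 < 3 - f s" unfolding fd using den s2 by simp
      have "9 * (pi\<^sup>2 - s\<^sup>2) / (3 * pi\<^sup>2 - s\<^sup>2) \<le> 9 * (pi\<^sup>2 - s\<^sup>2) / (2 * pi\<^sup>2)"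
        using den s2 by (intro divide_left_mono) auto
      also have "\<dots> \<le> (pi - s) * (9 / pi)"
      proof -
        have "9 * (pi\<^sup>2 - s\<^sup>2) = (pi - s) * (9 * (pi + s))" by (simp add: power2_eq_square algebra_simps)
        also have "\<dots> \<le> (pi - s) * (9 * (pi + pi))" using 1 by (intro mult_left_mono) auto
        finally have "9 * (pi\<^sup>2 - s\<^sup>2) / (2 * pi\<^sup>2) \<le> (pi - s) * (9 * (pi + pi)) / (2 * pi\<^sup>2)"
          by (intro divide_right_mono) auto
        also have "\<dots> = (pi - s) * (9 / pi)" by (simp add: power2_eq_square field_simps)
        finally show ?thesis .
      qed
      finally have fd2: "3 - f s \<le> (pi - s) * (9 / pi)" using fd by simp
      have "(pi - s) * b \<le> (norm m)\<^sup>2 * (3 - f s)"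
        using rad[of pi] S f_pi by (simp add: algebra_simps)
      also have "\<dots> \<le> (norm m)\<^sup>2 * ((pi - s) * (9 / pi))" using fd2 by (intro mult_left_mono) auto
      finally have "(pi - s) * b \<le> (pi - s) * ((norm m)\<^sup>2 * (9 / pi))" by (simp add: algebra_simps)
      then have bm: "b \<le> (norm m)\<^sup>2 * (9 / pi)"
        using 1 by (simp only: mult_le_cancel_left_pos diff_gt_0_iff_gt)
      have Gp: "0 < G" using f3 by (simp add: G_def)
      have m1: "m $ 1 = 0" using gm(1) Gp by simp
      have "m $ 2 = - (\<beta> * \<tau> $ 3)" using bc(3) by simp
      then have "(4 + G * \<beta>) * \<tau> $ 3 = 0" using gm(2) by (simp add: algebra_simps)
      moreover have "4 + G * \<beta> \<noteq> 0" using mult_pos_pos[OF Gp \<beta>0] by linarith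
      ultimately have "\<tau> $ 3 = 0" by simp
      then have m2: "m $ 2 = 0" using bc(3) by simp
      have m3: "m $ 3 = - (4 / G) * \<tau> $ 2" using gm(3) Gp by (simp add: field_simps)
      have t2e: "t2 = (\<beta> + 4 / G) * \<tau> $ 2" using bc(2) m3 by (simp add: algebra_simps)
      have pp: "0 < \<beta> + 4 / G" using \<beta>0 Gp by (simp add: add_pos_pos)
      then have \<tau>2: "0 < \<tau> $ 2" using t2e t(5) by (simp add: zero_less_mult_iff)
      have "\<bar>m $ 3\<bar> \<le> t2" using m3 t2e \<tau>2 \<beta>0 Gp by (simp add: abs_mult algebra_simps)
      then have "(m $ 3)\<^sup>2 \<le> t2\<^sup>2" using t(5) abs_le_square_iff[of "m $ 3" t2] by simp
      then have "(norm m)\<^sup>2 \<le> t2\<^sup>2" by (simp add: norm_sq_3 m1 m2)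
      then have "(norm m)\<^sup>2 * (9 / pi) \<le> t2\<^sup>2 * (9 / pi)" by (intro mult_right_mono) auto
      moreover have "t2\<^sup>2 * (9 / pi) \<le> t2\<^sup>2 * pi"
        using pi_sq_bounds(1) by (intro mult_left_mono) (auto simp: field_simps power2_eq_square)
      ultimately show False using bm t1b t(6) by (simp add: mult.commute)
    next
      case 2
      \<comment> \<open>At \<open>s = pi\<close> the radial problem has right derivative
        \<open>t1 - pi * t2^2\<close>, whose positivity is exactly the defining inequality of
        \<open>R2_lt_plus\<close> after division by 4; so the norm could still be increased.\<close>
      have "G = 0" by (simp add: G_def 2 f_pi)
      then have \<tau>23: "\<tau> $ 3 = 0" "\<tau> $ 2 = 0" using gm by auto
      then have m23: "m $ 2 = 0" "m $ 3 = - t2" using bc by auto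
      have "s\<^sup>2 = (\<tau> $ 1)\<^sup>2" using norm_sq_3[of \<tau>] \<tau>23 by (simp add: s_def)
      then have \<tau>s: "\<tau> $ 1 = s" using \<tau>1 s0 by (simp add: power2_eq_iff_nonneg)
      have "m $ 1 = 0" using grad(1) \<tau>23 \<tau>1 by (simp add: inner_vec_def sum_3)
      then have nm: "(norm m)\<^sup>2 = t2\<^sup>2" using m23 by (simp add: norm_sq_3)
      have bt: "b = t1" using bs bc(1) \<tau>s by simp
      define h where "h = (\<lambda>x. x * t1 - t2\<^sup>2 * kap x)"
      have "(kap has_real_derivative pi) (at pi)" using kap_deriv[of pi] tan_gap_nz[of pi] theta1_bounds
          by simp
      then have "(h has_real_derivative t1 - t2\<^sup>2 * pi) (at pi)"
        unfolding h_def by (auto intro!: derivative_eq_intros)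
      moreover have "0 < t1 - t2\<^sup>2 * pi" using t(6) by (simp add: mult.commute)
      ultimately obtain d where d: "0 < d" "\<And>x. \<lbrakk>0 < x; x < d\<rbrakk> \<Longrightarrow> h pi < h (pi + x)"
        using DERIV_pos_inc_right by blast
      define x where "x = min (d / 2) (S - pi)"
      have x: "0 < x" "x < d" "pi + x \<le> S" using d(1) S by (auto simp: x_def min_def)
      have "h (pi + x) \<le> h pi"
        using rad[of "pi + x"] x f_ge[of "pi + x"] f_pi pi_gt_zero unfolding nm bt 2 h_def
        by (simp add: algebra_simps)
      then show False using d(2)[OF x(1,2)] by simp
    qed
  qed
  have kp: "0 < kap s" using kap_pos s_pi sS S by auto
  have fs: "f s = 3 + kap s" using f_ge s_pi sS by auto
  have G: "G = - 8 * kap s" by (simp add: G_def fs)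
  have m1: "m $ 1 = 0" using gm(1) G kp by simp
  have m2: "m $ 2 = - \<tau> $ 3 / (2 * kap s)" using gm(2) kp unfolding G by (simp add: field_simps)
  have m3: "m $ 3 = \<tau> $ 2 / (2 * kap s)" using gm(3) kp unfolding G by (simp add: field_simps)
  have t2e: "t2 = \<tau> $ 2 * (\<beta> - 1 / (2 * kap s))" using bc(2) m3 by (simp add: algebra_simps)
  \<comment> \<open>The second and third coordinates of the equations share the factor
    \<open>\<beta> - 1 / (2 * kap s)\<close>, which is nonzero because \<open>t2\<close> is.\<close>
  have \<tau>3: "\<tau> $ 3 = 0"
  proof -
    have "\<tau> $ 3 * (\<beta> - 1 / (2 * kap s)) = 0" using bc(3) m2 by (simp add: algebra_simps)
    moreover have "\<beta> - 1 / (2 * kap s) \<noteq> 0" using t2e t(5) by auto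
    ultimately show ?thesis by simp
  qed
  have m20: "m $ 2 = 0" using m2 \<tau>3 by simp
  have nm: "(norm m)\<^sup>2 = (m $ 3)\<^sup>2" using m1 m20 by (simp add: norm_sq_3)
  have FFe: "energy_lb t m \<tau> = 4 * s\<^sup>2 * \<beta> - 4 * kap s * (m $ 3)\<^sup>2"
    unfolding FFv fs nm bs by (simp add: algebra_simps power2_eq_square)
  have last: "\<beta> = kap_slope s * (m $ 3)\<^sup>2" if "s < S"
  proof -
    define h where "h = (\<lambda>x. x * b - (m $ 3)\<^sup>2 * kap x)"
    have "(h has_real_derivative b - (m $ 3)\<^sup>2 * (s * kap_slope s)) (at s)"
      unfolding h_def using kap_deriv[of s] tan_gap_nz[of s] s_pi sS S by (auto intro!: derivative_eq_intros)
    moreover have "0 < min (s - pi) (S - s)" using s_pi that by simp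
    moreover have "\<forall>y. \<bar>s - y\<bar> < min (s - pi) (S - s) \<longrightarrow> h y \<le> h s"
    proof (intro allI impI)
      fix y assume y: "\<bar>s - y\<bar> < min (s - pi) (S - s)"
      then have "pi \<le> y" "y \<le> S" by linarith+
      then show "h y \<le> h s" using rad[of y] f_ge[of y] fs pi_gt_zero unfolding h_def nm by (simp add:
          algebra_simps)
    qed
    ultimately have "b - (m $ 3)\<^sup>2 * (s * kap_slope s) = 0" by (rule DERIV_local_max)
    then show ?thesis using s0 unfolding bs by (simp add: algebra_simps)
  qed
  show ?thesis using \<beta>0 s_pi sS \<tau>3 m1 m20 m3 bc(1) t2e FFe last by blast
qed

text \<open>Making the second coordinate of \<open>\<tau>\<close> nonnegative preserves both norms
  and can only raise the linear term. The maximum at \<open>- m\<close> is thus at most the one at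
  \<open>m\<close>, and a minimiser with \<open>m $ 3 > 0\<close> can be traded for its
  negative.\<close>

lemma energy_lb_reflect:
  assumes m: "m $ 1 = 0" "m $ 2 = 0" "0 \<le> m $ 3" and t: "0 \<le> t $ 2" "t $ 3 = 0"
  shows "\<exists>z. norm z = norm \<tau> \<and> energy_lb t (- m) \<tau> \<le> energy_lb t m z"
proof -
  define z :: "real^3" where "z = vector [\<tau> $ 1, \<bar>\<tau> $ 2\<bar>, \<tau> $ 3]"
  have z: "z $ 1 = \<tau> $ 1" "z $ 2 = \<bar>\<tau> $ 2\<bar>" "z $ 3 = \<tau> $ 3" by (simp_all add: z_def)
  have "(norm z)\<^sup>2 = (norm \<tau>)\<^sup>2" by (simp add: norm_sq_3 z)
  then have n: "norm z = norm \<tau>" by simp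
  have c: "(norm (m \<times> z))\<^sup>2 = (norm ((- m) \<times> \<tau>))\<^sup>2"
    by (simp add: norm_sq_3 cross_components z m power_mult_distrib)
  have d_pos: "z \<bullet> (t - e1 \<times> m) = \<tau> $ 1 * t $ 1 + \<bar>\<tau> $ 2\<bar> * (t $ 2 + m $ 3)"
    by (simp add: inner_vec_def sum_3 e1_cross z m t)
  have d_neg: "\<tau> \<bullet> (t - e1 \<times> (- m)) = \<tau> $ 1 * t $ 1 + \<tau> $ 2 * (t $ 2 - m $ 3)"
    by (simp add: inner_vec_def sum_3 e1_cross m t)
  have "\<tau> $ 2 * (t $ 2 - m $ 3) \<le> \<bar>\<tau> $ 2\<bar> * \<bar>t $ 2 - m $ 3\<bar>" by (simp add: abs_mult[symmetric])
  also have "\<dots> \<le> \<bar>\<tau> $ 2\<bar> * (t $ 2 + m $ 3)" using m t by (intro mult_left_mono) auto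
  finally have "energy_lb t (- m) \<tau> \<le> energy_lb t m z" unfolding energy_lb_def d_pos d_neg n c by simp
  then show ?thesis using n by blast
qed

lemma minimal_value:
  assumes t: "t $ 1 = t1" "t $ 2 = t2" "t $ 3 = 0" "0 < t1" "0 < t2" "pi * t2\<^sup>2 < t1"
  shows "\<exists>s v w \<beta>. pi < s \<and> s < theta1 \<and> 0 < v \<and> 0 < w \<and> s\<^sup>2 = v\<^sup>2 + w\<^sup>2 \<and>
     \<beta> = kap_slope s * (w / (2 * kap s))\<^sup>2 \<and> t1 = \<beta> * v \<and> t2 = w * (1 / (2 * kap s) - \<beta>) \<and>
     (\<forall>m. \<exists>\<tau>. norm \<tau> < theta1 \<and> 4 * s\<^sup>2 * \<beta> - w\<^sup>2 / kap s \<le> energy_lb t m \<tau>)"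
proof -
  \<comment> \<open>The size of \<open>kap S\<close> rules out \<open>s = S\<close> below: there
    \<open>2 * t1 * kap s < v \<le> s < theta1\<close> would hold.\<close>
  obtain S where S: "pi < S" "S < theta1" "theta1 / (2 * t1) \<le> kap S" using kap_unbounded by blast
  have S': "pi \<le> S" "0 \<le> S" using S pi_gt_zero by linarith+
  have t1': "0 < t $ 1" using t by simp
  obtain m0 \<tau>0 where mx0: "is_max t S m0 \<tau>0" and mn0: "\<forall>m \<tau>. is_max t S m \<tau> \<longrightarrow> energy_lb t m0 \<tau>0 \<le>
      energy_lb t m \<tau>"
    using minimizer_exists[OF S'(1) S(2) t1'] by blast
  \<comment> \<open>The sign \<open>m $ 3 \<le> 0\<close> makes \<open>\<tau> $ 2\<close> negative,
    as in \<open>Omega_m4\<close>, and yields \<open>\<beta> < 1 / (2 * kap s)\<close>.\<close>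
  have "\<exists>m \<tau>. is_max t S m \<tau> \<and> (\<forall>m' \<tau>'. is_max t S m' \<tau>' \<longrightarrow> energy_lb t m \<tau> \<le> energy_lb t m' \<tau>') \<and> m $ 3 \<le> 0"
  proof (cases "m0 $ 3 \<le> 0")
    case True
    then show ?thesis using mx0 mn0 by blast
  next
    case False
    obtain \<tau>1 where \<tau>1: "is_max t S (- m0) \<tau>1" using is_max_exists[OF S'(2) S(2)] by blast
    have "m0 $ 1 = 0 \<and> m0 $ 2 = 0"
      using minimizer_classify[OF S(1,2) t mx0 mn0[rule_format]] by blast
    then obtain z where z: "norm z = norm \<tau>1" "energy_lb t (- m0) \<tau>1 \<le> energy_lb t m0 z"
      using energy_lb_reflect[of m0 t \<tau>1] False t by auto
    have "norm z \<le> S" using z \<tau>1 by (simp add: is_max_def)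
    then have "energy_lb t (- m0) \<tau>1 \<le> energy_lb t m0 \<tau>0" using z mx0 unfolding is_max_def by (meson
        order_trans)
    then have "\<forall>m' \<tau>'. is_max t S m' \<tau>' \<longrightarrow> energy_lb t (- m0) \<tau>1 \<le> energy_lb t m' \<tau>'" using mn0 by (meson
        order_trans)
    moreover have "(- m0) $ 3 \<le> 0" using False by simp
    ultimately show ?thesis using \<tau>1 by blast
  qed
  then obtain m \<tau> where mx: "is_max t S m \<tau>" and mn1: "\<forall>m' \<tau>'. is_max t S m' \<tau>' \<longrightarrow> energy_lb t m \<tau> \<le>
      energy_lb t m' \<tau>'"
    and m3: "m $ 3 \<le> 0" by blast
  note mn = mn1[rule_format]
  define s where "s = norm \<tau>"
  obtain \<beta> where \<beta>: "0 < \<beta>" "pi < s" "s \<le> S" "\<tau> $ 3 = 0" "m $ 3 = \<tau> $ 2 / (2 * kap s)"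
     "t1 = \<beta> * \<tau> $ 1" "t2 = \<tau> $ 2 * (\<beta> - 1 / (2 * kap s))"
     "energy_lb t m \<tau> = 4 * s\<^sup>2 * \<beta> - 4 * kap s * (m $ 3)\<^sup>2" "s < S \<longrightarrow> \<beta> = kap_slope s * (m $ 3)\<^sup>2"
    using minimizer_classify[OF S(1,2) t mx] mn unfolding s_def by blast
  have sth: "s < theta1" using \<beta>(3) S by simp
  have kp: "0 < kap s" using kap_pos[OF \<beta>(2) sth] .
  define v where "v = \<tau> $ 1"
  define w where "w = - \<tau> $ 2"
  have v0: "0 < v" using \<beta>(1,6) t(4) by (simp add: v_def zero_less_mult_iff)
  have "w \<noteq> 0" using \<beta>(7) t(5) by (auto simp: w_def)
  moreover have "0 \<le> w" using m3 \<beta>(5) kp by (simp add: w_def divide_le_0_iff)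
  ultimately have w0: "0 < w" by simp
  have s2: "s\<^sup>2 = v\<^sup>2 + w\<^sup>2" using \<beta>(4) by (simp add: s_def v_def w_def norm_sq_3)
  have t2w: "t2 = w * (1 / (2 * kap s) - \<beta>)" using \<beta>(7) by (simp add: w_def algebra_simps)
  then have b1: "\<beta> < 1 / (2 * kap s)" using t(5) w0 by (simp add: zero_less_mult_iff)
  have m3w: "m $ 3 = - (w / (2 * kap s))" using \<beta>(5) by (simp add: w_def)
  have "s \<noteq> S"
  proof
    assume "s = S"
    then have "theta1 \<le> 2 * t1 * kap s" using S(3) t(4) by (simp add: field_simps)
    moreover have "2 * t1 * kap s < v"
    proof -
      have "2 * kap s * \<beta> < 1" using b1 kp by (simp add: field_simps)
      then have "2 * kap s * \<beta> * v < 1 * v" using v0 by (intro mult_strict_right_mono)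
      then show ?thesis using \<beta>(6) by (simp add: v_def algebra_simps)
    qed
    moreover have "v \<le> s" using component_le_norm_cart[of \<tau> 1] by (simp add: v_def s_def)
    ultimately show False using sth by linarith
  qed
  then have be: "\<beta> = kap_slope s * (w / (2 * kap s))\<^sup>2" using \<beta>(3,9) m3w by simp
  have val: "energy_lb t m \<tau> = 4 * s\<^sup>2 * \<beta> - w\<^sup>2 / kap s"
    unfolding \<beta>(8) m3w using kp by (simp add: power2_eq_square field_simps)
  have low: "\<exists>\<tau>'. norm \<tau>' < theta1 \<and> 4 * s\<^sup>2 * \<beta> - w\<^sup>2 / kap s \<le> energy_lb t m' \<tau>'" for m'
  proof -
    obtain \<tau>' where \<tau>': "is_max t S m' \<tau>'" using is_max_exists[OF S'(2) S(2)] by blast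
    then have "norm \<tau>' < theta1" using S(2) by (simp add: is_max_def)
    then show ?thesis using mn[OF \<tau>'] unfolding val by blast
  qed
  show ?thesis using \<beta>(2) sth v0 w0 s2 be \<beta>(6)[folded v_def] t2w low by blast
qed

subsection \<open>The extremal helix\<close>

lemma abs_cont_on_lipschitz:
  assumes "\<And>x y. \<lbrakk>x \<in> S; y \<in> S\<rbrakk> \<Longrightarrow> norm (f y - f x) \<le> L * \<bar>y - x\<bar>"
  shows "abs_cont_on S f"
  unfolding abs_cont_on_def
proof (intro allI impI)
  fix \<epsilon> :: real assume \<epsilon>: "0 < \<epsilon>"
  define K where "K = \<bar>L\<bar> + 1"
  have K: "0 < K" "L \<le> K" by (auto simp: K_def)
  show "\<exists>\<delta>>0. \<forall>(n::nat) (ab :: nat \<Rightarrow> real \<times> real).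
        (\<forall>k<n. fst (ab k) \<in> S \<and> snd (ab k) \<in> S \<and> fst (ab k) \<le> snd (ab k)) \<and>
        (\<forall>i<n. \<forall>j<n. i \<noteq> j \<longrightarrow> snd (ab i) \<le> fst (ab j) \<or> snd (ab j) \<le> fst (ab i)) \<and>
        (\<Sum>k<n. snd (ab k) - fst (ab k)) < \<delta>
        \<longrightarrow> (\<Sum>k<n. norm (f (snd (ab k)) - f (fst (ab k)))) < \<epsilon>"
  proof (intro exI[of _ "\<epsilon> / K"] conjI allI impI; (elim conjE)?)
    show "0 < \<epsilon> / K" using \<epsilon> K by simp
    fix n :: nat and ab :: "nat \<Rightarrow> real \<times> real"
    assume ab: "\<forall>k<n. fst (ab k) \<in> S \<and> snd (ab k) \<in> S \<and> fst (ab k) \<le> snd (ab k)"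
      and len: "(\<Sum>k<n. snd (ab k) - fst (ab k)) < \<epsilon> / K"
    have "(\<Sum>k<n. norm (f (snd (ab k)) - f (fst (ab k)))) \<le> (\<Sum>k<n. K * (snd (ab k) - fst (ab k)))"
    proof (rule sum_mono)
      fix k assume "k \<in> {..<n}"
      then have k: "fst (ab k) \<in> S" "snd (ab k) \<in> S" "fst (ab k) \<le> snd (ab k)" using ab by auto
      have "norm (f (snd (ab k)) - f (fst (ab k))) \<le> L * (snd (ab k) - fst (ab k))"
        using assms[OF k(1,2)] k(3) by simp
      also have "\<dots> \<le> K * (snd (ab k) - fst (ab k))" using K k(3) by (intro mult_right_mono) auto
      finally show "norm (f (snd (ab k)) - f (fst (ab k))) \<le> K * (snd (ab k) - fst (ab k))" .
    qed
    also have "\<dots> < \<epsilon>" using len K by (simp add: sum_distrib_left[symmetric] pos_less_divide_eq mult.commute)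
    finally show "(\<Sum>k<n. norm (f (snd (ab k)) - f (fst (ab k)))) < \<epsilon>" .
  qed
qed

lemma vector_3_axis: "(vector [p, q, r] :: real^3) = p *\<^sub>R axis 1 1 + q *\<^sub>R axis 2 1 + r *\<^sub>R axis 3 1"
  by (simp add: vec_eq_iff forall_3 axis_def)

lemma vec3_has_vector_derivative:
  assumes "(a has_real_derivative a') (at x)" "(b has_real_derivative b') (at x)" "(c has_real_derivative
      c') (at x)"
  shows "((\<lambda>x. vector [a x, b x, c x] :: real^3) has_vector_derivative vector [a', b', c']) (at x)"
  unfolding vector_3_axis using assms by (auto intro!: derivative_eq_intros)

lemma vec3_continuous_on:
  assumes "continuous_on S a" "continuous_on S b" "continuous_on S c"
  shows "continuous_on S (\<lambda>x. vector [a x, b x, c x] :: real^3)"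
  unfolding vector_3_axis by (intro continuous_intros assms)

text \<open>The extremal curve is a helix: a rotation in the plane spanned by \<open>e\<^sub>3\<close> and \<open>(w, v, 0) / s\<close>
  combined with a drift; the amplitude \<open>A\<close> is the one that makes its speed constant.\<close>

lemma helix:
  assumes s: "pi < s" "s < theta1" and v: "0 < v" and w: "0 < w" and s2: "s\<^sup>2 = v\<^sup>2 + w\<^sup>2"
    and \<beta>: "\<beta> = kap_slope s * (w / (2 * kap s))\<^sup>2"
  shows "\<exists>\<gamma>. horizontal_curve \<gamma> (e1, vector [\<beta> * v, w * (1 / (2 * kap s) - \<beta>), 0]) \<and>
     curve_length \<gamma> = sqrt (1 + (4 * s\<^sup>2 * \<beta> - w\<^sup>2 / kap s))"
proof -
  define A where "A = w / (2 * s * sin s)"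
  define \<theta> where "\<theta> = (\<lambda>x. s * (2 * x - 1))"
  define X where "X = (\<lambda>x. A * (cos (\<theta> x) - cos s))"
  define X' where "X' = (\<lambda>x. - 2 * s * A * sin (\<theta> x))"
  define Y where "Y = (\<lambda>x. A * (sin (\<theta> x) - sin s * (2 * x - 1)))"
  define Y' where "Y' = (\<lambda>x. A * (2 * s * cos (\<theta> x) - 2 * sin s))"
  define IX where "IX = (\<lambda>x. A * (sin (\<theta> x) / (2 * s) - x * cos s))"
  define IY where "IY = (\<lambda>x. A * (- cos (\<theta> x) / (2 * s) - sin s * (2 * x - 1)\<^sup>2 / 4))"
  \<comment> \<open>An antiderivative of \<open>(Y' * X - X' * Y) / 2\<close>, the area swept by the
    loop; \<open>IX\<close> and \<open>IY\<close> are antiderivatives of \<open>X\<close> and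
    \<open>Y\<close>.\<close>
  define Q where "Q = (\<lambda>x. A\<^sup>2 * ((s + sin s * cos s) * x - (s * cos s + sin s) * sin (\<theta> x) / (2 * s)
     - sin s * (sin (\<theta> x) - \<theta> x * cos (\<theta> x)) / (2 * s)))"
  have S: "sin s < 0" using sin_neg_pi_2pi s theta1_lt_2pi by simp
  have sp: "0 < s" using s pi_gt_zero by linarith
  have nz: "tan_gap s \<noteq> 0" "s \<noteq> 0" "sin s \<noteq> 0" "0 < kap s" using tan_gap_nz[of s] S sp kap_pos[OF s] s by auto
  have wA: "w = 2 * s * sin s * A" using nz by (simp add: A_def)
  have d\<theta>: "(\<theta> has_real_derivative 2 * s) (at x)" for x
    unfolding \<theta>_def by (auto intro!: derivative_eq_intros)
  have dX: "(X has_real_derivative X' x) (at x)" for x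
    unfolding X_def X'_def by (auto intro!: derivative_eq_intros d\<theta>)
  have dY: "(Y has_real_derivative Y' x) (at x)" for x
    unfolding Y_def Y'_def by (auto intro!: derivative_eq_intros d\<theta> simp: algebra_simps)
  have dIX: "(IX has_real_derivative X x) (at x)" for x
    unfolding IX_def X_def using sp by (auto intro!: derivative_eq_intros d\<theta>)
  have dIY: "(IY has_real_derivative Y x) (at x)" for x
    unfolding IY_def Y_def using sp by (auto intro!: derivative_eq_intros d\<theta> simp: field_simps)
  have dQ: "(Q has_real_derivative (Y' x * X x - X' x * Y x) / 2) (at x)" for x
  proof -
    have "(Q has_real_derivative A\<^sup>2 * ((s + sin s * cos s) - (s * cos s + sin s) * cos (\<theta> x)
        - sin s * (\<theta> x * sin (\<theta> x)))) (at x)"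
      unfolding Q_def using sp by (auto intro!: derivative_eq_intros d\<theta> simp: field_simps)
    moreover have "(Y' x * X x - X' x * Y x) / 2 = A\<^sup>2 * ((s * ((sin (\<theta> x))\<^sup>2 + (cos (\<theta> x))\<^sup>2) + sin s *
        cos s)
        - (s * cos s + sin s) * cos (\<theta> x) - sin s * (\<theta> x * sin (\<theta> x)))"
    proof -
      have "((A * (2 * s * q - 2 * S)) * (A * (q - C)) - (- 2 * s * A * p) * (A * (p - S * (2 * x - 1)))) / 2
        = A\<^sup>2 * ((s * (p\<^sup>2 + q\<^sup>2) + S * C) - (s * C + S) * q - S * (s * (2 * x - 1) * p))" for p q S C
        by (simp add: field_simps power2_eq_square)
      from this[of "cos (\<theta> x)" "sin s" "cos s" "sin (\<theta> x)"]
      show ?thesis unfolding X_def X'_def Y_def Y'_def by (simp add: \<theta>_def)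
    qed
    ultimately show ?thesis by simp
  qed
  define x1 x1' where "x1 = (\<lambda>x. x + Y x * (w / s))" and "x1' = (\<lambda>x. 1 + Y' x * (w / s))"
  define x2 x2' where "x2 = (\<lambda>x. Y x * (v / s))" and "x2' = (\<lambda>x. Y' x * (v / s))"
  have dx: "(x1 has_real_derivative x1' x) (at x)" "(x2 has_real_derivative x2' x) (at x)" for x
    unfolding x1_def x1'_def x2_def x2'_def using sp by (auto intro!: derivative_eq_intros dY)
  define T1 where "T1 = (\<lambda>x. (v / s) * (Q x - Q 0))"
  define T2 where "T2 = (\<lambda>x. x * X x / 2 - (IX x - IX 0) - (w / s) * (Q x - Q 0))"
  define T3 where "T3 = (\<lambda>x. (v / s) * ((IY x - IY 0) - x * Y x / 2))"
  define T1' where "T1' = (\<lambda>x. (x2' x * X x - x2 x * X' x) / 2)"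
  define T2' where "T2' = (\<lambda>x. (X' x * x1 x - X x * x1' x) / 2)"
  define T3' where "T3' = (\<lambda>x. (x1' x * x2 x - x1 x * x2' x) / 2)"
  have dT: "(T1 has_real_derivative T1' x) (at x)" "(T2 has_real_derivative T2' x) (at x)"
    "(T3 has_real_derivative T3' x) (at x)" for x
    unfolding T1_def T1'_def T2_def T2'_def T3_def T3'_def x1_def x1'_def x2_def x2'_def using sp
    by (auto intro!: derivative_eq_intros dQ dX dY dIX dIY simp: field_simps)
  define \<gamma> where "\<gamma> = (\<lambda>x. (vector [x1 x, x2 x, X x] :: real^3, vector [T1 x, T2 x, T3 x] :: real^3))"
  define \<gamma>' where "\<gamma>' = (\<lambda>x. (vector [x1' x, x2' x, X' x] :: real^3, vector [T1' x, T2' x, T3' x] :: real^3))"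
  have d\<gamma>: "(\<gamma> has_vector_derivative \<gamma>' x) (at x)" for x
    unfolding \<gamma>_def \<gamma>'_def
    by (intro has_vector_derivative_Pair vec3_has_vector_derivative dx dX dT)
  have vd: "vector_derivative \<gamma> (at x) = \<gamma>' x" for x by (rule vector_derivative_at[OF d\<gamma>])
  have th: "\<theta> 0 = - s" "\<theta> 1 = s" by (auto simp: \<theta>_def)
  have e0: "X 0 = 0" "Y 0 = 0" "X 1 = 0" "Y 1 = 0" by (auto simp: X_def Y_def th)
  have Q1: "Q 1 - Q 0 = \<beta> * s"
  proof -
    have "Q 1 - Q 0 = A\<^sup>2 * ((s\<^sup>2 + s * sin s * cos s - 2 * (sin s)\<^sup>2) / s)"
      unfolding Q_def th using sp by (simp add: field_simps power2_eq_square)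
    also have "\<dots> = A\<^sup>2 * (kap_slope s * (tan_gap s)\<^sup>2 / s)" using kap_slope_alt[OF nz(1,2)] nz by simp
    also have "\<dots> = \<beta> * s"
      unfolding \<beta> A_def kap_def using nz(1-3) by (simp add: field_simps power2_eq_square)
    finally show ?thesis .
  qed
  \<comment> \<open>The mean of the loop in the third coordinate is the \<open>m $ 3\<close> of the
    minimiser.\<close>
  have IX1: "IX 1 - IX 0 = - w / (2 * kap s)"
  proof -
    have "IX 1 - IX 0 = A * (tan_gap s / s)" unfolding IX_def th tan_gap_def using sp by (simp add:
        field_simps)
    also have "\<dots> = - w / (2 * kap s)" unfolding A_def kap_def using nz(1-3) by (simp add: field_simps
        power2_eq_square)
    finally show ?thesis .
  qed
  have IY1: "IY 1 - IY 0 = 0" by (simp add: IY_def th)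
  have g0: "\<gamma> 0 = N32_id"
    by (simp add: \<gamma>_def N32_id_def x1_def x2_def e0 T1_def T2_def T3_def vec_eq_iff forall_3)
  have g1: "\<gamma> 1 = (e1, vector [\<beta> * v, w * (1 / (2 * kap s) - \<beta>), 0])"
  proof -
    have "T1 1 = \<beta> * v" using sp by (simp add: T1_def Q1)
    moreover have "T2 1 = w * (1 / (2 * kap s) - \<beta>)" unfolding T2_def Q1 IX1 e0 using sp by (simp add:
        right_diff_distrib)
    moreover have "T3 1 = 0" by (simp add: T3_def IY1 e0)
    ultimately show ?thesis by (simp add: \<gamma>_def e1_def x1_def x2_def e0)
  qed
  have hor: "snd (\<gamma>' x) = (1/2) *\<^sub>R Uform (fst (\<gamma> x)) (fst (\<gamma>' x))" for x
    by (simp add: Uform_cross \<gamma>_def \<gamma>'_def vec_eq_iff forall_3 cross_components T1'_def T2'_def T3'_def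
        mult.commute)
  have cont\<gamma>': "continuous_on {0..1} \<gamma>'"
    unfolding \<gamma>'_def T1'_def T2'_def T3'_def x1_def x1'_def x2_def x2'_def X_def X'_def Y_def Y'_def \<theta>_def
        using sp
    by (intro continuous_on_Pair vec3_continuous_on continuous_intros) auto
  obtain L where L0: "\<forall>x\<in>{0..1}. norm (\<gamma>' x) \<le> L"
    using compact_imp_bounded[OF compact_continuous_image[OF cont\<gamma>' compact_Icc]] by (auto simp: bounded_iff)
  note L = L0[rule_format]
  have ac: "abs_cont_on {0..1} \<gamma>"
  proof (rule abs_cont_on_lipschitz)
    fix x y :: real assume xy: "x \<in> {0..1}" "y \<in> {0..1}"
    have "norm (\<gamma> y - \<gamma> x) \<le> L * norm (y - x)"
    proof (rule differentiable_bound[of "{0..1}" \<gamma> "\<lambda>x h. h *\<^sub>R \<gamma>' x"])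
      fix z :: real assume z: "z \<in> {0..1}"
      show "(\<gamma> has_derivative (\<lambda>h. h *\<^sub>R \<gamma>' z)) (at z within {0..1})"
        using has_vector_derivative_at_within[OF d\<gamma>] unfolding has_vector_derivative_def .
      show "onorm (\<lambda>h. h *\<^sub>R \<gamma>' z) \<le> L"
      proof (rule onorm_le)
        show "norm (h *\<^sub>R \<gamma>' z) \<le> L * norm h" for h
          using mult_left_mono[OF L[OF z], of "\<bar>h\<bar>"] by (simp add: mult.commute)
      qed
    qed (use xy in auto)
    then show "norm (\<gamma> y - \<gamma> x) \<le> L * \<bar>y - x\<bar>" by simp
  qed
  have hc: "horizontal_curve \<gamma> (e1, vector [\<beta> * v, w * (1 / (2 * kap s) - \<beta>), 0])"
    unfolding horizontal_curve_def
  proof (intro conjI ac g0 g1 AE_I2 impI)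
    fix x show "\<gamma> differentiable (at x)" using d\<gamma> by (auto simp: vector_derivative_works vd)
    show "snd (vector_derivative \<gamma> (at x)) = (1/2) *\<^sub>R Uform (fst (\<gamma> x)) (fst (vector_derivative \<gamma> (at x)))"
      unfolding vd by (rule hor)
  qed
  have speed: "norm (fst (\<gamma>' x)) = sqrt (1 + (4 * s\<^sup>2 * \<beta> - w\<^sup>2 / kap s))" for x
  proof -
    have "(norm (fst (\<gamma>' x)))\<^sup>2 = (x1' x)\<^sup>2 + (x2' x)\<^sup>2 + (X' x)\<^sup>2"
      unfolding power2_norm_eq_inner by (simp add: \<gamma>'_def inner_vec_def sum_3 power2_eq_square)
    also have "\<dots> = 1 + 2 * Y' x * (w / s) + (Y' x)\<^sup>2 * ((v\<^sup>2 + w\<^sup>2) / s\<^sup>2) + (X' x)\<^sup>2"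
      unfolding x1'_def x2'_def using sp by (simp add: power2_eq_square field_simps)
    also have "\<dots> = 1 + 2 * Y' x * (w / s) + (Y' x)\<^sup>2 + (X' x)\<^sup>2" using sp by (simp add: s2[symmetric])
    \<comment> \<open>By this relation the term linear in \<open>Y'\<close> completes the square to
      that of \<open>Y' x + 2 * A * sin s\<close>, which is
      \<open>2 * s * A * cos (\<theta> x)\<close>.\<close>
    also have "w / s = 2 * sin s * A" using sp wA by simp
    also have "1 + 2 * Y' x * (2 * sin s * A) + (Y' x)\<^sup>2 + (X' x)\<^sup>2
        = 1 + 4 * A\<^sup>2 * (s\<^sup>2 * ((sin (\<theta> x))\<^sup>2 + (cos (\<theta> x))\<^sup>2) - (sin s)\<^sup>2)"
      unfolding Y'_def X'_def by algebra
    also have "\<dots> = 1 + 4 * A\<^sup>2 * (s\<^sup>2 - (sin s)\<^sup>2)" by simp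
    also have "\<dots> = 1 + (4 * s\<^sup>2 * \<beta> - w\<^sup>2 / kap s)"
    proof -
      have e4: "4 * s\<^sup>2 * \<beta> = w\<^sup>2 * ((s\<^sup>2 + s * sin s * cos s - 2 * (sin s)\<^sup>2) / (s\<^sup>2 * (sin s)\<^sup>2))"
        unfolding \<beta> kap_def kap_slope_alt[OF nz(1,2)] using nz(1-3) by (simp add: field_simps
            power2_eq_square)
      have e5: "w\<^sup>2 / kap s = - (w\<^sup>2 * ((sin s - s * cos s) * sin s / (s\<^sup>2 * (sin s)\<^sup>2)))"
        unfolding kap_def using nz(1-3) by (simp add: tan_gap_def[symmetric] field_simps power2_eq_square)
      have "4 * s\<^sup>2 * \<beta> - w\<^sup>2 / kap s
        = w\<^sup>2 * ((s\<^sup>2 + s * sin s * cos s - 2 * (sin s)\<^sup>2 + (sin s - s * cos s) * sin s) / (s\<^sup>2 * (sin s)\<^sup>2))"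
        unfolding e4 e5 by (simp only: add_divide_distrib distrib_left diff_minus_eq_add)
      also have "\<dots> = w\<^sup>2 * ((s\<^sup>2 - (sin s)\<^sup>2) / (s\<^sup>2 * (sin s)\<^sup>2))" by (simp add: power2_eq_square
          algebra_simps)
      also have "\<dots> = 4 * A\<^sup>2 * (s\<^sup>2 - (sin s)\<^sup>2)" unfolding A_def using nz(1-3) by (simp add: field_simps
          power2_eq_square)
      finally show ?thesis by simp
    qed
    finally show ?thesis by (metis norm_ge_zero real_sqrt_unique)
  qed
  have "curve_length \<gamma> = integral {0..1} (\<lambda>x::real. sqrt (1 + (4 * s\<^sup>2 * \<beta> - w\<^sup>2 / kap s)))"
    unfolding curve_length_def vd speed ..
  then have "curve_length \<gamma> = sqrt (1 + (4 * s\<^sup>2 * \<beta> - w\<^sup>2 / kap s))" by simp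
  with hc show ?thesis by blast
qed

subsection \<open>Injectivity of \<open>Lambda\<close>\<close>

text \<open>For \<open>V = (v, - w)\<close> with norm \<open>s\<close>, the pair \<open>(t1, t2)\<close> is \<open>Lambda V / 4\<close>.\<close>

definition helix_params :: "real \<Rightarrow> real \<Rightarrow> real \<Rightarrow> real \<Rightarrow> real \<Rightarrow> bool" where
  "helix_params s v w t1 t2 \<longleftrightarrow> pi < s \<and> s < theta1 \<and> 0 < v \<and> 0 < w \<and> s\<^sup>2 = v\<^sup>2 + w\<^sup>2 \<and>
     t1 = kap_slope s * (w / (2 * kap s))\<^sup>2 * v \<and> t2 = w * (1 / (2 * kap s) - kap_slope s * (w / (2 * kap
         s))\<^sup>2)"

text \<open>This is \<open>s^2 * psi' s / 4\<close>. With \<open>c = v / s\<close>, the cosine of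
  the angle between \<open>V\<close> and the first axis, the first parameter becomes
  \<open>t1 = psi_slope s * (c - c^3)\<close>.\<close>

definition psi_slope :: "real \<Rightarrow> real" where
  "psi_slope s = s ^ 3 * kap_slope s / (4 * (kap s)\<^sup>2)"

lemma sin_neg: "\<lbrakk>pi < s; s < theta1\<rbrakk> \<Longrightarrow> sin s < 0"
  using sin_neg_pi_2pi theta1_lt_2pi by simp

lemma psi_slope_alt:
  assumes s: "pi < s" "s < theta1"
  shows "psi_slope s = (s / (sin s)\<^sup>2 + cos s / sin s - 2 / s) / 4"
proof -
  have nz: "tan_gap s \<noteq> 0" "s \<noteq> 0" "sin s \<noteq> 0" using tan_gap_nz[of s] sin_neg[OF s] s by auto
  show ?thesis unfolding psi_slope_def kap_def kap_slope_alt[OF nz(1,2)]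
    using nz by (simp add: field_simps power2_eq_square power3_eq_cube)
qed

text \<open>Here \<open>s / (sin s)^2\<close> is at least \<open>s\<close>, the cotangent is
  nonnegative, and \<open>s - 2 / s\<close> is at least \<open>3 - 2/3\<close>. It serves only to
  make \<open>psi_slope\<close> times a number at least 3 exceed 1.\<close>

lemma psi_slope_ge:
  assumes s: "pi < s" "s < theta1"
  shows "7/12 \<le> psi_slope s"
proof -
  have r: "pi \<le> s" "s < theta1" using s by auto
  note sc = sc_range[OF r]
  have S: "sin s < 0" by (rule sin_neg[OF s])
  have "(sin s)\<^sup>2 \<le> 1" by (simp add: abs_square_le_1)
  then have "s * (sin s)\<^sup>2 \<le> s * 1" using sc by (intro mult_left_mono) auto
  then have "s \<le> s / (sin s)\<^sup>2" using S by (simp add: pos_le_divide_eq)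
  moreover have "0 \<le> cos s / sin s" using sc S by (simp add: divide_nonpos_nonpos)
  moreover have "7/3 \<le> s - 2 / s"
  proof -
    have "0 \<le> (s - 3) * (3 * s + 2)" using sc by (intro mult_nonneg_nonneg) auto
    then have "7 * s \<le> 3 * (s * s) - 6" by (simp add: algebra_simps)
    then show ?thesis using sc by (simp add: field_simps)
  qed
  ultimately have "7/3 \<le> s / (sin s)\<^sup>2 + cos s / sin s - 2 / s" by linarith
  then have "7/3 / 4 \<le> (s / (sin s)\<^sup>2 + cos s / sin s - 2 / s) / 4" by (rule divide_right_mono) simp
  then show ?thesis unfolding psi_slope_alt[OF s] by simp
qed

text \<open>Positive \<open>tan_gap\<close> and negative sine give \<open>s * cot s > 1\<close>;
  division by the squared sine keeps this above 1, hence above \<open>1 / s^2\<close>, and the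
  derivative is negative.\<close>

lemma psi_slope_strict_anti:
  assumes "pi < a" "a < b" "b < theta1" shows "psi_slope b < psi_slope a"
proof -
  define h where "h = (\<lambda>s::real. (s / (sin s)\<^sup>2 + cos s / sin s - 2 / s) / 4)"
  have "h b < h a"
  proof (rule DERIV_neg_imp_decreasing[OF assms(2)])
    fix s assume "a \<le> s" "s \<le> b"
    then have s: "pi < s" "s < theta1" using assms by auto
    have S: "sin s < 0" by (rule sin_neg[OF s])
    have s3: "3 < s" using sc_range[of s] s by auto
    have d: "(h has_real_derivative
      ((1 * (sin s)\<^sup>2 - s * (2 * sin s * cos s)) / ((sin s)\<^sup>2 * (sin s)\<^sup>2)
        + (- sin s * sin s - cos s * cos s) / (sin s * sin s) + 2 / (s * s)) / 4) (at s)"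
      unfolding h_def using S s3
      by (auto intro!: derivative_eq_intros simp: power2_eq_square mult_ac)
    have e: "((1 * (sin s)\<^sup>2 - s * (2 * sin s * cos s)) / ((sin s)\<^sup>2 * (sin s)\<^sup>2)
        + (- sin s * sin s - cos s * cos s) / (sin s * sin s) + 2 / (s * s)) / 4
        = (1 / (s * s) - (s * cos s / sin s) / (sin s * sin s)) / 2"
    proof -
      have "- sin s * sin s - cos s * cos s = - ((sin s)\<^sup>2 + (cos s)\<^sup>2)" by (simp add: power2_eq_square)
      then have e1: "- sin s * sin s - cos s * cos s = - 1" by (simp only: sin_cos_squared_add)
      show ?thesis unfolding e1 using S s3 by (simp add: field_simps power2_eq_square)
    qed
    have n: "(1 / (s * s) - (s * cos s / sin s) / (sin s * sin s)) / 2 < 0"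
    proof -
      have "0 < tan_gap s" using tan_gap_pos s s3 by simp
      then have "s * cos s < sin s" by (simp add: tan_gap_def)
      then have "1 < s * cos s / sin s" using S by (simp add: neg_less_divide_eq)
      moreover have "sin s * sin s \<le> 1"
      proof -
        have "(sin s)\<^sup>2 \<le> 1" by (simp add: abs_square_le_1)
        then show ?thesis by (simp add: power2_eq_square)
      qed
      moreover have "0 < sin s * sin s" using S by (simp add: mult_neg_neg)
      ultimately have "1 < (s * cos s / sin s) / (sin s * sin s)" by (simp only: pos_less_divide_eq)
      moreover have "1 / (s * s) \<le> 1"
      proof -
        have "1 * 1 \<le> s * s" using s3 by (intro mult_mono) auto
        then show ?thesis by (simp add: divide_le_eq_1)
      qed
      ultimately show ?thesis by simp
    qed
    show "\<exists>y. (h has_real_derivative y) (at s) \<and> y < 0" using d[unfolded e] n by blast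
  qed
  then show ?thesis using assms by (simp add: psi_slope_alt h_def)
qed

text \<open>Positivity of \<open>t2\<close> bounds \<open>kap_slope s * w^2\<close> by
  \<open>2 * kap s\<close>, and convexity of \<open>kap\<close> in \<open>s^2\<close> bounds that by
  \<open>kap_slope s * (s^2 - pi^2)\<close>; so \<open>w^2 < s^2 - pi^2\<close>.\<close>

lemma helix_params_pi:
  assumes "helix_params s v w t1 t2" "0 < t2" shows "pi < v" "kap_slope s * w\<^sup>2 < 2 * kap s"
proof -
  have s: "pi < s" "s < theta1" and w: "0 < w" and v: "0 < v" and s2: "s\<^sup>2 = v\<^sup>2 + w\<^sup>2"
    and t2: "t2 = w * (1 / (2 * kap s) - kap_slope s * (w / (2 * kap s))\<^sup>2)"
    using assms by (auto simp: helix_params_def)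
  have k: "0 < kap s" by (rule kap_pos[OF s])
  have "kap_slope s * (w / (2 * kap s))\<^sup>2 < 1 / (2 * kap s)"
    using assms(2) w unfolding t2 by (simp add: zero_less_mult_iff)
  then show g: "kap_slope s * w\<^sup>2 < 2 * kap s" using k by (simp add: field_simps power2_eq_square)
  also have "\<dots> \<le> kap_slope s * (s\<^sup>2 - pi\<^sup>2)" using kap_le_kap_slope[of s] s by simp
  finally have "w\<^sup>2 < s\<^sup>2 - pi\<^sup>2" using kap_slope_ge_1[of s] s by simp
  then have "pi\<^sup>2 < v\<^sup>2" using s2 by simp
  then show "pi < v" using v by (simp add: power2_less_imp_less)
qed

text \<open>For fixed \<open>t1\<close>, increasing the angle between \<open>V\<close> and the first axis increases \<open>s\<close> and strictly decreases
  \<open>t2\<close>.\<close>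

lemma helix_params_unique_aux:
  assumes g: "helix_params s v w t1 t2" "helix_params s' v' w' t1 t2" and t: "0 < t1" "0 < t2"
    and le: "v' / s' \<le> v / s"
  shows "s = s' \<and> v = v' \<and> w = w'"
proof -
  have s: "pi < s" "s < theta1" "pi < s'" "s' < theta1" and pos: "0 < w" "0 < v" "0 < w'" "0 < v'"
    and s2: "s\<^sup>2 = v\<^sup>2 + w\<^sup>2" "s'\<^sup>2 = v'\<^sup>2 + w'\<^sup>2"
    using g by (auto simp: helix_params_def)
  have vp: "pi < v" "pi < v'" using helix_params_pi g t by auto
  have sp: "0 < s" "0 < s'" using s pi_gt_zero by linarith+
  define c c' where "c = v / s" and "c' = v' / s'"
  have c0: "0 < c" "0 < c'" using pos sp by (auto simp: c_def c'_def)
  \<comment> \<open>From \<open>v > pi\<close> and \<open>s < 3/2 * pi\<close> the cosine exceeds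
    2/3, hence lies in the range where \<open>c - c^3\<close> decreases.\<close>
  have third: "1 < 3 * (x / y)\<^sup>2" if "pi < x" "0 < y" "y < theta1" for x y
  proof -
    have "y\<^sup>2 < (3/2 * pi)\<^sup>2" using that theta1_bounds by (intro power_strict_mono) auto
    also have "\<dots> \<le> 3 * pi\<^sup>2" by (simp add: power2_eq_square)
    also have "\<dots> < 3 * x\<^sup>2" using that by (simp add: power_strict_mono)
    finally show ?thesis using that by (simp add: field_simps)
  qed
  have c3: "1 < 3 * c\<^sup>2" "1 < 3 * c'\<^sup>2" unfolding c_def c'_def using third vp sp s by auto
  have k: "0 < kap s" "0 < kap s'" using kap_pos s by auto
  have gp: "1 \<le> kap_slope s" "1 \<le> kap_slope s'" using kap_slope_ge_1 s by auto
  have tN: "t1 = psi_slope s * (c - c ^ 3)" "t1 = psi_slope s' * (c' - c' ^ 3)"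
  proof -
    have gen: "kap_slope s * (w / (2 * kap s))\<^sup>2 * v = psi_slope s * (v / s - (v / s) ^ 3)"
      if "s\<^sup>2 = v\<^sup>2 + w\<^sup>2" "0 < s" "0 < kap s" for s v w
    proof -
      have "v / s - (v / s) ^ 3 = v * w\<^sup>2 / s ^ 3"
      proof -
        have "v / s - (v / s) ^ 3 = v * (s\<^sup>2 - v\<^sup>2) / s ^ 3"
          using that(2) by (simp add: field_simps power2_eq_square power3_eq_cube)
        then show ?thesis using that(1) by simp
      qed
      then show ?thesis unfolding psi_slope_def using that(2,3) by (simp add: power_divide power_mult_distrib)
    qed
    show "t1 = psi_slope s * (c - c ^ 3)" "t1 = psi_slope s' * (c' - c' ^ 3)"
      using g gen[OF s2(1) sp(1) k(1)] gen[OF s2(2) sp(2) k(2)] by (auto simp: helix_params_def c_def c'_def)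
  qed
  have Np: "7/12 \<le> psi_slope s" "7/12 \<le> psi_slope s'" using psi_slope_ge s by auto
  show ?thesis
  proof (cases "c' = c")
    case True
    have "c - c ^ 3 \<noteq> 0" using tN(1) t(1) by auto
    then have "psi_slope s = psi_slope s'" using tN True by simp
    then have ss: "s = s'" using psi_slope_strict_anti[of s s'] psi_slope_strict_anti[of s' s] s by (cases
        s s' rule: linorder_cases) auto
    then have "v = v'" using True sp by (simp add: c_def c'_def)
    then have "w\<^sup>2 = w'\<^sup>2" using s2 ss by simp
    then show ?thesis using ss \<open>v = v'\<close> pos by (simp add: power2_eq_iff_nonneg)
  next
    case False
    then have lt: "c' < c" using le by (simp add: c_def c'_def)
    have "c - c ^ 3 < c' - c' ^ 3"
    proof -
      have "c' * c' \<le> c * c'" "c' * c' \<le> c * c" using lt c0 by (auto intro!: mult_mono)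
      then have "1 < c * c + c * c' + c' * c'" using c3 by (simp add: power2_eq_square)
      then have "(c - c') * 1 < (c - c') * (c * c + c * c' + c' * c')" using lt by (intro
          mult_strict_left_mono) auto
      then show ?thesis by (simp add: power3_eq_cube algebra_simps)
    qed
    note clt = this
    have cc: "0 < c - c ^ 3"
    proof -
      have "0 < psi_slope s * (c - c ^ 3)" using tN(1) t(1) by simp
      then show ?thesis using Np by (simp add: zero_less_mult_iff)
    qed
    have Nlt: "psi_slope s' < psi_slope s"
    proof (rule ccontr)
      assume "\<not> ?thesis"
      then have "psi_slope s * (c - c ^ 3) \<le> psi_slope s' * (c - c ^ 3)" using cc by (intro
          mult_right_mono) auto
      also have "\<dots> < psi_slope s' * (c' - c' ^ 3)" using clt Np by (intro mult_strict_left_mono) auto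
      finally show False using tN by simp
    qed
    have sl: "s < s'"
      using psi_slope_strict_anti[of s' s] Nlt s by (cases s s' rule: linorder_cases) auto
    define kp where "kp = s * kap_slope s"
    define X X' T T' where "X = s / v" and "X' = s' / v'" and "T = w / v" and "T' = w' / v'"
    define \<rho> \<rho>' where "\<rho> = w / (2 * kap s)" and "\<rho>' = w' / (2 * kap s')"
    have P: "0 < X" "0 < X'" "0 < T" "0 < T'" "0 < \<rho>" "0 < \<rho>'"
      using pos sp k by (auto simp: X_def X'_def T_def T'_def \<rho>_def \<rho>'_def)
    have XX: "X < X'" using lt pos sp by (simp add: X_def X'_def c_def c'_def field_simps)
    have k3: "3 \<le> kp"
    proof -
      have "3 * 1 \<le> s * kap_slope s" using sc_range(3)[of s] s gp by (intro mult_mono) auto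
      then show ?thesis by (simp add: kp_def)
    qed
    have kl: "kp \<le> s' * kap_slope s'"
      unfolding kp_def using sl kap_slope_strict_mono[of s s'] s gp sp by (intro mult_mono) auto
    have r1: "t1 = kap_slope s * \<rho>\<^sup>2 * v" and r2: "t1 = kap_slope s' * \<rho>'\<^sup>2 * v'"
      and q1: "t2 = w * (1 / (2 * kap s) - kap_slope s * \<rho>\<^sup>2)" and q2: "t2 = w' * (1 / (2 * kap s') -
          kap_slope s' * \<rho>'\<^sup>2)"
      using g unfolding helix_params_def \<rho>_def \<rho>'_def by blast+
    have rho: "kp * \<rho>\<^sup>2 = t1 * X" "s' * kap_slope s' * \<rho>'\<^sup>2 = t1 * X'"
      using pos by (simp add: kp_def X_def r1, simp add: X'_def r2)
    have T2: "T\<^sup>2 = X\<^sup>2 - 1" "T'\<^sup>2 = X'\<^sup>2 - 1"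
      unfolding T_def X_def T'_def X'_def power_divide s2 using pos by (auto simp: field_simps)
    have NT: "psi_slope s * T\<^sup>2 = t1 * X ^ 3" "psi_slope s' * T'\<^sup>2 = t1 * X' ^ 3"
      using pos k
      by (simp add: psi_slope_def T_def X_def r1 \<rho>_def field_simps power2_eq_square power3_eq_cube,
          simp add: psi_slope_def T'_def X'_def r2 \<rho>'_def field_simps power2_eq_square power3_eq_cube)
    \<comment> \<open>The value that \<open>\<rho>'\<close> would have if
      \<open>s * kap_slope s\<close> did not grow; since it grows, \<open>\<sigma>\<close> bounds
      \<open>\<rho>'\<close> from above.\<close>
    define \<sigma> where "\<sigma> = sqrt (t1 * X' / kp)"
    have \<sigma>2: "kp * \<sigma>\<^sup>2 = t1 * X'" and \<sigma>0: "0 < \<sigma>" using k3 t P by (auto simp: \<sigma>_def)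
    have \<rho>\<sigma>: "\<rho>' \<le> \<sigma>"
    proof (rule power2_le_imp_le)
      have "kp * \<rho>'\<^sup>2 \<le> s' * kap_slope s' * \<rho>'\<^sup>2" using kl by (intro mult_right_mono) auto
      then have "kp * \<rho>'\<^sup>2 \<le> kp * \<sigma>\<^sup>2" using rho \<sigma>2 by simp
      then show "\<rho>'\<^sup>2 \<le> \<sigma>\<^sup>2" using k3 by simp
    qed (use \<sigma>0 in simp)
    have bound: "A \<le> kp * (Y * r)" if "N * A\<^sup>2 = t1 * Y ^ 3" "kp * r\<^sup>2 = t1 * Y" "7/12 \<le> N" "0 < Y" "0 <
        r" for A N Y r
    proof (rule power2_le_imp_le)
      have Nk: "1 \<le> N * kp" using mult_mono[of "7/12" N 3 kp] that(3) k3 by simp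
      have "(kp * (Y * r))\<^sup>2 = kp * Y\<^sup>2 * (kp * r\<^sup>2)" by (simp add: power2_eq_square algebra_simps)
      also have "\<dots> = kp * (t1 * Y ^ 3)" unfolding that(2) by (simp add: power2_eq_square power3_eq_cube
          algebra_simps)
      also have "\<dots> = (N * kp) * A\<^sup>2" unfolding that(1)[symmetric] by (simp add: algebra_simps)
      finally have "(kp * (Y * r))\<^sup>2 = (N * kp) * A\<^sup>2" .
      moreover have "1 * A\<^sup>2 \<le> (N * kp) * A\<^sup>2" using Nk by (intro mult_right_mono) auto
      ultimately show "A\<^sup>2 \<le> (kp * (Y * r))\<^sup>2" by simp
      show "0 \<le> kp * (Y * r)" using that k3 by simp
    qed
    have b1: "T \<le> kp * (X * \<rho>)" by (rule bound[OF NT(1) rho(1) Np(1) P(1) P(5)])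
    have b2: "T' \<le> kp * (X' * \<sigma>)" by (rule bound[OF NT(2) \<sigma>2 Np(2) P(2) \<sigma>0])
    have "(\<sigma> - \<rho>) * ((\<sigma> + \<rho>) * kp) = t1 * (X' - X)"
      using \<sigma>2 rho(1) by (simp add: power2_eq_square algebra_simps)
    moreover have "(T' - T) * (T' + T) = (X' - X) * (X' + X)"
      using T2 by (simp add: power2_eq_square algebra_simps)
    moreover have "T' + T < kp * ((X' + X) * (\<sigma> + \<rho>))"
    proof -
      have "0 < kp * (X' * \<rho>)" "0 < kp * (X * \<sigma>)" using k3 P \<sigma>0 by auto
      then show ?thesis using b1 b2 by (simp add: algebra_simps)
    qed
    \<comment> \<open>Both differences are multiples of \<open>X' - X\<close>, so they are compared
      through the sums \<open>\<sigma> + \<rho>\<close> and \<open>T' + T\<close>. As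
      \<open>t2 = \<rho> - t1 * T\<close>, the result says that \<open>t2\<close> would strictly
      drop.\<close>
    ultimately have main: "\<sigma> - \<rho> < t1 * (T' - T)"
    proof -
      assume a: "(\<sigma> - \<rho>) * ((\<sigma> + \<rho>) * kp) = t1 * (X' - X)" "(T' - T) * (T' + T) = (X' - X) * (X' + X)"
        "T' + T < kp * ((X' + X) * (\<sigma> + \<rho>))"
      define Q where "Q = (\<sigma> + \<rho>) * kp"
      have Q: "0 < Q" using \<sigma>0 P k3 by (simp add: Q_def)
      have TT: "0 < T' + T" using P by simp
      have "(\<sigma> - \<rho>) * Q * (T' + T) = t1 * (X' - X) * (T' + T)" using a(1) by (simp add: Q_def)
      also have "\<dots> < t1 * (X' - X) * ((X' + X) * Q)"
        using a(3) t XX by (intro mult_strict_left_mono) (auto simp: Q_def algebra_simps)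
      also have "\<dots> = t1 * Q * ((T' - T) * (T' + T))" unfolding a(2) by (simp only: mult_ac)
      also have "\<dots> = t1 * (T' - T) * Q * (T' + T)" by (simp only: mult_ac)
      finally have "(\<sigma> - \<rho>) * (Q * (T' + T)) < t1 * (T' - T) * (Q * (T' + T))" by (simp only: mult.assoc)
      then show ?thesis using mult_pos_pos[OF Q TT] by (simp only: mult_less_cancel_right_pos)
    qed
    have t2: "t2 = \<rho> - t1 * T" using pos by (simp add: q1 T_def r1 right_diff_distrib \<rho>_def)
    moreover have "t2 = \<rho>' - t1 * T'" using pos by (simp add: q2 T'_def r2 right_diff_distrib \<rho>'_def)
    ultimately have False using main \<rho>\<sigma> by (simp add: algebra_simps)
    then show ?thesis ..
  qed
qed

lemma helix_params_unique:
  assumes "helix_params s v w t1 t2" "helix_params s' v' w' t1 t2" "0 < t1" "0 < t2"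
  shows "s = s'" "v = v'" "w = w'"
proof -
  have "s = s' \<and> v = v' \<and> w = w'"
    using helix_params_unique_aux[OF assms] helix_params_unique_aux[OF assms(2,1,3,4)]
    by (cases "v' / s' \<le> v / s") auto
  then show "s = s'" "v = v'" "w = w'" by auto
qed

section \<open>Identification of the helix parameters with \<open>Lambda_inv\<close>\<close>

lemma norm_sq_2: "(norm (x::real^2))\<^sup>2 = (x $ 1)\<^sup>2 + (x $ 2)\<^sup>2"
  unfolding power2_norm_eq_inner by (simp add: inner_vec_def sum_2 power2_eq_square)

lemma Lambda_components:
  assumes s: "pi < norm V" "norm V < theta1"
  shows "Lambda V $ 1 = kap_slope (norm V) / (kap (norm V))\<^sup>2 * (V $ 2)\<^sup>2 * V $ 1"
    "Lambda V $ 2 = V $ 2 * (kap_slope (norm V) / (kap (norm V))\<^sup>2 * (V $ 2)\<^sup>2 - 2 / kap (norm V))"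
proof -
  have "norm V \<noteq> 0" using s pi_gt_zero by linarith
  then have p: "deriv psi (norm V) / norm V = kap_slope (norm V) / (kap (norm V))\<^sup>2"
    unfolding deriv_psi[OF s] by simp
  show "Lambda V $ 1 = kap_slope (norm V) / (kap (norm V))\<^sup>2 * (V $ 2)\<^sup>2 * V $ 1"
    "Lambda V $ 2 = V $ 2 * (kap_slope (norm V) / (kap (norm V))\<^sup>2 * (V $ 2)\<^sup>2 - 2 / kap (norm V))"
    unfolding Lambda_def p psi_kap[OF s] by (simp_all add: power2_eq_square)
qed

lemma Omega_helix_params:
  assumes "V \<in> Omega_m4"
  shows "helix_params (norm V) (V $ 1) (- V $ 2) (Lambda V $ 1 / 4) (Lambda V $ 2 / 4)"
    "0 < Lambda V $ 1" "0 < Lambda V $ 2"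
proof -
  define s where "s = norm V"
  have V: "V $ 2 < 0" "pi < V $ 1" "V $ 1 < s" "s < theta1"
    "2 * psi s + deriv psi s / s * (V $ 2)\<^sup>2 < 0" using assms by (auto simp: Omega_m4_def s_def)
  have s: "pi < s" "s < theta1" "s \<noteq> 0" "0 < V $ 1" using V pi_gt_zero by linarith+
  have k: "0 < kap s" by (rule kap_pos[OF s(1,2)])
  have g: "1 \<le> kap_slope s" using kap_slope_ge_1 s by simp
  note L = Lambda_components[of V, folded s_def, OF s(1,2)]
  show "helix_params (norm V) (V $ 1) (- V $ 2) (Lambda V $ 1 / 4) (Lambda V $ 2 / 4)"
  proof -
    have "s\<^sup>2 = (V $ 1)\<^sup>2 + (V $ 2)\<^sup>2" unfolding s_def by (rule norm_sq_2)
    then show ?thesis unfolding helix_params_def s_def[symmetric] L using s V(1-4) k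
      by (auto simp: field_simps power2_eq_square)
  qed
  show "0 < Lambda V $ 1" unfolding L using g k V s by (auto intro!: mult_pos_pos divide_pos_pos)
  have "kap_slope s / (kap s)\<^sup>2 * (V $ 2)\<^sup>2 - 2 / kap s < 0"
    using V(5) s unfolding deriv_psi[OF s(1,2)] psi_kap[OF s(1,2)] by simp
  then show "0 < Lambda V $ 2" unfolding L using V(1) by (simp add: mult_neg_neg)
qed

lemma Lambda_inj: "inj_on Lambda Omega_m4"
proof (rule inj_onI)
  fix V V' assume V: "V \<in> Omega_m4" "V' \<in> Omega_m4" "Lambda V = Lambda V'"
  note o = Omega_helix_params[OF V(1)] and o' = Omega_helix_params[OF V(2), folded V(3)]
  have "V $ 1 = V' $ 1" "- V $ 2 = - V' $ 2"
    using helix_params_unique[OF o(1) o'(1)] o(2,3) by auto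
  then show "V = V'" by (simp add: vec_eq_iff forall_2)
qed

text \<open>Both nontrivial conditions of \<open>Omega_m4\<close>, the bound \<open>pi < v\<close>
  and the sign of the last expression, follow from \<open>u $ 2 > 0\<close> by
  \<open>helix_params_pi\<close>; injectivity then evaluates the inverse.\<close>

lemma helix_params_Lambda_inv:
  assumes g: "helix_params s v w (u $ 1 / 4) (u $ 2 / 4)" and u: "0 < u $ 2"
  shows "Lambda_inv u = vector [v, - w]"
proof -
  define V :: "real^2" where "V = vector [v, - w]"
  have V: "V $ 1 = v" "V $ 2 = - w" by (simp_all add: V_def)
  have s: "pi < s" "s < theta1" and w: "0 < w" and s2: "s\<^sup>2 = v\<^sup>2 + w\<^sup>2"
    and t: "u $ 1 / 4 = kap_slope s * (w / (2 * kap s))\<^sup>2 * v"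
      "u $ 2 / 4 = w * (1 / (2 * kap s) - kap_slope s * (w / (2 * kap s))\<^sup>2)"
    using g by (auto simp: helix_params_def)
  have sp: "0 < s" using s pi_gt_zero by linarith
  have vp: "pi < v" "kap_slope s * w\<^sup>2 < 2 * kap s" using helix_params_pi[OF g] u by auto
  have k: "0 < kap s" by (rule kap_pos[OF s])
  have nV: "norm V = s"
  proof -
    have "(norm V)\<^sup>2 = s\<^sup>2" by (simp add: norm_sq_2 V s2)
    then show ?thesis using sp by (simp add: power2_eq_iff_nonneg)
  qed
  have "v\<^sup>2 < s\<^sup>2" using s2 w by simp
  then have vs: "v < s" using sp by (simp add: power2_less_imp_less)
  have "2 * psi s + deriv psi s / s * w\<^sup>2 < 0"
    unfolding deriv_psi[OF s] psi_kap[OF s] using sp k vp(2) by (simp add: field_simps power2_eq_square)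
  then have VO: "V \<in> Omega_m4" by (simp add: Omega_m4_def V nV w vp vs s)
  have "Lambda V $ 1 = 4 * (u $ 1 / 4)" "Lambda V $ 2 = 4 * (u $ 2 / 4)"
    unfolding Lambda_components[of V, unfolded nV, OF s] t V using k
    by (simp_all add: field_simps power2_eq_square)
  then have "Lambda V = u" by (simp add: vec_eq_iff forall_2)
  then have "Lambda_inv u = V" unfolding Lambda_inv_def using the_inv_into_f_eq[OF Lambda_inj _ VO] by simp
  then show ?thesis by (simp add: V_def)
qed

lemma phi_helix_params:
  assumes s: "pi < s" "s < theta1" and s2: "s\<^sup>2 = v\<^sup>2 + w\<^sup>2"
    and t: "t $ 1 = \<beta> * v" "t $ 2 = w * (1 / (2 * kap s) - \<beta>)" "t $ 3 = 0"
  shows "phi (e1, t) (vector [v, - w, 0]) = 1 + (4 * s\<^sup>2 * \<beta> - w\<^sup>2 / kap s)"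
proof -
  let ?\<tau> = "vector [v, - w, 0] :: real^3"
  have sp: "0 < s" using s pi_gt_zero by linarith
  have k: "0 < kap s" by (rule kap_pos[OF s])
  have "(norm ?\<tau>)\<^sup>2 = s\<^sup>2" by (simp add: norm_sq_3 s2)
  then have n: "norm ?\<tau> = s" using sp by (simp add: power2_eq_iff_nonneg)
  have "1 - s * cot s = s\<^sup>2 * psi s" using sp by (simp add: psi_def)
  then have c: "s * cot s = 1 + s\<^sup>2 / kap s" unfolding psi_kap[OF s] by simp
  have "phi (e1, t) ?\<tau> = s * cot s + psi s * v\<^sup>2 + 4 * (\<beta> * v * v - w * (1 / (2 * kap s) - \<beta>) * w)"
    unfolding phi_def n by (simp add: inner_vec_def sum_3 t) (simp add: e1_def)
  also have "\<dots> = 1 + (4 * s\<^sup>2 * \<beta> - w\<^sup>2 / kap s)"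
    unfolding c psi_kap[OF s] s2 using k by (simp add: field_simps power2_eq_square)
  finally show ?thesis .
qed

text \<open>Valid for every \<open>\<gamma>\<close>, because the integral of a function that is not
  integrable is 0.\<close>

lemma curve_length_nonneg: "0 \<le> curve_length \<gamma>"
  unfolding curve_length_def
  by (cases "(\<lambda>s. norm (fst (vector_derivative \<gamma> (at s)))) integrable_on {0..1}")
    (auto intro: Henstock_Kurzweil_Integration.integral_nonneg simp: not_integrable_integral)

theorem theorem11p6:
  fixes u :: "real^2"
  assumes "u \<in> R2_lt_plus"
  shows "(cc_dist (e1, (1/4) *\<^sub>R vector [u$1, u$2, 0]))^2
           = phi (e1, (1/4) *\<^sub>R vector [u$1, u$2, 0])
                 (vector [(Lambda_inv u)$1, (Lambda_inv u)$2, 0])"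
proof -
  define t :: "real^3" where "t = (1/4) *\<^sub>R vector [u $ 1, u $ 2, 0]"
  have u: "0 < u $ 1" "0 < u $ 2" "u $ 2 < 2 / sqrt pi * sqrt (u $ 1)" using assms by (auto simp:
      R2_lt_plus_def)
  have tc: "t $ 1 = u $ 1 / 4" "t $ 2 = u $ 2 / 4" "t $ 3 = 0" by (simp_all add: t_def)
  have "(u $ 2)\<^sup>2 < (2 / sqrt pi * sqrt (u $ 1))\<^sup>2" using u by (intro power_strict_mono) auto
  also have "\<dots> = 4 * u $ 1 / pi" using u by (simp add: power_mult_distrib power_divide)
  finally have "pi * (u $ 2 / 4)\<^sup>2 < u $ 1 / 4" by (simp add: field_simps power2_eq_square)
  then obtain s v w \<beta> where s: "pi < s" "s < theta1" and vw: "0 < v" "0 < w" "s\<^sup>2 = v\<^sup>2 + w\<^sup>2"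
    and \<beta>: "\<beta> = kap_slope s * (w / (2 * kap s))\<^sup>2" and tb: "u $ 1 / 4 = \<beta> * v" "u $ 2 / 4 = w * (1 / (2 *
        kap s) - \<beta>)"
    and low: "\<And>m. \<exists>\<tau>. norm \<tau> < theta1 \<and> 4 * s\<^sup>2 * \<beta> - w\<^sup>2 / kap s \<le> energy_lb t m \<tau>"
    using minimal_value[OF tc] u by auto
  define K where "K = 4 * s\<^sup>2 * \<beta> - w\<^sup>2 / kap s"
  have tv: "t = vector [\<beta> * v, w * (1 / (2 * kap s) - \<beta>), 0]"
    by (simp add: vec_eq_iff forall_3 tc tb)
  obtain \<gamma> where \<gamma>: "horizontal_curve \<gamma> (e1, t)" "curve_length \<gamma> = sqrt (1 + K)"
    using helix[OF s vw \<beta>] unfolding tv K_def by blast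
  have K1: "0 \<le> 1 + K" using curve_length_nonneg[of \<gamma>] \<gamma>(2) by simp
  have "sqrt (1 + K) \<le> curve_length \<gamma>'" if hc: "horizontal_curve \<gamma>' (e1, t)" for \<gamma>'
  proof -
    obtain m where m: "\<forall>\<tau>. norm \<tau> < theta1 \<longrightarrow> energy_lb t m \<tau> \<le> (curve_length \<gamma>')\<^sup>2 - 1"
      using curve_bound[OF hc] by blast
    \<comment> \<open>The mean \<open>m\<close> belongs to the given curve, and the multiplier is
      chosen in dependence on it; this is the order of quantifiers in the min-max.\<close>
    obtain \<tau> where "norm \<tau> < theta1" "K \<le> energy_lb t m \<tau>" using low[of m] by (auto simp: K_def)
    then have "1 + K \<le> (curve_length \<gamma>')\<^sup>2" using m by fastforce
    then show ?thesis using curve_length_nonneg by (intro real_le_lsqrt) auto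
  qed
  moreover have "sqrt (1 + K) \<in> {curve_length \<gamma> |\<gamma>. horizontal_curve \<gamma> (e1, t)}"
    unfolding mem_Collect_eq using \<gamma> by (intro exI[of _ \<gamma>]) simp
  ultimately have "cc_dist (e1, t) = sqrt (1 + K)"
    unfolding cc_dist_def by (intro cInf_eq_minimum) auto
  then have d: "(cc_dist (e1, t))\<^sup>2 = 1 + K" using K1 by simp
  have "helix_params s v w (u $ 1 / 4) (u $ 2 / 4)" unfolding helix_params_def using s vw tb \<beta> by simp
  then have inv: "Lambda_inv u = vector [v, - w]" using helix_params_Lambda_inv u by blast
  have "phi (e1, t) (vector [v, - w, 0]) = 1 + K"
    unfolding K_def by (rule phi_helix_params[OF s vw(3)]) (simp_all add: tc tb)
  then show ?thesis using d inv by (simp add: t_def)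
qed

end
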